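(* Let $H_1,\dots,H_p$ be arbitrary hyperplanes in $\mathbb{P}^n(\mathbb{C})$ with defining linear forms $L_1,\dots,L_p$. Let $f:\mathbb{C}\to\mathbb{P}^n(\mathbb{C})$ be a holomorphic map with a reduced representation $\mathbf{f}=(f_0,\dots,f_n)$ such that $f_0,\dots,f_n$ are linearly independent over $\mathbb{C}$, and suppose $$\limsup_{r\to\infty}\frac{\log^+\log^+T_f(r)}{\log\log r}<1.$$ Then $$\int_0^{2\pi}\max_{\mathcal{K}}\sum_{j\in\mathcal{K}}\log\frac{\|\mathbf{f}(re^{i\theta})\|}{|L_j(\mathbf{f})(re^{i\theta})|}\frac{d\theta}{2\pi}+N\!\left(r,\frac{1}{\mathcal{W}}\right)\le(n+1)T_f(r)+S_{\log}(r,f)$$ as $r\to\infty$ outside a set $F$ with $\int_F\frac{dt}{t\log t}<\infty$, where $\mathcal{W}=\mathcal{W}(f_0,\dots,f_n)$ and the maximum is over all subsets $\mathcal{K}\subset\{1,\dots,p\}$ such that the linear forms $L_j$, $j\in\mathcal{K}$, are linearly independent.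
   Context: Fix $q\in\mathbb{C}$ with $0<|q|<1$. Every $x\in\mathbb{C}$ is written uniquely as $x=\frac{z+z^{-1}}{2}$ with $|z|\ge 1$ (when $|z|=1$, $z=x+i\sqrt{1-x^2}$). $(\eta_q f)(x)=f\big(\tfrac{q^{1/2}z+q^{-1/2}z^{-1}}{2}\big)$, $(\eta_q^{-1}f)(x)=f\big(\tfrac{q^{-1/2}z+q^{1/2}z^{-1}}{2}\big)$, $(\eta_{q^{\pm k}}f)(x)=f\big(\tfrac{q^{\pm k/2}z+q^{\mp k/2}z^{-1}}{2}\big)$. Askey-Wilson operator $(\mathcal{D}_qf)(x)=\frac{(\eta_qf)(x)-(\eta_q^{-1}f)(x)}{\eta_qx-\eta_q^{-1}x}$ ($x\ne\pm1$; limit at $\pm1$), $\mathcal{D}_q^0f=f$, $\mathcal{D}_q^k=\mathcal{D}_q\circ\mathcal{D}_q^{k-1}$; $(\mathcal{A}_{q^k}f)(x)=\frac{(\eta_{q^k}f)(x)+(\eta_{q^{-k}}f)(x)}{2}$, $\mathcal{A}_{q^0}f=f$. The Askey-Wilson Wronskian-Casorati determinant is $\mathcal{W}(f_0,\dots,f_n)(x)=\det\big(\mathcal{A}_{q^{n-i}}\mathcal{D}_q^{i}f_j\big)_{0\le i,j\le n}(x)$. A reduced representation of $f$ is a tuple of entire functions without common zeros representing $f$; $\|\mathbf{f}(z)\|=\max_k|f_k(z)|$ and $T_f(r)=\int_0^{2\pi}\log\|\mathbf{f}(re^{i\theta})\|\frac{d\theta}{2\pi}$. $N(r,1/g)$ is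 the standard integrated counting function of zeros. $S_{\log}(r,f)$ denotes any quantity of the form $O\big(\frac{T_f(r)}{\log\log r}\big)+O(\log r)$. *)

theory Defs
  imports "HOL-Complex_Analysis.Complex_Analysis"
begin

text \<open>The unique z with x = (z + 1/z)/2 and |z| > 1, or, on the segment [-1,1]
  (where |z| = 1), z = x + i sqrt(1 - x^2).\<close>
definition aw_z :: "complex \<Rightarrow> complex" where
  "aw_z x = (if \<exists>z. 1 < cmod z \<and> x = (z + inverse z) / 2
             then (THE z. 1 < cmod z \<and> x = (z + inverse z) / 2)
             else x + \<i> * csqrt (1 - x\<^sup>2))"

text \<open>Shift with multiplier s: (f)((s z + s^{-1} z^{-1})/2). With s = q^{k/2} this is
  eta_{q^k}; with s = q^{-k/2} it is eta_{q^{-k}}. Here q^{1/2} := csqrt q.\<close>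
definition aw_eta :: "complex \<Rightarrow> (complex \<Rightarrow> complex) \<Rightarrow> complex \<Rightarrow> complex" where
  "aw_eta s f x = f ((s * aw_z x + inverse s * inverse (aw_z x)) / 2)"

definition aw_quot :: "complex \<Rightarrow> (complex \<Rightarrow> complex) \<Rightarrow> complex \<Rightarrow> complex" where
  "aw_quot q f x =
     (aw_eta (csqrt q) f x - aw_eta (inverse (csqrt q)) f x) /
     (aw_eta (csqrt q) id x - aw_eta (inverse (csqrt q)) id x)"

definition aw_D :: "complex \<Rightarrow> (complex \<Rightarrow> complex) \<Rightarrow> complex \<Rightarrow> complex" where
  "aw_D q f x = (if x = 1 \<or> x = -1 then Lim (at x) (aw_quot q f) else aw_quot q f x)"

definition aw_D_pow :: "complex \<Rightarrow> nat \<Rightarrow> (complex \<Rightarrow> complex) \<Rightarrow> complex \<Rightarrow> complex" where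
  "aw_D_pow q k f = (aw_D q ^^ k) f"

definition aw_A :: "complex \<Rightarrow> nat \<Rightarrow> (complex \<Rightarrow> complex) \<Rightarrow> complex \<Rightarrow> complex" where
  "aw_A q k f x = (if k = 0 then f x else
     (aw_eta (csqrt q ^ k) f x + aw_eta (inverse (csqrt q) ^ k) f x) / 2)"

definition aw_wronskian :: "complex \<Rightarrow> nat \<Rightarrow> (nat \<Rightarrow> complex \<Rightarrow> complex) \<Rightarrow> complex \<Rightarrow> complex" where
  "aw_wronskian q n fs x =
     (\<Sum>\<sigma> | \<sigma> permutes {0..n}. of_int (sign \<sigma>) *
        (\<Prod>i\<in>{0..n}. aw_A q (n - i) (aw_D_pow q i (fs (\<sigma> i))) x))"

definition vnorm :: "nat \<Rightarrow> (nat \<Rightarrow> complex \<Rightarrow> complex) \<Rightarrow> complex \<Rightarrow> real" where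
  "vnorm n fs z = Max ((\<lambda>k. cmod (fs k z)) ` {0..n})"

definition char_T :: "nat \<Rightarrow> (nat \<Rightarrow> complex \<Rightarrow> complex) \<Rightarrow> real \<Rightarrow> real" where
  "char_T n fs r = integral {0..2*pi} (\<lambda>\<theta>. ln (vnorm n fs (of_real r * cis \<theta>))) / (2*pi)"

definition zero_count :: "(complex \<Rightarrow> complex) \<Rightarrow> real \<Rightarrow> real" where
  "zero_count g t = (\<Sum>z\<in>{z. cmod z \<le> t \<and> g z = 0}. real (nat (zorder g z)))"

definition count_N :: "(complex \<Rightarrow> complex) \<Rightarrow> real \<Rightarrow> real" where
  "count_N g r = integral {0..r} (\<lambda>t. (zero_count g t - zero_count g 0) / t)
                 + zero_count g 0 * ln r"

definition log_plus :: "real \<Rightarrow> real" where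
  "log_plus x = max 0 (ln x)"

definition lin_form :: "nat \<Rightarrow> (nat \<Rightarrow> complex) \<Rightarrow> (nat \<Rightarrow> complex \<Rightarrow> complex) \<Rightarrow> complex \<Rightarrow> complex" where
  "lin_form n c fs z = (\<Sum>k\<le>n. c k * fs k z)"

definition forms_indep :: "nat \<Rightarrow> (nat \<Rightarrow> nat \<Rightarrow> complex) \<Rightarrow> nat set \<Rightarrow> bool" where
  "forms_indep n a K \<longleftrightarrow>
     (\<forall>c :: nat \<Rightarrow> complex. (\<forall>k\<le>n. (\<Sum>j\<in>K. c j * a j k) = 0) \<longrightarrow> (\<forall>j\<in>K. c j = 0))"

end

theory Submission
  imports Defs "HOL-Real_Asymp.Real_Asymp" "Jordan_Normal_Form.Determinant"
begin

text \<open>No lemma on the logarithmic difference is needed. Genus-zero Hadamard factorisation of one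
  component gives \<open>fs k = exp h * ft k\<close> with \<open>h\<close> entire, where every \<open>ft k\<close> has slowly growing
  \<open>\<phi> g r = ln (sup |x| \<le> r. |g x|)\<close>, i.e. \<open>\<phi> g r \<le> exp (K (1 + ln r) powr \<rho>)\<close> with \<open>\<rho> < 1\<close>. Outside an
  exceptional set \<open>\<phi> g (C r) - \<phi> g (r / C) = O(T / ln ln r)\<close>, and then Harnack's inequality shows that
  \<open>ln |g|\<close> differs from the constant \<open>\<phi> g r\<close> on \<open>|x| = r\<close> by \<open>O(T / ln ln r)\<close> in the mean. Write \<open>\<Phi>\<close> for
  the largest \<open>\<phi> (ft k)\<close>, which is \<open>T\<close> up to such an error. The integrated maximum is therefore at most
  the largest of the sums \<open>\<Sum>j\<in>K. \<Phi> r - \<phi> (L j) r\<close>. The Wronskian is a bounded multiple of the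
  determinant of the values of the components at \<open>n + 1\<close> points \<open>y k = O(r)\<close>; after a change of basis
  that contains the \<open>L j\<close> for the optimal \<open>K\<close>, Jensen's formula bounds \<open>N(r, 1 / W)\<close> by
  \<open>\<Sum>j\<in>K. \<phi> (L j) r + (n + 1 - |K|) \<Phi> r\<close>, and the sum of the two bounds is \<open>(n + 1) \<Phi> r\<close>.\<close>

section \<open>Circle means and the Poisson-Jensen inequality\<close>


text \<open>The growth hypothesis bounds no single component: a common factor \<open>exp h\<close>
  with \<open>h\<close> entire may grow arbitrarily fast, while it shifts the characteristic only by
  the constant \<open>Re (h 0)\<close>. Values at radius \<open>C r\<close> are not comparable with
  values at radius \<open>r\<close> until such a factor is divided out. It returns in the
  determinant of point values as the exponential of the sum of the \<open>h (y k)\<close>, and the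
  symmetry of the points makes this sum an entire function of \<open>x\<close>, so its real part has
  constant circle means and costs O(1). The condition \<rho> < 1 acts twice: it makes the sum of 1 /
  |a| over the zeros converge, and it leaves room for a logarithm between
  \<open>s powr \<rho>\<close> and \<open>s\<close> on the scale \<open>s = ln r\<close>. There the
  measure dt / (t ln t) becomes ds / s, and the loss 1 / ln ln r becomes 1 / ln s. The constant
  \<open>C\<close> depends only on \<open>q\<close> and \<open>n\<close>, so the exceptional set can
  be fixed before the optimal set of forms, which varies with \<open>r\<close>. Only finitely many
  such sets exist, hence constants attached to them are harmless.\<close>

lemma entire_factor_point:
  fixes f :: "complex \<Rightarrow> complex"
  assumes f: "f holomorphic_on UNIV" and nz: "\<exists>w. f w \<noteq> 0"
  obtains g where "g holomorphic_on UNIV" "\<And>x. f x = (x - a) ^ nat (zorder f a) * g x" "g a \<noteq> 0"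
proof -
  define m where "m = nat (zorder f a)"
  define p where "p = zor_poly f a"
  from zorder_exist_zero[OF f open_UNIV connected_UNIV UNIV_I, of a] nz
  obtain r where r: "r > 0" "p holomorphic_on cball a r"
    "\<And>w. w \<in> cball a r \<Longrightarrow> f w = p w * (w - a) ^ m \<and> p w \<noteq> 0"
    unfolding m_def p_def by blast
  define g where "g x = (if x = a then p a else f x / (x - a) ^ m)" for x
  have geq: "g w = p w" if "w \<in> cball a r" for w
    using r(3)[OF that] by (auto simp: g_def)
  have "g holomorphic_on ball a r"
    using holomorphic_transform[OF holomorphic_on_subset[OF r(2) ball_subset_cball]] geq by auto
  moreover have "g holomorphic_on (- {a})"
  proof (rule holomorphic_transform)
    show "(\<lambda>x. f x / (x - a) ^ m) holomorphic_on (- {a})"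
      by (intro holomorphic_intros holomorphic_on_subset[OF f]) auto
  qed (auto simp: g_def)
  ultimately have "g holomorphic_on (ball a r \<union> - {a})"
    by (intro holomorphic_on_Un) auto
  moreover have "ball a r \<union> - {a} = UNIV" using r(1) by auto
  ultimately have "g holomorphic_on UNIV" by simp
  moreover have "f x = (x - a) ^ m * g x" for x
    using r(1) r(3)[of a] by (auto simp: g_def)
  moreover have "g a \<noteq> 0" using r(1) r(3)[of a] by (auto simp: g_def)
  ultimately show ?thesis using that unfolding m_def by blast
qed

lemma entire_factor_finite:
  fixes f :: "complex \<Rightarrow> complex"
  assumes f: "f holomorphic_on UNIV" and nz: "\<exists>w. f w \<noteq> 0" and fin: "finite A"
  shows "\<exists>g. g holomorphic_on UNIV \<and> (\<forall>x. f x = (\<Prod>a\<in>A. (x - a) ^ nat (zorder f a)) * g x)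
              \<and> (\<forall>a\<in>A. g a \<noteq> 0)"
  using fin
proof (induction A rule: finite_induct)
  case empty
  then show ?case using f by (intro exI[of _ f]) auto
next
  case (insert b A)
  then obtain g where g: "g holomorphic_on UNIV" "\<And>x. f x = (\<Prod>a\<in>A. (x - a) ^ nat (zorder f a)) * g x"
    "\<And>a. a \<in> A \<Longrightarrow> g a \<noteq> 0" by blast
  have "\<exists>w. g w \<noteq> 0" using nz g(2) by (metis mult_zero_right)
  from entire_factor_point[OF g(1) this, of b] obtain g' where
    g': "g' holomorphic_on UNIV" "\<And>x. g x = (x - b) ^ nat (zorder g b) * g' x" "g' b \<noteq> 0" by blast
  define P where "P x = (\<Prod>a\<in>A. (x - a) ^ nat (zorder f a))" for x
  have "P b \<noteq> 0" using insert by (auto simp: P_def)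
  \<comment> \<open>The factors belonging to \<open>A\<close> do not vanish at \<open>b\<close>, so
    dividing them out leaves the order at \<open>b\<close> unchanged.\<close>
  have "zorder f b = int (nat (zorder g b))"
  proof (rule zorder_eqI[of UNIV _ "\<lambda>x. P x * g' x"])
    show "(\<lambda>x. P x * g' x) holomorphic_on UNIV" unfolding P_def
      by (intro holomorphic_intros g')
    show "f w = P w * g' w * (w - b) powi int (nat (zorder g b))" for w
      using g(2)[of w] g'(2)[of w] unfolding P_def by (simp only: power_int_of_nat mult_ac)
  qed (use \<open>P b \<noteq> 0\<close> g' in auto)
  then have "f x = (\<Prod>a\<in>insert b A. (x - a) ^ nat (zorder f a)) * g' x" for x
    using g(2)[of x] g'(2)[of x] insert by (simp add: algebra_simps)
  moreover have "g' a \<noteq> 0" if "a \<in> insert b A" for a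
    using that g(3)[of a] g'(2)[of a] g'(3) by auto
  ultimately show ?case using g'(1) by blast
qed

lemma entire_finite_zeros:
  fixes f :: "complex \<Rightarrow> complex"
  assumes "f holomorphic_on UNIV" and "\<exists>w. f w \<noteq> 0"
  shows "finite {z. cmod z \<le> R \<and> f z = 0}"
proof -
  have "finite {z\<in>cball 0 R. f z = 0}"
  proof (cases "f constant_on UNIV")
    case True
    then have "{z\<in>cball 0 R. f z = 0} = {}" using assms(2) by (auto simp: constant_on_def)
    then show ?thesis by (metis finite.emptyI)
  qed (rule holomorphic_compact_finite_zeros[OF assms(1) open_UNIV connected_UNIV compact_cball subset_UNIV])
  then show ?thesis by simp
qed

lemma entire_factor_cball:
  fixes f :: "complex \<Rightarrow> complex"
  assumes f: "f holomorphic_on UNIV" and nz: "\<exists>w. f w \<noteq> 0"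
  obtains g where "g holomorphic_on UNIV"
    "\<And>x. f x = (\<Prod>a | cmod a \<le> R \<and> f a = 0. (x - a) ^ nat (zorder f a)) * g x"
    "\<And>x. cmod x \<le> R \<Longrightarrow> g x \<noteq> 0"
proof -
  let ?A = "{a. cmod a \<le> R \<and> f a = 0}"
  have fin: "finite ?A" using entire_finite_zeros[OF assms] .
  from entire_factor_finite[OF assms this] obtain g where g: "g holomorphic_on UNIV"
    "\<And>x. f x = (\<Prod>a\<in>?A. (x - a) ^ nat (zorder f a)) * g x" "\<And>a. a \<in> ?A \<Longrightarrow> g a \<noteq> 0" by blast
  have "g x \<noteq> 0" if "cmod x \<le> R" for x
    using that g(2)[of x] g(3)[of x] by force
  then show ?thesis using that g by blast
qed

section \<open>Circle means and the Poisson formula\<close>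

definition circle_mean :: "(complex \<Rightarrow> real) \<Rightarrow> real \<Rightarrow> real" where
  "circle_mean u r = integral {0..2*pi} (\<lambda>\<theta>. u (of_real r * cis \<theta>)) / (2*pi)"

lemma circle_param_continuous:
  assumes "continuous_on (sphere 0 r) u" "0 \<le> r"
  shows "continuous_on {0..2*pi} (\<lambda>\<theta>. u (complex_of_real r * cis \<theta>))"
  by (rule continuous_on_compose2[OF assms(1)])
     (use assms(2) in \<open>auto intro!: continuous_intros simp: norm_mult\<close>)

lemma circle_param_integrable:
  assumes "continuous_on (sphere 0 r) (u :: complex \<Rightarrow> real)" "0 \<le> r"
  shows "(\<lambda>\<theta>. u (complex_of_real r * cis \<theta>)) integrable_on {0..2*pi}"
  by (rule integrable_continuous_real[OF circle_param_continuous[OF assms]])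

lemma circle_mean_mono:
  assumes "continuous_on (sphere 0 r) u" "continuous_on (sphere 0 r) v" "0 \<le> r"
    "\<And>x. cmod x = r \<Longrightarrow> u x \<le> v x"
  shows "circle_mean u r \<le> circle_mean v r"
  unfolding circle_mean_def
  by (intro divide_right_mono integral_le circle_param_integrable assms)
     (use assms(3) in \<open>auto simp: norm_mult\<close>)

lemma circle_mean_cong:
  assumes "0 \<le> r" "\<And>x. cmod x = r \<Longrightarrow> u x = v x"
  shows "circle_mean u r = circle_mean v r"
proof -
  have "u (of_real r * cis \<theta>) = v (of_real r * cis \<theta>)" for \<theta>
    using assms by (auto simp: norm_mult)
  then show ?thesis unfolding circle_mean_def by simp
qed

lemma circle_mean_add:
  assumes "continuous_on (sphere 0 r) u" "continuous_on (sphere 0 r) v" "0 \<le> r"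
  shows "circle_mean (\<lambda>x. u x + v x) r = circle_mean u r + circle_mean v r"
  unfolding circle_mean_def
  by (simp add: integral_add circle_param_integrable assms add_divide_distrib)

lemma circle_mean_diff:
  assumes "continuous_on (sphere 0 r) u" "continuous_on (sphere 0 r) v" "0 \<le> r"
  shows "circle_mean (\<lambda>x. u x - v x) r = circle_mean u r - circle_mean v r"
  unfolding circle_mean_def
  by (simp add: integral_diff circle_param_integrable assms diff_divide_distrib)

lemma circle_mean_cmult: "circle_mean (\<lambda>x. c * u x) r = c * circle_mean u r"
  unfolding circle_mean_def by simp

lemma circle_mean_const [simp]: "circle_mean (\<lambda>x. c) r = c"
  unfolding circle_mean_def by simp

lemma circle_mean_sum:
  assumes "finite A" "\<And>a. a \<in> A \<Longrightarrow> continuous_on (sphere 0 r) (u a)" "0 \<le> r"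
  shows "circle_mean (\<lambda>x. \<Sum>a\<in>A. u a x) r = (\<Sum>a\<in>A. circle_mean (u a) r)"
  unfolding circle_mean_def
  using assms by (simp add: integral_sum circle_param_integrable sum_divide_distrib)

definition poisson_kernel :: "real \<Rightarrow> complex \<Rightarrow> complex \<Rightarrow> real" where
  "poisson_kernel R x w = (R\<^sup>2 - (cmod x)\<^sup>2) / (cmod (w - x))\<^sup>2"

lemma poisson_kernel_bounds:
  assumes "cmod x < R" "cmod w = R"
  shows "(R - cmod x) / (R + cmod x) \<le> poisson_kernel R x w"
    "poisson_kernel R x w \<le> (R + cmod x) / (R - cmod x)"
proof -
  let ?d = "cmod (w - x)"
  have d: "R - cmod x \<le> ?d" "?d \<le> R + cmod x"
    using assms norm_triangle_ineq2[of w x] norm_triangle_ineq4[of w x] by auto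
  have pos: "0 < R - cmod x" "0 < R + cmod x" using assms norm_ge_zero[of x] by linarith+
  have eq: "R\<^sup>2 - (cmod x)\<^sup>2 = (R - cmod x) * (R + cmod x)"
    by (simp add: power2_eq_square algebra_simps)
  have "(R - cmod x) / (R + cmod x) = (R - cmod x) * (R + cmod x) / (R + cmod x)\<^sup>2"
    using pos by (simp add: power2_eq_square)
  also have "\<dots> \<le> (R - cmod x) * (R + cmod x) / ?d\<^sup>2"
    using d pos by (intro divide_left_mono power_mono mult_nonneg_nonneg mult_pos_pos) auto
  finally show "(R - cmod x) / (R + cmod x) \<le> poisson_kernel R x w"
    by (simp add: poisson_kernel_def eq)
  have "(R - cmod x) * (R + cmod x) / ?d\<^sup>2 \<le> (R - cmod x) * (R + cmod x) / (R - cmod x)\<^sup>2"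
    using d pos by (intro divide_left_mono power_mono mult_nonneg_nonneg mult_pos_pos) auto
  also have "\<dots> = (R + cmod x) / (R - cmod x)"
    using pos by (simp add: power2_eq_square)
  finally show "poisson_kernel R x w \<le> (R + cmod x) / (R - cmod x)"
    by (simp add: poisson_kernel_def eq)
qed

lemma poisson_kernel_nonneg:
  assumes "cmod x < R" "cmod w = R"
  shows "0 \<le> poisson_kernel R x w"
  using assms by (auto simp: poisson_kernel_def intro!: divide_nonneg_nonneg power_mono)

lemma continuous_on_poisson_kernel:
  assumes "cmod x < R"
  shows "continuous_on (sphere 0 R) (poisson_kernel R x)"
  unfolding poisson_kernel_def using assms by (intro continuous_intros) auto

definition poisson_mean :: "(complex \<Rightarrow> real) \<Rightarrow> real \<Rightarrow> complex \<Rightarrow> real" where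
  "poisson_mean u R x = circle_mean (\<lambda>w. u w * poisson_kernel R x w) R"

lemma poisson_mean_0:
  assumes "0 < R" shows "poisson_mean u R 0 = circle_mean u R"
  unfolding poisson_mean_def
  by (rule circle_mean_cong) (use assms in \<open>auto simp: poisson_kernel_def\<close>)

text \<open>By compactness a zero-free closed disc has a zero-free open neighbourhood; on the larger
  open disc a holomorphic logarithm exists, to which the Poisson formula applies.\<close>

lemma cmod_ball_compact_extend:
  fixes g :: "complex \<Rightarrow> complex"
  assumes g: "continuous_on UNIV g" and nz: "\<And>x. cmod x \<le> R \<Longrightarrow> g x \<noteq> 0" and "0 < R"
  obtains R' where "R < R'" "\<And>x. cmod x < R' \<Longrightarrow> g x \<noteq> 0"
proof -
  have "open (g -` (- {0}))" by (intro open_vimage g) auto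
  moreover have "cball 0 R \<subseteq> g -` (- {0})" using nz by auto
  ultimately obtain e where e: "e > 0" "{x. infdist x (cball 0 R) \<le> e} \<subseteq> g -` (- {0})"
    using compact_in_open_separated[of "cball 0 R" "g -` (- {0})"] \<open>0 < R\<close> by auto
  have "g x \<noteq> 0" if "cmod x < R + e" for x
  proof (cases "cmod x \<le> R")
    case False
    \<comment> \<open>The radial projection of \<open>x\<close> to the disc, at distance
      \<open>cmod x - R\<close> from \<open>x\<close>.\<close>
    define y where "y = of_real (R / cmod x) * x"
    have pos: "cmod x > 0" using False \<open>0 < R\<close> by auto
    have y: "y \<in> cball 0 R" using pos \<open>0 < R\<close> by (auto simp: y_def norm_mult norm_divide)
    have "dist x y = cmod (of_real (1 - R / cmod x) * x)"
      by (simp add: dist_norm y_def algebra_simps)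
    also have "\<dots> = \<bar>1 - R / cmod x\<bar> * cmod x" by (simp add: norm_mult del: of_real_diff)
    also have "\<dots> = cmod x - R" using pos False by (simp add: field_simps)
    finally have "infdist x (cball 0 R) \<le> cmod x - R" using infdist_le2[OF y] by simp
    then have "infdist x (cball 0 R) \<le> e" using that by linarith
    then have "x \<in> g -` (- {0})" using e(2) by blast
    then show ?thesis by simp
  qed (use nz in auto)
  then show ?thesis using that[of "R + e"] e(1) by auto
qed

lemma poisson_formula:
  fixes \<kappa> :: "complex \<Rightarrow> complex"
  assumes hol: "\<kappa> holomorphic_on ball 0 R'" and R: "0 < R" "R < R'" and x: "cmod x < R"
  shows "Re (\<kappa> x) = poisson_mean (\<lambda>w. Re (\<kappa> w)) R x"
proof -
  \<comment> \<open>\<open>D\<close> can vanish only at the reflection of \<open>x\<close> in the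
    circle, which lies outside the closed disc.\<close>
  define D where "D w = of_real (R\<^sup>2) - cnj x * w" for w
  have Dnz: "D w \<noteq> 0" if "cmod w \<le> R" for w
  proof
    assume "D w = 0"
    then have "cnj x * w = of_real (R\<^sup>2)" by (simp add: D_def)
    then have "cmod (cnj x * w) = R\<^sup>2" by (simp only: norm_of_real) simp
    moreover have "cmod (cnj x * w) \<le> cmod x * R" using that by (simp add: norm_mult mult_left_mono)
    moreover have "cmod x * R < R\<^sup>2" using x R by (simp add: power2_eq_square)
    ultimately show False by simp
  qed
  \<comment> \<open>\<open>F x = \<kappa> x\<close>, and on the circle the Cauchy kernel of \<open>F\<close> is the Poisson kernel of \<open>\<kappa>\<close>.\<close>
  define F where "F w = \<kappa> w * (of_real (R\<^sup>2 - (cmod x)\<^sup>2) / D w)" for w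
  have holF: "F holomorphic_on cball 0 R"
    unfolding F_def D_def
    by (intro holomorphic_intros holomorphic_on_subset[OF hol]) (use R Dnz in \<open>auto simp: D_def\<close>)
  have Fx: "F x = \<kappa> x"
  proof -
    have "D x = of_real (R\<^sup>2 - (cmod x)\<^sup>2)" 
      by (simp add: D_def complex_norm_square mult.commute flip: of_real_power)
    then show ?thesis using Dnz[of x] x by (simp add: F_def)
  qed
  have "((\<lambda>w. F w / (w - x)) has_contour_integral (2 * of_real pi * \<i> * F x)) (circlepath 0 R)"
    by (rule Cauchy_integral_circlepath)
       (use x holF in \<open>auto intro: holomorphic_on_imp_continuous_on holomorphic_on_subset\<close>)
  then have "((\<lambda>t. F (circlepath 0 R t) / (circlepath 0 R t - x) *
       vector_derivative (circlepath 0 R) (at t within {0..1})) has_integral 2 * of_real pi * \<i> * \<kappa> x) {0..1}"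
    by (simp add: has_contour_integral_def Fx)
  then have I1: "((\<lambda>t. 2 * of_real pi * \<i> * (\<kappa> (of_real R * cis (2*pi*t)) *
        of_real (poisson_kernel R x (of_real R * cis (2*pi*t))))) has_integral 2 * of_real pi * \<i> * \<kappa> x) {0..1}"
  proof (rule has_integral_eq[rotated])
    fix t :: real assume t: "t \<in> {0..1}"
    define w where "w = complex_of_real R * cis (2*pi*t)"
    have cw: "circlepath 0 R t = w"
      by (simp add: circlepath w_def cis_conv_exp mult_ac)
    have vd: "vector_derivative (circlepath 0 R) (at t within {0..1}) = 2 * of_real pi * \<i> * w"
      using t by (simp add: vector_derivative_circlepath01 w_def cis_conv_exp mult_ac)
    have nw: "cmod w = R" using R by (simp add: w_def norm_mult)
    have ww: "w * cnj w = of_real (R\<^sup>2)" using complex_norm_square[of w] nw by simp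
    have wx: "w \<noteq> x" using nw x by auto
    have "D w = w * cnj (w - x)" using ww by (simp add: D_def algebra_simps)
    moreover have "w \<noteq> 0" using nw R by auto
    ultimately have *: "w / (D w * (w - x)) = 1 / of_real ((cmod (w - x))\<^sup>2)"
      unfolding complex_norm_square by (simp add: mult_ac del: complex_cnj_diff)
    have "F w / (w - x) * (2 * of_real pi * \<i> * w) =
        2 * of_real pi * \<i> * (\<kappa> w * (of_real (R\<^sup>2 - (cmod x)\<^sup>2) * (w / (D w * (w - x)))))"
      by (simp add: F_def field_simps)
    also have "\<dots> = 2 * of_real pi * \<i> * (\<kappa> w * of_real (poisson_kernel R x w))"
      unfolding * by (simp add: poisson_kernel_def)
    finally show "F (circlepath 0 R t) / (circlepath 0 R t - x) *
       vector_derivative (circlepath 0 R) (at t within {0..1}) =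
       2 * of_real pi * \<i> * (\<kappa> (of_real R * cis (2*pi*t)) *
        of_real (poisson_kernel R x (of_real R * cis (2*pi*t))))"
      unfolding cw vd by (simp add: w_def)
  qed
  then have "((\<lambda>t. \<kappa> (of_real R * cis (2*pi*t)) *
        of_real (poisson_kernel R x (of_real R * cis (2*pi*t)))) has_integral \<kappa> x) {0..1}"
    by (subst (asm) has_integral_mult_right_iff) auto
  then have "((\<lambda>t. Re (\<kappa> (of_real R * cis (2*pi*t)) *
        of_real (poisson_kernel R x (of_real R * cis (2*pi*t))))) has_integral Re (\<kappa> x)) {0..1}"
    by (rule has_integral_Re)
  then have I2: "((\<lambda>t. Re (\<kappa> (of_real R * cis (2*pi*t))) *
        poisson_kernel R x (of_real R * cis (2*pi*t))) has_integral Re (\<kappa> x)) (cbox 0 1)"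
    by simp
  define u where "u \<theta> = Re (\<kappa> (of_real R * cis \<theta>)) * poisson_kernel R x (of_real R * cis \<theta>)" for \<theta>
  have "((\<lambda>t. u (2*pi*t)) has_integral Re (\<kappa> x)) (cbox 0 1)" using I2 by (simp add: u_def)
  from has_integral_affinity'[OF this, of "1/(2*pi)" 0]
  have "(u has_integral (2*pi * Re (\<kappa> x))) {0..2*pi}"
    by (simp add: field_simps)
  then have "integral {0..2*pi} u = 2*pi * Re (\<kappa> x)" by (rule integral_unique)
  then show ?thesis by (simp add: poisson_mean_def circle_mean_def u_def[abs_def])
qed

lemma poisson_log_nonvanishing:
  fixes g :: "complex \<Rightarrow> complex"
  assumes g: "g holomorphic_on UNIV" and nz: "\<And>x. cmod x \<le> R \<Longrightarrow> g x \<noteq> 0" and x: "cmod x < R"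
  shows "ln (cmod (g x)) = poisson_mean (\<lambda>w. ln (cmod (g w))) R x"
proof -
  have R: "0 < R" using x norm_ge_zero[of x] by linarith
  obtain R' where R': "R < R'" "\<And>x. cmod x < R' \<Longrightarrow> g x \<noteq> 0"
    using cmod_ball_compact_extend[OF holomorphic_on_imp_continuous_on[OF g] nz R] by blast
  have "contractible (ball (0::complex) R')" by (simp add: convex_imp_contractible)
  then obtain k where k: "k holomorphic_on ball 0 R'" "\<And>z. z \<in> ball 0 R' \<Longrightarrow> g z = exp (k z)"
    using contractible_imp_holomorphic_log[of g "ball 0 R'"] holomorphic_on_subset[OF g] R'(2) by auto
  have eq: "ln (cmod (g z)) = Re (k z)" if "cmod z \<le> R" for z
    using k(2)[of z] that R'(1) by simp
  have "ln (cmod (g x)) = Re (k x)" using eq x by simp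
  also have "\<dots> = poisson_mean (\<lambda>w. Re (k w)) R x" by (rule poisson_formula[OF k(1) R R'(1) x])
  also have "\<dots> = poisson_mean (\<lambda>w. ln (cmod (g w))) R x"
    unfolding poisson_mean_def by (rule circle_mean_cong) (use R eq in auto)
  finally show ?thesis .
qed

lemma poisson_mean_const:
  assumes "cmod x < R" shows "poisson_mean (\<lambda>_. c) R x = c"
proof -
  \<comment> \<open>A constant function of modulus \<open>exp 1\<close> has logarithm 1, so the
    kernel has mean 1.\<close>
  have "ln (cmod (of_real (exp 1))) = poisson_mean (\<lambda>w. ln (cmod (of_real (exp 1)))) R x"
    by (rule poisson_log_nonvanishing) (use assms in auto)
  then have "poisson_mean (\<lambda>_. 1) R x = 1" by simp
  then show ?thesis unfolding poisson_mean_def by (simp add: circle_mean_cmult)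
qed

text \<open>On the circle \<open>w - z\<close> has the same modulus as
  \<open>R - cnj z * w / R\<close>, whose only possible zero is the reflected point outside the
  disc. The formula for zero-free functions applies to the latter.\<close>

lemma poisson_mean_log_linear:
  assumes "cmod z < R" "cmod x < R"
  shows "poisson_mean (\<lambda>w. ln (cmod (w - z))) R x = ln (cmod (of_real R - cnj z * x / of_real R))"
proof -
  have R: "0 < R" using assms(1) norm_ge_zero[of z] by linarith
  define g where "g w = of_real R - cnj z * w / of_real R" for w
  have nz: "g w \<noteq> 0" if "cmod w \<le> R" for w
  proof
    assume "g w = 0"
    then have "cnj z * w = of_real (R\<^sup>2)" using R by (simp add: g_def field_simps power2_eq_square)
    then have "cmod (cnj z * w) = R\<^sup>2" by (simp only: norm_of_real) simp
    moreover have "cmod (cnj z * w) \<le> cmod z * R" using that by (simp add: norm_mult mult_left_mono)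
    moreover have "cmod z * R < R\<^sup>2" using assms R by (simp add: power2_eq_square)
    ultimately show False by simp
  qed
  have "poisson_mean (\<lambda>w. ln (cmod (w - z))) R x = poisson_mean (\<lambda>w. ln (cmod (g w))) R x"
    unfolding poisson_mean_def
  proof (rule circle_mean_cong)
    fix w assume w: "cmod w = R"
    have "w * cnj w = of_real (R\<^sup>2)" using complex_norm_square[of w] w by simp
    then have "g w = w * cnj (w - z) / of_real R"
      using R by (simp add: g_def field_simps power2_eq_square)
    then show "ln (cmod (w - z)) * poisson_kernel R x w = ln (cmod (g w)) * poisson_kernel R x w"
      using w R by (simp add: norm_mult norm_divide del: complex_cnj_diff)
  qed (use R in simp)
  also have "\<dots> = ln (cmod (g x))"
    by (rule poisson_log_nonvanishing[symmetric]) (use nz assms in \<open>auto simp: g_def[abs_def] intro!: holomorphic_intros\<close>)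
  finally show ?thesis by (simp add: g_def)
qed

lemma circle_mean_log_linear:
  assumes "cmod z < R" shows "circle_mean (\<lambda>w. ln (cmod (w - z))) R = ln R"
proof -
  have R: "0 < R" using assms norm_ge_zero[of z] by linarith
  then show ?thesis using poisson_mean_log_linear[OF assms, of 0] poisson_mean_0[OF R] by simp
qed

lemma poisson_log_linear:
  assumes "cmod z < R" "cmod x < R" "x \<noteq> z"
  shows "ln (cmod (x - z)) \<le> poisson_mean (\<lambda>w. ln (cmod (w - z))) R x"
proof -
  have R: "0 < R" using assms(1) norm_ge_zero[of z] by linarith
  define g where "g = of_real R - cnj z * x / of_real R"
  \<comment> \<open>The Blaschke identity: the modulus grows when \<open>z\<close> is replaced by
    its reflection, since both \<open>x\<close> and \<open>z\<close> lie inside the circle.\<close>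
  have "(cmod (x - z))\<^sup>2 + (R\<^sup>2 - (cmod x)\<^sup>2) * (R\<^sup>2 - (cmod z)\<^sup>2) / R\<^sup>2 = (cmod (g))\<^sup>2"
    using R unfolding g_def cmod_power2 by (simp add: field_simps power2_eq_square)
  moreover have "0 \<le> (R\<^sup>2 - (cmod x)\<^sup>2) * (R\<^sup>2 - (cmod z)\<^sup>2) / R\<^sup>2"
    using assms R by (intro divide_nonneg_nonneg mult_nonneg_nonneg) (auto intro!: power_mono)
  ultimately have "(cmod (x - z))\<^sup>2 \<le> (cmod (g))\<^sup>2" by linarith
  then have "cmod (x - z) \<le> cmod (g)" by (simp add: power2_le_iff_abs_le)
  then show ?thesis using assms by (simp add: poisson_mean_log_linear g_def ln_mono)
qed


section \<open>Linearity, monotonicity and Harnack bounds of the Poisson mean\<close>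

lemma poisson_mean_add:
  assumes "continuous_on (sphere 0 R) u" "continuous_on (sphere 0 R) v" "cmod x < R"
  shows "poisson_mean (\<lambda>w. u w + v w) R x = poisson_mean u R x + poisson_mean v R x"
proof -
  have "0 \<le> R" using assms(3) norm_ge_zero[of x] by linarith
  then show ?thesis unfolding poisson_mean_def distrib_right
    by (intro circle_mean_add continuous_intros continuous_on_poisson_kernel assms)
qed

lemma poisson_mean_diff:
  assumes "continuous_on (sphere 0 R) u" "continuous_on (sphere 0 R) v" "cmod x < R"
  shows "poisson_mean (\<lambda>w. u w - v w) R x = poisson_mean u R x - poisson_mean v R x"
proof -
  have "0 \<le> R" using assms(3) norm_ge_zero[of x] by linarith
  then show ?thesis unfolding poisson_mean_def left_diff_distrib
    by (intro circle_mean_diff continuous_intros continuous_on_poisson_kernel assms)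
qed

lemma poisson_mean_cmult: "poisson_mean (\<lambda>w. c * u w) R x = c * poisson_mean u R x"
  unfolding poisson_mean_def by (simp add: mult.assoc circle_mean_cmult)

lemma poisson_mean_sum:
  assumes "finite A" "\<And>a. a \<in> A \<Longrightarrow> continuous_on (sphere 0 R) (u a)" "cmod x < R"
  shows "poisson_mean (\<lambda>w. \<Sum>a\<in>A. u a w) R x = (\<Sum>a\<in>A. poisson_mean (u a) R x)"
proof -
  have "0 \<le> R" using assms(3) norm_ge_zero[of x] by linarith
  then show ?thesis unfolding poisson_mean_def sum_distrib_right
    by (intro circle_mean_sum continuous_intros continuous_on_poisson_kernel assms)
qed

lemma poisson_mean_cong:
  assumes "0 \<le> R" "\<And>w. cmod w = R \<Longrightarrow> u w = v w"
  shows "poisson_mean u R x = poisson_mean v R x"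
  unfolding poisson_mean_def by (rule circle_mean_cong) (use assms in auto)

lemma poisson_mean_mono:
  assumes "continuous_on (sphere 0 R) u" "continuous_on (sphere 0 R) v" "cmod x < R"
    "\<And>w. cmod w = R \<Longrightarrow> u w \<le> v w"
  shows "poisson_mean u R x \<le> poisson_mean v R x"
proof -
  have "0 \<le> R" using assms(3) norm_ge_zero[of x] by linarith
  then show ?thesis unfolding poisson_mean_def
    by (intro circle_mean_mono continuous_intros continuous_on_poisson_kernel assms mult_right_mono
        poisson_kernel_nonneg) auto
qed

text \<open>Harnack's inequality, from the extreme values of the kernel on the circle.\<close>

lemma poisson_mean_nonneg_bounds:
  assumes u: "continuous_on (sphere 0 R) u" and x: "cmod x < R"
    and nn: "\<And>w. cmod w = R \<Longrightarrow> 0 \<le> u w"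
  shows "(R - cmod x) / (R + cmod x) * circle_mean u R \<le> poisson_mean u R x"
    "poisson_mean u R x \<le> (R + cmod x) / (R - cmod x) * circle_mean u R"
proof -
  have R: "0 \<le> R" using x norm_ge_zero[of x] by linarith
  have "circle_mean (\<lambda>w. (R - cmod x) / (R + cmod x) * u w) R \<le> poisson_mean u R x"
    unfolding poisson_mean_def
    by (intro circle_mean_mono continuous_intros continuous_on_poisson_kernel u x R)
       (use nn poisson_kernel_bounds(1)[OF x] in \<open>simp only: mult.commute mult_left_mono\<close>)
  then show "(R - cmod x) / (R + cmod x) * circle_mean u R \<le> poisson_mean u R x"
    by (simp only: circle_mean_cmult)
  have "poisson_mean u R x \<le> circle_mean (\<lambda>w. (R + cmod x) / (R - cmod x) * u w) R"
    unfolding poisson_mean_def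
    by (intro circle_mean_mono continuous_intros continuous_on_poisson_kernel u x R)
       (use nn poisson_kernel_bounds(2)[OF x] in \<open>simp only: mult.commute mult_left_mono\<close>)
  then show "poisson_mean u R x \<le> (R + cmod x) / (R - cmod x) * circle_mean u R"
    by (simp only: circle_mean_cmult)
qed

section \<open>Poisson-Jensen inequality, Jensen's formula and the counting function\<close>

lemma continuous_on_log_norm:
  assumes "f holomorphic_on UNIV" "\<And>x. x \<in> S \<Longrightarrow> f x \<noteq> 0"
  shows "continuous_on S (\<lambda>w. ln (cmod (f w)))"
  by (intro continuous_intros continuous_on_subset[OF holomorphic_on_imp_continuous_on[OF assms(1)]])
     (use assms(2) in auto)

lemma log_norm_factor:
  fixes f :: "complex \<Rightarrow> complex"
  assumes "finite A" "\<And>y. f y = (\<Prod>a\<in>A. (y - a) ^ m a) * g y" "f x \<noteq> 0"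
  shows "ln (cmod (f x)) = (\<Sum>a\<in>A. real (m a) * ln (cmod (x - a))) + ln (cmod (g x))"
proof -
  have nz: "(\<Prod>a\<in>A. (x - a) ^ m a) \<noteq> 0" "g x \<noteq> 0" using assms(3) unfolding assms(2)[of x] by auto
  have pos: "cmod (x - a) ^ m a > 0" if "a \<in> A" for a
    using nz(1) assms(1) that by (metis norm_power prod_zero zero_less_norm_iff)
  have "ln (cmod (f x)) = ln (\<Prod>a\<in>A. cmod (x - a) ^ m a) + ln (cmod (g x))"
    unfolding assms(2)[of x] norm_mult prod_norm[symmetric] norm_power
    by (rule ln_mult_pos) (use pos nz in \<open>auto intro: prod_pos\<close>)
  also have "ln (\<Prod>a\<in>A. cmod (x - a) ^ m a) = (\<Sum>a\<in>A. ln (cmod (x - a) ^ m a))"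
    by (rule ln_prod) (use assms(1) less_imp_neq[OF pos] in metis)+
  also have "\<dots> = (\<Sum>a\<in>A. real (m a) * ln (cmod (x - a)))"
  proof (rule sum.cong)
    \<comment> \<open>The exponent may be 0, and then \<open>x = a\<close> is possible; both sides
      are 0 in that case.\<close>
    fix a assume "a \<in> A"
    then show "ln (cmod (x - a) ^ m a) = real (m a) * ln (cmod (x - a))"
      using pos[of a] by (cases "x = a") (auto simp: ln_realpow power_0_left split: if_splits)
  qed simp
  finally show ?thesis .
qed

text \<open>Each linear factor has an explicit Poisson mean and the cofactor reproduces its own
  value. The Poisson-Jensen inequality follows by comparing factor by factor at \<open>x\<close>,
  Jensen's formula by evaluating at 0.\<close>

lemma entire_mean_decomposition:
  fixes f :: "complex \<Rightarrow> complex"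
  assumes f: "f holomorphic_on UNIV" and nz: "\<And>x. cmod x = R \<Longrightarrow> f x \<noteq> 0" and R: "0 < R"
  defines "A \<equiv> {a. cmod a \<le> R \<and> f a = 0}"
  obtains g where "g holomorphic_on UNIV"
    "\<And>x. f x = (\<Prod>a\<in>A. (x - a) ^ nat (zorder f a)) * g x"
    "\<And>x. cmod x \<le> R \<Longrightarrow> g x \<noteq> 0"
    "\<And>x. cmod x < R \<Longrightarrow> poisson_mean (\<lambda>w. ln (cmod (f w))) R x =
       (\<Sum>a\<in>A. real (nat (zorder f a)) * poisson_mean (\<lambda>w. ln (cmod (w - a))) R x) + ln (cmod (g x))"
proof -
  have ex: "\<exists>w. f w \<noteq> 0" using nz[of "of_real R"] R by auto
  have fin: "finite A" unfolding A_def using entire_finite_zeros[OF f ex] .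
  obtain g where g: "g holomorphic_on UNIV"
    "\<And>x. f x = (\<Prod>a\<in>A. (x - a) ^ nat (zorder f a)) * g x"
    "\<And>x. cmod x \<le> R \<Longrightarrow> g x \<noteq> 0"
    using entire_factor_cball[OF f ex] unfolding A_def by blast
  have Alt: "cmod a < R" if "a \<in> A" for a using that nz[of a] by (auto simp: A_def less_le)
  have "poisson_mean (\<lambda>w. ln (cmod (f w))) R x =
       (\<Sum>a\<in>A. real (nat (zorder f a)) * poisson_mean (\<lambda>w. ln (cmod (w - a))) R x) + ln (cmod (g x))"
    if x: "cmod x < R" for x
  proof -
    have c1: "continuous_on (sphere 0 R) (\<lambda>w. real (nat (zorder f a)) * ln (cmod (w - a)))" if "a \<in> A" for a
      by (intro continuous_intros) (use Alt[OF that] in auto)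
    have c2: "continuous_on (sphere 0 R) (\<lambda>w. ln (cmod (g w)))"
      by (rule continuous_on_log_norm[OF g(1)]) (use g(3) in auto)
    have "poisson_mean (\<lambda>w. ln (cmod (f w))) R x =
      poisson_mean (\<lambda>w. (\<Sum>a\<in>A. real (nat (zorder f a)) * ln (cmod (w - a))) + ln (cmod (g w))) R x"
      by (rule poisson_mean_cong) (use R nz log_norm_factor[OF fin g(2)] in auto)
    also have "\<dots> = poisson_mean (\<lambda>w. \<Sum>a\<in>A. real (nat (zorder f a)) * ln (cmod (w - a))) R x
        + poisson_mean (\<lambda>w. ln (cmod (g w))) R x"
      by (intro poisson_mean_add c2 x continuous_on_sum c1)
    also have "poisson_mean (\<lambda>w. ln (cmod (g w))) R x = ln (cmod (g x))"
      using poisson_log_nonvanishing[OF g(1,3) x] by simp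
    also have "poisson_mean (\<lambda>w. \<Sum>a\<in>A. real (nat (zorder f a)) * ln (cmod (w - a))) R x =
       (\<Sum>a\<in>A. real (nat (zorder f a)) * poisson_mean (\<lambda>w. ln (cmod (w - a))) R x)"
      by (subst poisson_mean_sum[OF fin c1 x]) (simp_all add: poisson_mean_cmult)
    finally show ?thesis .
  qed
  then show ?thesis using that g by blast
qed

text \<open>The zero-free cofactor contributes equality, and every zero in the disc only lowers the
  value at \<open>x\<close> against the mean.\<close>

lemma poisson_jensen_le:
  fixes f :: "complex \<Rightarrow> complex"
  assumes f: "f holomorphic_on UNIV" and nz: "\<And>x. cmod x = R \<Longrightarrow> f x \<noteq> 0"
    and x: "cmod x < R" "f x \<noteq> 0"
  shows "ln (cmod (f x)) \<le> poisson_mean (\<lambda>w. ln (cmod (f w))) R x"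
proof -
  have R: "0 < R" using x norm_ge_zero[of x] by linarith
  let ?A = "{a. cmod a \<le> R \<and> f a = 0}"
  obtain g where g: "g holomorphic_on UNIV"
    "\<And>x. f x = (\<Prod>a\<in>?A. (x - a) ^ nat (zorder f a)) * g x"
    "\<And>x. cmod x \<le> R \<Longrightarrow> g x \<noteq> 0"
    "\<And>x. cmod x < R \<Longrightarrow> poisson_mean (\<lambda>w. ln (cmod (f w))) R x =
       (\<Sum>a\<in>?A. real (nat (zorder f a)) * poisson_mean (\<lambda>w. ln (cmod (w - a))) R x) + ln (cmod (g x))"
    using entire_mean_decomposition[OF f nz R] by blast
  have fin: "finite ?A" using entire_finite_zeros[OF f] x by blast
  have Alt: "cmod a < R" if "a \<in> ?A" for a using that nz[of a] by (auto simp: less_le)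
  have "ln (cmod (f x)) = (\<Sum>a\<in>?A. real (nat (zorder f a)) * ln (cmod (x - a))) + ln (cmod (g x))"
    by (rule log_norm_factor[OF fin g(2) x(2)])
  also have "\<dots> \<le> (\<Sum>a\<in>?A. real (nat (zorder f a)) * poisson_mean (\<lambda>w. ln (cmod (w - a))) R x) + ln (cmod (g x))"
    by (intro add_right_mono sum_mono mult_left_mono poisson_log_linear Alt x) (use x in auto)
  finally show ?thesis using g(4)[OF x(1)] by simp
qed

lemma jensen_inequality:
  assumes "f holomorphic_on UNIV" "\<And>x. cmod x = R \<Longrightarrow> f x \<noteq> 0" "0 < R" "f 0 \<noteq> 0"
  shows "ln (cmod (f 0)) \<le> circle_mean (\<lambda>w. ln (cmod (f w))) R"
  using poisson_jensen_le[of f R 0] assms poisson_mean_0[OF assms(3)] by simp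

lemma jensen_zeros:
  fixes f :: "complex \<Rightarrow> complex"
  assumes f: "f holomorphic_on UNIV" and nz: "\<And>x. cmod x = R \<Longrightarrow> f x \<noteq> 0" and R: "0 < R" and f0: "f 0 \<noteq> 0"
  shows "(\<Sum>a | cmod a \<le> R \<and> f a = 0. real (nat (zorder f a)) * (ln R - ln (cmod a)))
     = circle_mean (\<lambda>w. ln (cmod (f w))) R - ln (cmod (f 0))"
proof -
  let ?A = "{a. cmod a \<le> R \<and> f a = 0}"
  obtain g where g: "g holomorphic_on UNIV"
    "\<And>x. f x = (\<Prod>a\<in>?A. (x - a) ^ nat (zorder f a)) * g x"
    "\<And>x. cmod x \<le> R \<Longrightarrow> g x \<noteq> 0"
    "\<And>x. cmod x < R \<Longrightarrow> poisson_mean (\<lambda>w. ln (cmod (f w))) R x =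
       (\<Sum>a\<in>?A. real (nat (zorder f a)) * poisson_mean (\<lambda>w. ln (cmod (w - a))) R x) + ln (cmod (g x))"
    using entire_mean_decomposition[OF f nz R] by blast
  have fin: "finite ?A" using entire_finite_zeros[OF f] f0 by blast
  have Alt: "cmod a < R" if "a \<in> ?A" for a using that nz[of a] by (auto simp: less_le)
  have "circle_mean (\<lambda>w. ln (cmod (f w))) R = (\<Sum>a\<in>?A. real (nat (zorder f a)) * ln R) + ln (cmod (g 0))"
    using g(4)[of 0] R Alt by (simp add: poisson_mean_0 circle_mean_log_linear)
  moreover have "ln (cmod (f 0)) = (\<Sum>a\<in>?A. real (nat (zorder f a)) * ln (cmod a)) + ln (cmod (g 0))"
    using log_norm_factor[OF fin g(2) f0] by simp
  ultimately show ?thesis by (simp add: right_diff_distrib sum_subtractf)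
qed

lemma zorder_zero_if_nonzero:
  assumes "f holomorphic_on UNIV" "f z \<noteq> 0"
  shows "zorder f z = 0"
  using zorder_exist_zero[OF assms(1) open_UNIV connected_UNIV UNIV_I, of z] assms(2) by auto

text \<open>A zero \<open>a\<close> other than the origin contributes a step function of
  \<open>t\<close>, and dt / t integrates to \<open>ln R - ln (cmod a)\<close> from
  \<open>cmod a\<close> to \<open>R\<close>. This turns the integrated counting function into the
  sum that occurs in Jensen's formula.\<close>

lemma count_N_eq:
  fixes f :: "complex \<Rightarrow> complex"
  assumes f: "f holomorphic_on UNIV" and nz: "\<exists>w. f w \<noteq> 0" and R: "0 < R"
  shows "count_N f R = (\<Sum>a\<in>{a. cmod a \<le> R \<and> f a = 0} - {0}. real (nat (zorder f a)) * (ln R - ln (cmod a)))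
     + real (nat (zorder f 0)) * ln R"
proof -
  let ?A = "{a. cmod a \<le> R \<and> f a = 0}"
  let ?m = "\<lambda>a. real (nat (zorder f a))"
  have fin: "finite ?A" using entire_finite_zeros[OF f nz] .
  have z0: "zero_count f 0 = ?m 0"
  proof (cases "f 0 = 0")
    case True
    then have "{z. cmod z \<le> 0 \<and> f z = 0} = {0}" by auto
    then show ?thesis unfolding zero_count_def by simp
  next
    case False
    then have "{z. cmod z \<le> 0 \<and> f z = 0} = {}" by auto
    then show ?thesis using zorder_zero_if_nonzero[OF f False] unfolding zero_count_def by simp
  qed
  have zt: "zero_count f t - zero_count f 0 = (\<Sum>a\<in>?A - {0}. ?m a * (if cmod a \<le> t then 1 else 0))"
    if t: "0 \<le> t" "t \<le> R" for t
  proof -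
    have fint: "finite {z. cmod z \<le> t \<and> f z = 0}" using entire_finite_zeros[OF f nz] .
    have "zero_count f t = sum ?m ({z. cmod z \<le> t \<and> f z = 0} - {0}) + ?m 0"
    proof (cases "f 0 = 0")
      case True
      then show ?thesis using sum.remove[OF fint, of 0 ?m] t(1) unfolding zero_count_def by simp
    next
      case False
      then have "{z. cmod z \<le> t \<and> f z = 0} - {0} = {z. cmod z \<le> t \<and> f z = 0}" by auto
      then show ?thesis using zorder_zero_if_nonzero[OF f False] unfolding zero_count_def by simp
    qed
    also have "sum ?m ({z. cmod z \<le> t \<and> f z = 0} - {0}) = (\<Sum>a\<in>?A - {0}. ?m a * (if cmod a \<le> t then 1 else 0))"
      by (rule sum.mono_neutral_cong_left) (use fin t in auto)
    finally show ?thesis using z0 by simp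
  qed
  have I: "((\<lambda>t. ?m a * (if cmod a \<le> t then 1 / t else 0)) has_integral (?m a * (ln R - ln (cmod a)))) {0..R}"
    if a: "a \<in> ?A - {0}" for a
  proof -
    have "((\<lambda>t. 1 / t) has_integral (ln R - ln (cmod a))) {cmod a..R}"
    proof (rule fundamental_theorem_of_calculus)
      fix t assume "t \<in> {cmod a..R}"
      then have "0 < t" using a by (auto intro: less_le_trans[of 0 "cmod a"])
      then show "(ln has_vector_derivative 1 / t) (at t within {cmod a..R})"
        by (auto simp: has_real_derivative_iff_has_vector_derivative[symmetric] intro!: derivative_eq_intros)
    qed (use a in auto)
    then have "((\<lambda>t. if t \<in> {cmod a..R} then 1 / t else 0) has_integral (ln R - ln (cmod a))) {0..R}"
      by (subst has_integral_restrict) auto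
    then have "((\<lambda>t. if cmod a \<le> t then 1 / t else 0) has_integral (ln R - ln (cmod a))) {0..R}"
      by (rule has_integral_eq[rotated]) auto
    then show ?thesis by (rule has_integral_mult_right)
  qed
  have "((\<lambda>t. \<Sum>a\<in>?A - {0}. ?m a * (if cmod a \<le> t then 1 / t else 0)) has_integral
      (\<Sum>a\<in>?A - {0}. ?m a * (ln R - ln (cmod a)))) {0..R}"
    by (rule has_integral_sum) (use fin I in auto)
  then have "((\<lambda>t. (zero_count f t - zero_count f 0) / t) has_integral
      (\<Sum>a\<in>?A - {0}. ?m a * (ln R - ln (cmod a)))) {0..R}"
    by (rule has_integral_eq[rotated]) (simp add: zt sum_divide_distrib, intro sum.cong, auto)
  then show ?thesis unfolding count_N_def z0 by (simp add: integral_unique)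
qed

text \<open>The limit is the first nonvanishing Taylor coefficient of \<open>f\<close> at \<open>0\<close>.\<close>
lemma jensen_count:
  fixes f :: "complex \<Rightarrow> complex"
  assumes f: "f holomorphic_on UNIV" and nz: "\<And>x. cmod x = R \<Longrightarrow> f x \<noteq> 0" and R: "0 < R"
  shows "circle_mean (\<lambda>w. ln (cmod (f w))) R =
    count_N f R + ln (cmod (Lim (at 0) (\<lambda>x. f x / x ^ nat (zorder f 0))))"
proof -
  let ?A = "{a. cmod a \<le> R \<and> f a = 0}"
  let ?m = "\<lambda>a. nat (zorder f a)"
  have ex: "\<exists>w. f w \<noteq> 0" using nz[of "of_real R"] R by auto
  obtain g where g: "g holomorphic_on UNIV"
    "\<And>x. f x = (\<Prod>a\<in>?A. (x - a) ^ ?m a) * g x"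
    "\<And>x. cmod x \<le> R \<Longrightarrow> g x \<noteq> 0"
    "\<And>x. cmod x < R \<Longrightarrow> poisson_mean (\<lambda>w. ln (cmod (f w))) R x =
       (\<Sum>a\<in>?A. real (?m a) * poisson_mean (\<lambda>w. ln (cmod (w - a))) R x) + ln (cmod (g x))"
    using entire_mean_decomposition[OF f nz R] by blast
  have fin: "finite ?A" using entire_finite_zeros[OF f ex] .
  have Alt: "cmod a < R" if "a \<in> ?A" for a using that nz[of a] by (auto simp: less_le)
  have mean: "circle_mean (\<lambda>w. ln (cmod (f w))) R = (\<Sum>a\<in>?A. real (?m a) * ln R) + ln (cmod (g 0))"
    using g(4)[of 0] R Alt by (simp add: poisson_mean_0 circle_mean_log_linear)
  define h where "h x = (\<Prod>a\<in>?A - {0}. (x - a) ^ ?m a) * g x" for x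
  have fh: "f x = x ^ ?m 0 * h x" for x
  proof (cases "f 0 = 0")
    case True
    then have "0 \<in> ?A" using R by simp
    then show ?thesis using g(2)[of x] prod.remove[OF fin, of 0 "\<lambda>a. (x - a) ^ ?m a"] by (simp add: h_def mult_ac)
  next
    case False
    then have "?A - {0} = ?A" by auto
    then show ?thesis using g(2)[of x] zorder_zero_if_nonzero[OF f False] by (simp add: h_def)
  qed
  have Asum: "(\<Sum>a\<in>?A. real (?m a) * ln R) = (\<Sum>a\<in>?A - {0}. real (?m a) * ln R) + real (?m 0) * ln R"
  proof (cases "f 0 = 0")
    case True
    then have "0 \<in> ?A" using R by simp
    then show ?thesis using sum.remove[OF fin, of 0 "\<lambda>a. real (?m a) * ln R"] by simp
  next
    case False
    then have "?A - {0} = ?A" by auto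
    then show ?thesis using zorder_zero_if_nonzero[OF f False] by simp
  qed
  have "isCont h 0" unfolding h_def
    using g(1) by (intro continuous_intros) (auto simp: holomorphic_on_open field_differentiable_imp_continuous_at holomorphic_on_imp_differentiable_at[OF g(1)])
  then have "((\<lambda>x. f x / x ^ ?m 0) \<longlongrightarrow> h 0) (at 0)"
    unfolding isCont_def
    by (rule Lim_transform_eventually) (auto simp: fh eventually_at_filter)
  then have lim: "Lim (at 0) (\<lambda>x. f x / x ^ ?m 0) = h 0" by (intro tendsto_Lim) auto
  have h0: "h 0 \<noteq> 0" using fin g(3)[of 0] R by (auto simp: h_def)
  have "ln (cmod (h 0)) = (\<Sum>a\<in>?A - {0}. real (?m a) * ln (cmod (0 - a))) + ln (cmod (g 0))"
    by (rule log_norm_factor) (use fin h0 in \<open>auto simp: h_def\<close>)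
  then show ?thesis
    unfolding mean lim count_N_eq[OF f ex R] Asum by (simp add: right_diff_distrib sum_subtractf)
qed

section \<open>Comparison of circle means with values inside the disc\<close>

text \<open>\<open>M - ln (cmod (f w))\<close> is nonnegative on the circle, so Harnack's inequality
  bounds its mean by a multiple of its Poisson mean at \<open>x\<close>, and Poisson-Jensen bounds
  the latter by \<open>M - ln (cmod (f x))\<close>. The factor is 3 because \<open>cmod x\<close> is
  at most \<open>R / 2\<close>.\<close>

lemma mean_log_ge_harnack:
  fixes f :: "complex \<Rightarrow> complex"
  assumes f: "f holomorphic_on UNIV" and nz: "\<And>x. cmod x = R \<Longrightarrow> f x \<noteq> 0"
    and M: "\<And>x. cmod x = R \<Longrightarrow> ln (cmod (f x)) \<le> M"
    and x: "cmod x \<le> R / 2" "f x \<noteq> 0" and R: "0 < R"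
  shows "circle_mean (\<lambda>w. ln (cmod (f w))) R \<ge> M - 3 * (M - ln (cmod (f x)))"
proof -
  have xR: "cmod x < R" using x R by linarith
  have cont: "continuous_on (sphere 0 R) (\<lambda>w. ln (cmod (f w)))"
    by (rule continuous_on_log_norm[OF f]) (use nz in auto)
  let ?k = "(R - cmod x) / (R + cmod x)"
  have k: "?k \<ge> 1 / 3" using x R norm_ge_zero[of x]
    by (simp add: field_simps add_pos_nonneg)
  have 1: "?k * circle_mean (\<lambda>w. M - ln (cmod (f w))) R \<le> poisson_mean (\<lambda>w. M - ln (cmod (f w))) R x"
    by (rule poisson_mean_nonneg_bounds(1)) (use M xR cont in \<open>auto intro!: continuous_intros\<close>)
  have 2: "poisson_mean (\<lambda>w. M - ln (cmod (f w))) R x = M - poisson_mean (\<lambda>w. ln (cmod (f w))) R x"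
    by (subst poisson_mean_diff) (use xR cont in \<open>auto simp: poisson_mean_const\<close>)
  have 3: "circle_mean (\<lambda>w. M - ln (cmod (f w))) R = M - circle_mean (\<lambda>w. ln (cmod (f w))) R"
    by (subst circle_mean_diff) (use R cont in auto)
  have 4: "circle_mean (\<lambda>w. 0) R \<le> circle_mean (\<lambda>w. M - ln (cmod (f w))) R"
    by (rule circle_mean_mono) (use M R cont in \<open>auto intro!: continuous_intros\<close>)
  have "1 / 3 * circle_mean (\<lambda>w. M - ln (cmod (f w))) R \<le> ?k * circle_mean (\<lambda>w. M - ln (cmod (f w))) R"
    using k 4 by (intro mult_right_mono) auto
  also note 1
  also note 2
  finally show ?thesis unfolding 3 using poisson_jensen_le[of f R x] f nz xR x(2) by (auto simp: algebra_simps)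
qed

text \<open>Poisson-Jensen followed by the upper Harnack bound for the positive part. It recovers a
  pointwise bound from a mean at twice the radius.\<close>

lemma log_norm_le_mean_plus:
  fixes f :: "complex \<Rightarrow> complex"
  assumes f: "f holomorphic_on UNIV" and nz: "\<And>x. cmod x = R \<Longrightarrow> f x \<noteq> 0"
    and x: "cmod x \<le> R / 2" "f x \<noteq> 0" and R: "0 < R"
  shows "ln (cmod (f x)) \<le> 3 * circle_mean (\<lambda>w. max 0 (ln (cmod (f w)))) R"
proof -
  have xR: "cmod x < R" using x R by linarith
  have cont: "continuous_on (sphere 0 R) (\<lambda>w. ln (cmod (f w)))"
    by (rule continuous_on_log_norm[OF f]) (use nz in auto)
  have cont': "continuous_on (sphere 0 R) (\<lambda>w. max 0 (ln (cmod (f w))))"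
    by (intro continuous_intros cont)
  let ?k = "(R + cmod x) / (R - cmod x)"
  have k: "?k \<le> 3" using x R norm_ge_zero[of x]
    by (simp add: field_simps)
  have nn: "circle_mean (\<lambda>w. 0) R \<le> circle_mean (\<lambda>w. max 0 (ln (cmod (f w)))) R"
    by (rule circle_mean_mono) (use R cont' in auto)
  have "ln (cmod (f x)) \<le> poisson_mean (\<lambda>w. ln (cmod (f w))) R x"
    by (rule poisson_jensen_le[OF f nz xR x(2)])
  also have "\<dots> \<le> poisson_mean (\<lambda>w. max 0 (ln (cmod (f w)))) R x"
    by (rule poisson_mean_mono) (use cont cont' xR in auto)
  also have "\<dots> \<le> ?k * circle_mean (\<lambda>w. max 0 (ln (cmod (f w)))) R"
    by (rule poisson_mean_nonneg_bounds(2)) (use cont' xR in auto)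
  also have "\<dots> \<le> 3 * circle_mean (\<lambda>w. max 0 (ln (cmod (f w)))) R"
    using k nn by (intro mult_right_mono) auto
  finally show ?thesis .
qed


section \<open>Slow growth and genus-zero factorisation\<close>

text \<open>The class of growth that the hypothesis allows. The summand 1 keeps the power at least 1
  from \<open>r = 1\<close> on when \<rho> is nonnegative, so that constants are absorbed into
  \<open>K\<close> and the class is closed under sums, nonnegative products and scaling of the
  argument.\<close>

definition log_slow :: "real \<Rightarrow> (real \<Rightarrow> real) \<Rightarrow> bool" where
  "log_slow \<rho> \<phi> \<longleftrightarrow> (\<exists>K\<ge>0. \<forall>r\<ge>1. \<phi> r \<le> exp (K * (1 + ln r) powr \<rho>))"

lemma log_slowI:
  assumes "0 \<le> K" "\<And>r. 1 \<le> r \<Longrightarrow> \<phi> r \<le> exp (K * (1 + ln r) powr \<rho>)"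
  shows "log_slow \<rho> \<phi>"
  using assms unfolding log_slow_def by blast

lemma log_slowE:
  assumes "log_slow \<rho> \<phi>"
  obtains K where "0 \<le> K" "\<And>r. 1 \<le> r \<Longrightarrow> \<phi> r \<le> exp (K * (1 + ln r) powr \<rho>)"
  using assms unfolding log_slow_def by blast

lemma log_slow_mono:
  assumes "log_slow \<rho> \<psi>" "\<And>r. 1 \<le> r \<Longrightarrow> \<phi> r \<le> \<psi> r"
  shows "log_slow \<rho> \<phi>"
  using assms unfolding log_slow_def by (meson order_trans)

lemma one_le_log_powr:
  fixes r \<rho> :: real
  assumes "0 \<le> \<rho>" "1 \<le> r" shows "1 \<le> (1 + ln r) powr \<rho>"
  using powr_mono2[of \<rho> 1 "1 + ln r"] assms by simp

lemma log_slow_const: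
  assumes "0 \<le> \<rho>" shows "log_slow \<rho> (\<lambda>r. c)"
proof (rule log_slowI)
  fix r :: real assume r: "1 \<le> r"
  have "c \<le> exp \<bar>c\<bar>" using exp_ge_add_one_self[of "\<bar>c\<bar>"] by linarith
  also have "\<dots> \<le> exp (\<bar>c\<bar> * (1 + ln r) powr \<rho>)"
    using mult_left_mono[OF one_le_log_powr[OF assms r], of "\<bar>c\<bar>"] by simp
  finally show "c \<le> exp (\<bar>c\<bar> * (1 + ln r) powr \<rho>)" .
qed simp

lemma log_slow_mult:
  assumes "log_slow \<rho> \<phi>" "log_slow \<rho> \<psi>" "\<And>r. 1 \<le> r \<Longrightarrow> 0 \<le> \<phi> r" "\<And>r. 1 \<le> r \<Longrightarrow> 0 \<le> \<psi> r"
  shows "log_slow \<rho> (\<lambda>r. \<phi> r * \<psi> r)"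
proof -
  obtain K where K: "0 \<le> K" "\<And>r. 1 \<le> r \<Longrightarrow> \<phi> r \<le> exp (K * (1 + ln r) powr \<rho>)"
    using assms(1) by (auto elim: log_slowE)
  obtain L where L: "0 \<le> L" "\<And>r. 1 \<le> r \<Longrightarrow> \<psi> r \<le> exp (L * (1 + ln r) powr \<rho>)"
    using assms(2) by (auto elim: log_slowE)
  show ?thesis
  proof (rule log_slowI)
    show "0 \<le> K + L" using K L by simp
    show "\<phi> r * \<psi> r \<le> exp ((K + L) * (1 + ln r) powr \<rho>)" if r: "1 \<le> r" for r
      using mult_mono[OF K(2)[OF r] L(2)[OF r]] assms(3,4)[OF r]
      by (simp add: distrib_right exp_add)
  qed
qed

lemma log_slow_add:
  assumes "log_slow \<rho> \<phi>" "log_slow \<rho> \<psi>" "0 \<le> \<rho>"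
  shows "log_slow \<rho> (\<lambda>r. \<phi> r + \<psi> r)"
proof -
  obtain K where K: "0 \<le> K" "\<And>r. 1 \<le> r \<Longrightarrow> \<phi> r \<le> exp (K * (1 + ln r) powr \<rho>)"
    using assms(1) by (auto elim: log_slowE)
  obtain L where L: "0 \<le> L" "\<And>r. 1 \<le> r \<Longrightarrow> \<psi> r \<le> exp (L * (1 + ln r) powr \<rho>)"
    using assms(2) by (auto elim: log_slowE)
  have "log_slow \<rho> (\<lambda>r. 2 * exp ((K + L) * (1 + ln r) powr \<rho>))"
    by (rule log_slow_mult[OF log_slow_const[OF assms(3)]]) (use K L in \<open>auto intro: log_slowI[of "K + L"]\<close>)
  then show ?thesis
  proof (rule log_slow_mono)
    fix r :: real assume r: "1 \<le> r"
    have "exp (K * (1 + ln r) powr \<rho>) \<le> exp ((K + L) * (1 + ln r) powr \<rho>)"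
      "exp (L * (1 + ln r) powr \<rho>) \<le> exp ((K + L) * (1 + ln r) powr \<rho>)"
      using K L by (auto intro!: mult_right_mono)
    then show "\<phi> r + \<psi> r \<le> 2 * exp ((K + L) * (1 + ln r) powr \<rho>)"
      using K(2)[OF r] L(2)[OF r] by linarith
  qed
qed

lemma log_slow_scale:
  assumes "log_slow \<rho> \<phi>" "1 \<le> c" "0 \<le> \<rho>"
  shows "log_slow \<rho> (\<lambda>r. \<phi> (c * r))"
proof -
  obtain K where K: "0 \<le> K" "\<And>r. 1 \<le> r \<Longrightarrow> \<phi> r \<le> exp (K * (1 + ln r) powr \<rho>)"
    using assms(1) by (auto elim: log_slowE)
  show ?thesis
  proof (rule log_slowI)
    show "0 \<le> K * (1 + ln c) powr \<rho>" using K by simp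
    fix r :: real assume r: "1 \<le> r"
    have "1 + ln (c * r) \<le> (1 + ln c) * (1 + ln r)"
      using r assms by (simp add: ln_mult algebra_simps)
    then have "(1 + ln (c * r)) powr \<rho> \<le> ((1 + ln c) * (1 + ln r)) powr \<rho>"
      using r assms by (intro powr_mono2) (auto simp: ln_mult)
    also have "\<dots> = (1 + ln c) powr \<rho> * (1 + ln r) powr \<rho>"
      by (simp add: powr_mult)
    finally have "K * (1 + ln (c * r)) powr \<rho> \<le> K * (1 + ln c) powr \<rho> * (1 + ln r) powr \<rho>"
      using mult_left_mono[OF _ K(1)] by (simp add: mult.assoc)
    moreover have "1 \<le> c * r" using r assms mult_mono[of 1 c 1 r] by simp
    ultimately show "\<phi> (c * r) \<le> exp (K * (1 + ln c) powr \<rho> * (1 + ln r) powr \<rho>)"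
      using K(2)[of "c * r"] by (meson exp_le_cancel_iff order_trans)
  qed
qed

lemma log_slow_ln:
  assumes "0 < \<rho>" shows "log_slow \<rho> ln"
proof (rule log_slowI)
  fix r :: real assume r: "1 \<le> r"
  have "ln (1 + ln r) * \<rho> \<le> (1 + ln r) powr \<rho>"
  proof -
    have "\<rho> * ln (1 + ln r) \<le> exp (\<rho> * ln (1 + ln r))"
      using exp_ge_add_one_self[of "\<rho> * ln (1 + ln r)"] by linarith
    then show ?thesis using ln_ge_zero[OF r] unfolding powr_def by (simp add: mult.commute)
  qed
  then have "ln (1 + ln r) \<le> 1 / \<rho> * (1 + ln r) powr \<rho>"
    using assms by (simp add: field_simps)
  then have "exp (ln (1 + ln r)) \<le> exp (1 / \<rho> * (1 + ln r) powr \<rho>)" by (simp only: exp_le_cancel_iff)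
  moreover have "exp (ln (1 + ln r)) = 1 + ln r" using ln_ge_zero[OF r] by (intro exp_ln) linarith
  ultimately show "ln r \<le> exp (1 / \<rho> * (1 + ln r) powr \<rho>)" by linarith
qed (use assms in simp)

text \<open>A share \<open>u\<close> between 0 and 1 satisfies \<open>u \<le> u powr \<rho>\<close>;
  this is applied to the shares of \<open>x\<close> and \<open>y\<close> in their sum.\<close>

lemma powr_add_le:
  fixes x y \<rho> :: real
  assumes "0 \<le> x" "0 \<le> y" "0 < \<rho>" "\<rho> \<le> 1"
  shows "(x + y) powr \<rho> \<le> x powr \<rho> + y powr \<rho>"
proof (cases "x + y = 0")
  case False
  have le: "a / (a + b) \<le> (a / (a + b)) powr \<rho>" if "0 \<le> a" "0 \<le> b" "a + b \<noteq> 0" for a b :: real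
    using powr_mono'[of \<rho> 1 "a / (a + b)"] that assms by (auto simp: divide_le_eq_1)
  have "1 = x / (x + y) + y / (y + x)" using False by (simp add: add_divide_distrib[symmetric] add.commute)
  also have "\<dots> \<le> (x / (x + y)) powr \<rho> + (y / (y + x)) powr \<rho>"
    by (intro add_mono le) (use assms False in auto)
  also have "\<dots> = (x powr \<rho> + y powr \<rho>) / (x + y) powr \<rho>"
    using assms by (simp add: powr_divide add_divide_distrib add.commute)
  finally show ?thesis using False assms by (simp add: le_divide_eq)
qed (use assms in auto)

text \<open>Since \<rho> < 1, the exponent is o(l) and eventually below half of
  \<open>l * ln 2\<close>, which leaves a geometric series. This is the convergence behind genus
  zero.\<close>

lemma summable_exp_powr_div_power:
  fixes K \<rho> :: real
  assumes "0 \<le> K" "0 < \<rho>" "\<rho> < 1"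
  shows "summable (\<lambda>l. exp (K * (real l * ln 2) powr \<rho>) / 2 ^ l)"
proof (rule summable_comparison_test_ev)
  have "((\<lambda>l. K * (real l * ln 2) powr (\<rho> - 1)) \<longlongrightarrow> K * 0) sequentially"
  proof (intro tendsto_mult tendsto_const)
    have "filterlim (\<lambda>l. ln 2 * real l) at_top sequentially"
      by (rule filterlim_tendsto_pos_mult_at_top[OF tendsto_const _ filterlim_real_sequentially]) simp
    then show "((\<lambda>l. (real l * ln 2) powr (\<rho> - 1)) \<longlongrightarrow> 0) sequentially"
      using tendsto_neg_powr[of "\<rho> - 1" "\<lambda>l. ln 2 * real l"] assms by (simp add: mult.commute)
  qed
  then have "\<forall>\<^sub>F l in sequentially. K * (real l * ln 2) powr (\<rho> - 1) < 1 / 2"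
    by (intro order_tendstoD(2)) auto
  then show "\<forall>\<^sub>F l in sequentially. norm (exp (K * (real l * ln 2) powr \<rho>) / 2 ^ l) \<le> (1 / sqrt 2) ^ l"
    using eventually_gt_at_top[of 0]
  proof eventually_elim
    case (elim l)
    have p: "real l * ln 2 > 0" using elim by simp
    have *: "sqrt 2 / 2 = 1 / sqrt 2" by (simp add: field_simps)
    have "K * (real l * ln 2) powr \<rho> = K * (real l * ln 2) powr (\<rho> - 1) * (real l * ln 2)"
      using p by (simp add: powr_diff)
    also have "\<dots> \<le> 1 / 2 * (real l * ln 2)" using elim p by (intro mult_right_mono) auto
    also have "\<dots> = real l * ln (sqrt 2)" by (simp add: ln_sqrt)
    finally have "exp (K * (real l * ln 2) powr \<rho>) \<le> exp (real l * ln (sqrt 2))" by simp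
    also have "\<dots> = sqrt 2 ^ l" by (simp add: exp_of_nat_mult)
    finally have "exp (K * (real l * ln 2) powr \<rho>) / 2 ^ l \<le> sqrt 2 ^ l / 2 ^ l"
      by (intro divide_right_mono) auto
    also have "\<dots> = (1 / sqrt 2) ^ l" 
      by (simp only: power_divide[symmetric] *)
    finally show ?case by simp
  qed
  show "summable (\<lambda>l. (1 / sqrt 2) ^ l :: real)" by (rule summable_geometric) simp
qed

text \<open>Subadditivity of the power separates the growth at \<open>2 ^ l * r\<close> into a
  summable factor in \<open>l\<close> and a slow factor in \<open>r\<close>. With the zero count for
  \<open>\<phi>\<close> it controls the sum of reciprocal moduli of distant zeros, shell by
  shell.\<close>

lemma log_slow_dyadic_sum:
  assumes "log_slow \<rho> \<phi>" "0 < \<rho>" "\<rho> < 1"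
  obtains \<sigma> where "log_slow \<rho> \<sigma>" "\<And>r s. 1 \<le> r \<Longrightarrow> r \<le> s \<Longrightarrow> \<sigma> r \<le> \<sigma> s"
    "\<And>r N. 1 \<le> r \<Longrightarrow> (\<Sum>l<N. \<phi> (2 ^ l * r) / 2 ^ l) \<le> \<sigma> r"
proof -
  obtain K where K: "0 \<le> K" "\<And>r. 1 \<le> r \<Longrightarrow> \<phi> r \<le> exp (K * (1 + ln r) powr \<rho>)"
    using assms(1) by (auto elim: log_slowE)
  define u where "u l = exp (K * (real l * ln 2) powr \<rho>) / 2 ^ l" for l
  have su: "summable u" unfolding u_def[abs_def] by (rule summable_exp_powr_div_power) (use K assms in auto)
  have "log_slow \<rho> (\<lambda>r. suminf u * exp (K * (1 + ln r) powr \<rho>))"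
    by (intro log_slow_mult log_slow_const log_slowI[of K] suminf_nonneg su) (use K assms in \<open>auto simp: u_def\<close>)
  moreover have "suminf u * exp (K * (1 + ln r) powr \<rho>) \<le> suminf u * exp (K * (1 + ln s) powr \<rho>)"
    if "1 \<le> r" "r \<le> s" for r s
    using that assms K
    by (intro mult_left_mono exp_le_cancel_iff[THEN iffD2] powr_mono2 suminf_nonneg su) (auto simp: u_def)
  moreover have "(\<Sum>l<N. \<phi> (2 ^ l * r) / 2 ^ l) \<le> suminf u * exp (K * (1 + ln r) powr \<rho>)"
    if r: "1 \<le> r" for r N
  proof -
    have "\<phi> (2 ^ l * r) / 2 ^ l \<le> u l * exp (K * (1 + ln r) powr \<rho>)" for l
    proof -
      have "1 \<le> 2 ^ l * r" using r mult_mono[of 1 "2 ^ l" 1 r] by simp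
      then have "\<phi> (2 ^ l * r) \<le> exp (K * (1 + ln (2 ^ l * r)) powr \<rho>)" by (rule K(2))
      also have "1 + ln (2 ^ l * r) = real l * ln 2 + (1 + ln r)"
        using r by (simp add: ln_mult ln_realpow)
      also have "exp (K * (real l * ln 2 + (1 + ln r)) powr \<rho>) \<le>
         exp (K * ((real l * ln 2) powr \<rho> + (1 + ln r) powr \<rho>))"
        using powr_add_le[of "real l * ln 2" "1 + ln r" \<rho>] r K assms by (simp add: mult_left_mono)
      finally show ?thesis by (simp add: u_def divide_right_mono distrib_left exp_add)
    qed
    then have "(\<Sum>l<N. \<phi> (2 ^ l * r) / 2 ^ l) \<le> (\<Sum>l<N. u l * exp (K * (1 + ln r) powr \<rho>))"
      by (intro sum_mono)
    also have "\<dots> = (\<Sum>l<N. u l) * exp (K * (1 + ln r) powr \<rho>)" by (simp add: sum_distrib_right)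
    also have "\<dots> \<le> suminf u * exp (K * (1 + ln r) powr \<rho>)"
      by (intro mult_right_mono sum_le_suminf su) (auto simp: u_def)
    finally show ?thesis .
  qed
  ultimately show ?thesis using that by blast
qed

section \<open>Dividing out a zero-free factor\<close>

lemma zero_count_nonneg: "0 \<le> zero_count f t"
  unfolding zero_count_def by (intro sum_nonneg) auto

lemma zero_count_mono:
  assumes "f holomorphic_on UNIV" "\<exists>w. f w \<noteq> 0" "s \<le> t"
  shows "zero_count f s \<le> zero_count f t"
  unfolding zero_count_def
  by (intro sum_mono2 entire_finite_zeros assms) (use assms(3) in auto)

lemma entire_eq_off_finite:
  fixes g h :: "complex \<Rightarrow> complex"
  assumes "g holomorphic_on UNIV" "h holomorphic_on UNIV" "finite A" "\<And>x. x \<notin> A \<Longrightarrow> g x = h x"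
  shows "g x = h x"
proof -
  have "closure (- A) = UNIV"
    using assms(3) by (simp add: closure_complement empty_interior_finite)
  moreover have "closed {x. g x = h x}"
    by (intro closed_Collect_eq holomorphic_on_imp_continuous_on assms)
  then have "closure (- A) \<subseteq> {x. g x = h x}" by (rule closure_minimal[rotated]) (use assms(4) in auto)
  ultimately show ?thesis by auto
qed


text \<open>Hadamard factorisation in genus zero, without the infinite product: the entire cofactors
  \<open>G\<^sub>j = f / Q\<^sub>j\<close> of the polynomials \<open>Q\<^sub>j x = (\<Prod>|a| \<le> 2\<^sup>j. 1 - x / a)\<close> form a normal family that is also
  bounded away from zero, and a limit \<open>G\<close> inherits the bound \<open>|f| \<le> sup |Q\<^sub>j| |G|\<close>.\<close>
lemma slow_zeros_factor:
  fixes f :: "complex \<Rightarrow> complex"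
  assumes f: "f holomorphic_on UNIV" and f0: "f 0 \<noteq> 0" and slow: "log_slow \<rho> (zero_count f)"
    and \<rho>: "0 < \<rho>" "\<rho> < 1"
  obtains G \<beta> where "G holomorphic_on UNIV" "\<And>x. G x \<noteq> 0" "G 0 = f 0" "log_slow \<rho> \<beta>"
    "\<And>x r. cmod x \<le> r \<Longrightarrow> 1 \<le> r \<Longrightarrow> cmod (f x) \<le> exp (\<beta> r) * cmod (G x)"
proof -
  have ex: "\<exists>w. f w \<noteq> 0" using f0 by blast
  define m where "m a = nat (zorder f a)" for a
  define Z where "Z j = {a. cmod a \<le> 2 ^ j \<and> f a = 0}" for j :: nat
  define Q where "Q j x = (\<Prod>a\<in>Z j. (1 - x / a) ^ m a)" for j x
  have finZ: "finite (Z j)" for j unfolding Z_def by (rule entire_finite_zeros[OF f ex])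
  have Z0: "a \<noteq> 0" if "a \<in> Z j" for a j using that f0 by (auto simp: Z_def)
  have Zmono: "Z i \<subseteq> Z j" if "i \<le> j" for i j
    using power_increasing[OF that, of "2::real"] by (auto simp: Z_def intro: order_trans)
  have "\<exists>G. G holomorphic_on UNIV \<and> (\<forall>x. f x = Q j x * G x) \<and> (\<forall>x. cmod x \<le> 2 ^ j \<longrightarrow> G x \<noteq> 0)" for j
  proof -
    obtain g where g: "g holomorphic_on UNIV" "\<And>x. f x = (\<Prod>a\<in>Z j. (x - a) ^ m a) * g x"
      "\<And>x. cmod x \<le> 2 ^ j \<Longrightarrow> g x \<noteq> 0"
      using entire_factor_cball[OF f ex] unfolding Z_def m_def by blast
    define c where "c = (\<Prod>a\<in>Z j. (- a) ^ m a)"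
    have "(x - a) ^ m a = (1 - x / a) ^ m a * (- a) ^ m a" if "a \<in> Z j" for a x
      using Z0[OF that] by (simp add: power_mult_distrib[symmetric] left_diff_distrib)
    then have "(\<Prod>a\<in>Z j. (x - a) ^ m a) = Q j x * c" for x
      by (simp add: Q_def c_def prod.distrib[symmetric])
    then have "\<forall>x. f x = Q j x * (c * g x)" using g(2) by simp
    moreover have "c \<noteq> 0" using finZ Z0 by (auto simp: c_def)
    ultimately show ?thesis using g(1,3) by (intro exI[of _ "\<lambda>x. c * g x"]) (auto intro!: holomorphic_intros)
  qed
  then obtain G where G: "\<And>j. G j holomorphic_on UNIV" "\<And>j x. f x = Q j x * G j x"
    "\<And>j x. cmod x \<le> 2 ^ j \<Longrightarrow> G j x \<noteq> 0" by metis
  \<comment> \<open>The polynomial \<open>Q j / Q i\<close>, made of the zeros with modulus above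
    \<open>2 ^ i\<close>; it measures how far the cofactors \<open>G i\<close> and
    \<open>G j\<close> differ.\<close>
  define P where "P i j x = (\<Prod>a\<in>Z j - Z i. (1 - x / a) ^ m a)" for i j x
  have QP: "Q j x = Q i x * P i j x" if "i \<le> j" for i j x
    unfolding Q_def P_def using prod.subset_diff[OF Zmono[OF that] finZ] by (simp add: mult.commute)
  have GP: "G i x = P i j x * G j x" if ij: "i \<le> j" for i j x
  proof (rule entire_eq_off_finite[of "G i" "\<lambda>x. P i j x * G j x" "Z i"])
    show "(\<lambda>x. P i j x * G j x) holomorphic_on UNIV"
      unfolding P_def by (intro holomorphic_intros G) (use Z0 in auto)
    fix x assume x: "x \<notin> Z i"
    have "Q i x \<noteq> 0" using x finZ Z0 by (auto simp: Q_def)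
    moreover have "Q i x * G i x = Q i x * (P i j x * G j x)"
      using G(2)[of x i] G(2)[of x j] QP[OF ij] by (metis mult.assoc)
    ultimately show "G i x = P i j x * G j x" by simp
  qed (use G finZ in auto)
  obtain \<sigma> where \<sigma>: "log_slow \<rho> \<sigma>"
    and \<sigma>mono: "\<And>r s. 1 \<le> r \<Longrightarrow> r \<le> s \<Longrightarrow> \<sigma> r \<le> \<sigma> s"
    and \<sigma>sum:
    "\<And>r N. 1 \<le> r \<Longrightarrow> (\<Sum>l<N. zero_count f (2 ^ l * r) / 2 ^ l) \<le> \<sigma> r"
    using log_slow_dyadic_sum[OF slow \<rho>] by blast
  \<comment> \<open>Zeros in the shell between \<open>2 ^ j\<close> and \<open>2 ^ (j + 1)\<close>
    have reciprocal modulus below \<open>1 / 2 ^ j\<close>, and their number is at most the count at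
    the outer radius.\<close>
  have S1: "(\<Sum>a\<in>Z j - Z i. real (m a) / cmod a) \<le> (\<Sum>l<j-i. zero_count f (2 ^ (l + i + 1)) / 2 ^ (l + i))"
    if "i \<le> j" for i j
    using that
  proof (induction j rule: dec_induct)
    case (step j)
    have "Z (Suc j) - Z i = (Z j - Z i) \<union> (Z (Suc j) - Z j)"
      using Zmono[of j "Suc j"] Zmono[of i j] step by auto
    then have "(\<Sum>a\<in>Z (Suc j) - Z i. real (m a) / cmod a) =
      (\<Sum>a\<in>Z j - Z i. real (m a) / cmod a) + (\<Sum>a\<in>Z (Suc j) - Z j. real (m a) / cmod a)"
      using finZ by (simp only:) (rule sum.union_disjoint, auto)
    also have "(\<Sum>a\<in>Z (Suc j) - Z j. real (m a) / cmod a) \<le> (\<Sum>a\<in>Z (Suc j) - Z j. real (m a) / 2 ^ j)"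
    proof (rule sum_mono)
      fix a assume "a \<in> Z (Suc j) - Z j"
      then have "2 ^ j < cmod a" by (auto simp: Z_def)
      then show "real (m a) / cmod a \<le> real (m a) / 2 ^ j"
        by (intro divide_left_mono mult_pos_pos) (auto intro: less_trans[of 0 "2 ^ j"])
    qed
    also have "\<dots> \<le> (\<Sum>a\<in>Z (Suc j). real (m a) / 2 ^ j)"
      by (rule sum_mono2) (use finZ in auto)
    also have "\<dots> = zero_count f (2 ^ Suc j) / 2 ^ j"
      by (simp add: zero_count_def Z_def m_def sum_divide_distrib)
    finally show ?case using step by (simp add: Suc_diff_le)
  qed simp
  have S: "(\<Sum>a\<in>Z j - Z i. real (m a) / cmod a) \<le> \<sigma> (2 ^ (i + 1)) / 2 ^ i" if "i \<le> j" for i j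
  proof -
    have "(\<Sum>l<j-i. zero_count f (2 ^ (l + i + 1)) / 2 ^ (l + i)) =
      (\<Sum>l<j-i. zero_count f (2 ^ l * 2 ^ (i + 1)) / 2 ^ l) / 2 ^ i"
      by (simp add: sum_divide_distrib power_add mult_ac)
    also have "\<dots> \<le> \<sigma> (2 ^ (i + 1)) / 2 ^ i"
      using \<sigma>sum[of "2 ^ (i + 1)"] one_le_power[of "2::real" "i + 1"] by (intro divide_right_mono) auto
    finally show ?thesis using S1[OF that] by linarith
  qed
  \<comment> \<open>Every zero in the product has modulus at least \<open>2 * r\<close>, so
    \<open>u = r / cmod a\<close> is at most 1/2, and there \<open>exp (- 2 * u) \<le> 1 - u\<close>
    and \<open>1 + u \<le> exp u\<close> enclose the factor.\<close>
  have Pup: "cmod (P i j x) \<le> exp (r * (\<sigma> (2 ^ (i + 1)) / 2 ^ i))"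
    and Plow: "cmod (P i j x) \<ge> exp (- (2 * r) * (\<sigma> (2 ^ (i + 1)) / 2 ^ i))"
    if ij: "i \<le> j" and x: "cmod x \<le> r" "2 * r \<le> 2 ^ i" for i j x r
  proof -
    have r0: "0 \<le> r" using x norm_ge_zero[of x] by linarith
    have a: "cmod (1 - x / a) \<le> exp (r / cmod a)" "exp (- (2 * r) / cmod a) \<le> cmod (1 - x / a)"
      if "a \<in> Z j - Z i" for a
    proof -
      have ai: "2 * r \<le> cmod a" "0 < cmod a" using that x Z0[of a j] by (auto simp: Z_def)
      define u where "u = r / cmod a"
      have u: "0 \<le> u" "u \<le> 1 / 2" using ai r0 by (auto simp: u_def field_simps)
      have xu: "cmod (x / a) \<le> u" using x ai by (simp add: u_def norm_divide divide_right_mono)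
      have "cmod (1 - x / a) \<le> 1 + u" using norm_triangle_ineq4[of 1 "x / a"] xu by simp
      also have "\<dots> \<le> exp u" by (rule exp_ge_add_one_self)
      finally show "cmod (1 - x / a) \<le> exp (r / cmod a)" by (simp add: u_def)
      have "exp (- 2 * u) \<le> 1 - u"
      proof -
        have "exp (2 * u) \<ge> 1 + 2 * u" by (rule exp_ge_add_one_self)
        then have "exp (2 * u) * (1 - u) \<ge> (1 + 2 * u) * (1 - u)" using u by (intro mult_right_mono) auto
        moreover have "(1 + 2 * u) * (1 - u) = 1 + u * (1 - 2 * u)" by (simp add: algebra_simps)
        moreover have "u * (1 - 2 * u) \<ge> 0" using u by (intro mult_nonneg_nonneg) auto
        ultimately show ?thesis by (simp add: exp_minus field_simps)
      qed
      also have "\<dots> \<le> cmod (1 - x / a)" using norm_triangle_ineq2[of 1 "x / a"] xu by simp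
      finally show "exp (- (2 * r) / cmod a) \<le> cmod (1 - x / a)" by (simp add: u_def)
    qed
    have nP: "cmod (P i j x) = (\<Prod>a\<in>Z j - Z i. cmod (1 - x / a) ^ m a)"
      by (simp add: P_def prod_norm[symmetric] norm_power)
    have "cmod (P i j x) \<le> (\<Prod>a\<in>Z j - Z i. exp (r / cmod a) ^ m a)"
      unfolding nP by (intro prod_mono conjI power_mono a) auto
    also have "\<dots> = exp (r * (\<Sum>a\<in>Z j - Z i. real (m a) / cmod a))"
      using finZ by (simp add: exp_of_nat_mult[symmetric] exp_sum[symmetric] sum_distrib_left mult_ac)
    also have "\<dots> \<le> exp (r * (\<sigma> (2 ^ (i + 1)) / 2 ^ i))"
      using S[OF ij] r0 by (simp add: mult_left_mono del: times_divide_eq_right)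
    finally show "cmod (P i j x) \<le> exp (r * (\<sigma> (2 ^ (i + 1)) / 2 ^ i))" .
    have "exp (- (2 * r) * (\<sigma> (2 ^ (i + 1)) / 2 ^ i)) \<le> exp (- (2 * r) * (\<Sum>a\<in>Z j - Z i. real (m a) / cmod a))"
      using S[OF ij] r0 by (simp add: mult_left_mono del: times_divide_eq_right)
    also have "\<dots> = (\<Prod>a\<in>Z j - Z i. exp (- (2 * r) / cmod a) ^ m a)"
      using finZ by (simp add: exp_of_nat_mult[symmetric] exp_sum[symmetric] sum_distrib_left mult_ac)
    also have "\<dots> \<le> cmod (P i j x)"
      unfolding nP by (intro prod_mono conjI power_mono a) auto
    finally show "cmod (P i j x) \<ge> exp (- (2 * r) * (\<sigma> (2 ^ (i + 1)) / 2 ^ i))" .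
  qed
  \<comment> \<open>\<open>G i = P i j * G j\<close> read in both directions: once \<open>i\<close>
    is fixed by the radius, all later cofactors are comparable with \<open>G i\<close>, with factors
    independent of \<open>j\<close>.\<close>
  have Gup: "cmod (G j x) \<le> cmod (G i x) * exp (2 * r * (\<sigma> (2 ^ (i + 1)) / 2 ^ i))"
    and Glow: "cmod (G i x) * exp (- r * (\<sigma> (2 ^ (i + 1)) / 2 ^ i)) \<le> cmod (G j x)"
    if ij: "i \<le> j" and x: "cmod x \<le> r" "2 * r \<le> 2 ^ i" for i j x r
  proof -
    let ?s = "\<sigma> (2 ^ (i + 1)) / 2 ^ i"
    have up: "c \<le> g * exp t" if "exp (- t) * c \<le> g" for t c g :: real
      using that by (simp add: exp_minus field_simps)
    have low: "g * exp (- t) \<le> c" if "g \<le> exp t * c" for t c g :: real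
      using that by (simp add: exp_minus field_simps)
    have eq: "cmod (G i x) = cmod (P i j x) * cmod (G j x)" using GP[OF ij, of x] by (simp add: norm_mult)
    have "exp (- (2 * r) * ?s) * cmod (G j x) \<le> cmod (G i x)"
      unfolding eq by (intro mult_right_mono Plow[OF that]) auto
    then show "cmod (G j x) \<le> cmod (G i x) * exp (2 * r * ?s)"
      using up[of "2 * r * ?s"] by (simp only: minus_mult_left)
    have "cmod (G i x) \<le> exp (r * ?s) * cmod (G j x)"
      unfolding eq by (intro mult_right_mono Pup[OF that]) auto
    then show "cmod (G i x) * exp (- r * ?s) \<le> cmod (G j x)"
      using low[of _ "r * ?s"] by (simp only: minus_mult_left)
  qed
  have ex_i: "\<exists>i. 2 * r \<le> 2 ^ i" for r :: real
    using real_arch_pow[of 2 "2 * r"] by (auto intro: less_imp_le)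
  obtain G' \<tau> where G': "G' holomorphic_on UNIV" "strict_mono (\<tau> :: nat \<Rightarrow> nat)"
    "\<And>x. (\<lambda>k. G (\<tau> k) x) \<longlonglongrightarrow> G' x"
  proof (rule Montel[of UNIV "range G" G])
    fix K :: "complex set" assume K: "compact K"
    then obtain r where r: "\<And>x. x \<in> K \<Longrightarrow> cmod x \<le> r"
      using compact_imp_bounded[OF K] by (auto simp: bounded_iff)
    obtain i where i: "2 * r \<le> 2 ^ i" using ex_i by blast
    have "\<exists>B. \<forall>x\<in>K. cmod (G j x) \<le> B" for j
      using compact_imp_bounded[OF compact_continuous_image[OF
        continuous_on_subset[OF holomorphic_on_imp_continuous_on[OF G(1)[of j]] subset_UNIV] K]]
      by (auto simp: bounded_iff)
    then obtain B where B: "\<And>j x. x \<in> K \<Longrightarrow> cmod (G j x) \<le> B j" by metis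
    \<comment> \<open>The comparison with \<open>G i\<close> works only from index \<open>i\<close>
      on; the finitely many earlier cofactors are bounded separately.\<close>
    define C where "C = Max (B ` {..i})"
    have C: "B j \<le> C" if "j \<le> i" for j using that by (simp add: C_def)
    define e where "e = exp (2 * r * (\<sigma> (2 ^ (i + 1)) / 2 ^ i))"
    have "cmod (G j x) \<le> max C (C * e)" if x: "x \<in> K" for j x
    proof (cases "j \<le> i")
      case True then show ?thesis using B[OF x, of j] C[of j] by linarith
    next
      case False
      then have "cmod (G j x) \<le> cmod (G i x) * e" unfolding e_def using Gup[OF _ r[OF x] i] by simp
      also have "\<dots> \<le> C * e" using B[OF x, of i] C[of i] by (intro mult_right_mono) (auto simp: e_def)
      finally show ?thesis by linarith
    qed
    then show "\<exists>B. \<forall>h\<in>range G. \<forall>z\<in>K. cmod (h z) \<le> B" by blast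
  qed (use G in auto)
  \<comment> \<open>The lower bound by \<open>G i\<close> does not depend on the later index, so it
    survives the limit.\<close>
  have G'nz: "G' x \<noteq> 0" for x
  proof -
    obtain i where i: "2 * cmod x \<le> 2 ^ i" using ex_i by blast
    define c where "c = cmod (G i x) * exp (- cmod x * (\<sigma> (2 ^ (i + 1)) / 2 ^ i))"
    have "c > 0" using G(3)[of x i] i norm_ge_zero[of x] by (auto simp: c_def)
    have "\<forall>\<^sub>F k in sequentially. c \<le> cmod (G (\<tau> k) x)"
      using eventually_ge_at_top[of i]
    proof eventually_elim
      case (elim k)
      then show ?case unfolding c_def using seq_suble[OF G'(2), of k] by (intro Glow i) auto
    qed
    then have "c \<le> cmod (G' x)" by (intro tendsto_lowerbound[OF tendsto_norm[OF G'(3)]]) auto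
    then show ?thesis using \<open>c > 0\<close> by auto
  qed
  have "(\<lambda>k. G (\<tau> k) 0) \<longlonglongrightarrow> f 0"
  proof -
    have "G j 0 = f 0" for j using G(2)[of 0 j] by (simp add: Q_def)
    then show ?thesis by simp
  qed
  then have G'0: "G' 0 = f 0" using LIMSEQ_unique G'(3) by blast
  obtain \<delta> where \<delta>: "0 < \<delta>" "\<And>a. f a = 0 \<Longrightarrow> \<delta> \<le> cmod a"
  proof -
    have "isCont f 0" using holomorphic_on_imp_differentiable_at[OF f] 
      by (simp add: field_differentiable_imp_continuous_at)
    from continuous_at_avoid[OF this f0] obtain e where e: "e > 0" "\<And>y. dist 0 y < e \<Longrightarrow> f y \<noteq> 0" by blast
    have "e \<le> cmod a" if "f a = 0" for a using e(2)[of a] that by (cases "e \<le> cmod a") auto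
    then show ?thesis using that[of e] e(1) by blast
  qed
  \<comment> \<open>The least \<open>i\<close> with \<open>2 * r \<le> 2 ^ i\<close> satisfies
    \<open>2 ^ i \<le> 4 * r\<close>. This gives the radius \<open>4 * r\<close> for the zeros in
    \<open>Q i\<close> and \<open>8 * r\<close> for the argument \<open>2 ^ (i + 1)\<close> of
    \<sigma>. As zeros have modulus at least \<delta>, each factor of \<open>Q i\<close> is at most
    \<open>1 + r / \<delta>\<close>.\<close>
  define \<beta> where "\<beta> r = \<bar>\<sigma> (8 * r)\<bar> + zero_count f (4 * r) * ln (1 + 1 / \<delta> * r)" for r
  have \<sigma>nn: "0 \<le> \<sigma> r" if "1 \<le> r" for r using \<sigma>sum[OF that, of 0] by simp
  have "log_slow \<rho> (\<lambda>r. \<bar>\<sigma> (8 * r)\<bar>)"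
    by (rule log_slow_mono[OF log_slow_scale[OF \<sigma>, of 8]]) (use \<rho> \<sigma>nn in auto)
  moreover have "log_slow \<rho> (\<lambda>r. ln (1 + 1 / \<delta> * r))"
  proof (rule log_slow_mono[OF log_slow_add[OF log_slow_const[of \<rho> "ln (1 + 1 / \<delta>)"] log_slow_ln[of \<rho>]]])
    fix r :: real assume r: "1 \<le> r"
    have "ln (1 + 1 / \<delta> * r) \<le> ln ((1 + 1 / \<delta>) * r)"
      using r \<delta> by (intro ln_mono) (auto simp: algebra_simps intro: add_pos_nonneg)
    also have "\<dots> = ln (1 + 1 / \<delta>) + ln r" using r \<delta> by (intro ln_mult_pos) (auto intro: add_pos_nonneg)
    finally show "ln (1 + 1 / \<delta> * r) \<le> ln (1 + 1 / \<delta>) + ln r" .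
  qed (use \<rho> in auto)
  ultimately have \<beta>: "log_slow \<rho> \<beta>"
    unfolding \<beta>_def[abs_def] using \<rho> \<delta>
    by (intro log_slow_add log_slow_mult log_slow_scale[OF slow]) (auto simp: zero_count_nonneg)
  have "cmod (f x) \<le> exp (\<beta> r) * cmod (G' x)" if x: "cmod x \<le> r" and r: "1 \<le> r" for x r
  proof -
    define i where "i = (LEAST i. 2 * r \<le> 2 ^ i)"
    have i: "2 * r \<le> 2 ^ i" unfolding i_def by (rule LeastI_ex[OF ex_i])
    have i4: "2 ^ i \<le> 4 * r"
    proof (cases i)
      case 0 then show ?thesis using r by simp
    next
      case (Suc k)
      then have "\<not> 2 * r \<le> 2 ^ k" using not_less_Least[of k "\<lambda>i. 2 * r \<le> 2 ^ i"] by (simp add: i_def)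
      then show ?thesis using Suc by simp
    qed
    have "cmod (Q i x) = (\<Prod>a\<in>Z i. cmod (1 - x / a) ^ m a)"
      by (simp add: Q_def prod_norm[symmetric] norm_power)
    also have "\<dots> \<le> (\<Prod>a\<in>Z i. (1 + 1 / \<delta> * r) ^ m a)"
    proof (intro prod_mono conjI power_mono)
      fix a assume a: "a \<in> Z i"
      have "cmod (1 - x / a) \<le> 1 + cmod x / cmod a" using norm_triangle_ineq4[of 1 "x / a"] by (simp add: norm_divide)
      also have "cmod x / cmod a \<le> r / \<delta>" using a x r \<delta> by (intro frac_le) (auto simp: Z_def)
      finally show "cmod (1 - x / a) \<le> 1 + 1 / \<delta> * r" by simp
    qed auto
    also have "\<dots> = exp (zero_count f (2 ^ i) * ln (1 + 1 / \<delta> * r))"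
    proof -
      have "exp (ln (1 + 1 / \<delta> * r)) = 1 + 1 / \<delta> * r" using r \<delta> by (intro exp_ln) (auto intro: add_pos_nonneg)
      then have "(\<Prod>a\<in>Z i. (1 + 1 / \<delta> * r) ^ m a) = (\<Prod>a\<in>Z i. exp (ln (1 + 1 / \<delta> * r)) ^ m a)" by (simp only:)
      also have "\<dots> = exp (\<Sum>a\<in>Z i. real (m a) * ln (1 + 1 / \<delta> * r))"
        using finZ by (simp only: exp_of_nat_mult[symmetric] exp_sum)
      finally show ?thesis by (simp add: zero_count_def Z_def m_def sum_distrib_right)
    qed
    also have "\<dots> \<le> exp (zero_count f (4 * r) * ln (1 + 1 / \<delta> * r))"
      using zero_count_mono[OF f ex i4] r \<delta> by (intro exp_le_cancel_iff[THEN iffD2] mult_right_mono) auto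
    finally have Qi: "cmod (Q i x) \<le> exp (zero_count f (4 * r) * ln (1 + 1 / \<delta> * r))" .
    have bound: "cmod (f x) \<le> exp (\<bar>\<sigma> (2 ^ (i + 1))\<bar> + zero_count f (4 * r) * ln (1 + 1 / \<delta> * r)) * cmod (G j x)"
      if j: "i \<le> j" for j
    proof -
      have "r * (\<sigma> (2 ^ (i + 1)) / 2 ^ i) \<le> \<bar>\<sigma> (2 ^ (i + 1))\<bar>"
      proof -
        have "r * (\<sigma> (2 ^ (i + 1)) / 2 ^ i) = r / 2 ^ i * \<sigma> (2 ^ (i + 1))" by simp
        also have "\<dots> \<le> 1 * \<bar>\<sigma> (2 ^ (i + 1))\<bar>"
          using i r \<sigma>nn[of "2 ^ (i + 1)"] one_le_power[of "2::real" "i + 1"] by (intro mult_mono) auto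
        finally show ?thesis by simp
      qed
      then have "cmod (P i j x) \<le> exp \<bar>\<sigma> (2 ^ (i + 1))\<bar>" using Pup[OF j x i] by (meson exp_le_cancel_iff order_trans)
      then have "cmod (Q i x) * cmod (P i j x) \<le> exp (zero_count f (4 * r) * ln (1 + 1 / \<delta> * r)) * exp \<bar>\<sigma> (2 ^ (i + 1))\<bar>"
        using Qi by (intro mult_mono) auto
      then have "cmod (Q i x) * cmod (P i j x) * cmod (G j x) \<le>
         exp (zero_count f (4 * r) * ln (1 + 1 / \<delta> * r)) * exp \<bar>\<sigma> (2 ^ (i + 1))\<bar> * cmod (G j x)"
        by (intro mult_right_mono) auto
      then show ?thesis using G(2)[of x j] QP[OF j, of x] by (simp add: norm_mult exp_add mult_ac)
    qed
    let ?E = "exp (\<bar>\<sigma> (2 ^ (i + 1))\<bar> + zero_count f (4 * r) * ln (1 + 1 / \<delta> * r))"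
    have "\<forall>\<^sub>F k in sequentially. cmod (f x) \<le> ?E * cmod (G (\<tau> k) x)"
      using eventually_ge_at_top[of i]
    proof eventually_elim
      case (elim k)
      then show ?case using seq_suble[OF G'(2), of k] by (intro bound) auto
    qed
    then have "cmod (f x) \<le> ?E * cmod (G' x)"
      by (intro tendsto_lowerbound[OF tendsto_mult[OF tendsto_const tendsto_norm[OF G'(3)]]]) auto
    moreover have "\<bar>\<sigma> (2 ^ (i + 1))\<bar> \<le> \<bar>\<sigma> (8 * r)\<bar>"
      using \<sigma>mono[of "2 ^ (i + 1)" "8 * r"] \<sigma>nn[of "2 ^ (i + 1)"] one_le_power[of "2::real" "i + 1"] i4 by simp
    then have "?E * cmod (G' x) \<le> exp (\<beta> r) * cmod (G' x)"
      by (intro mult_right_mono) (auto simp: \<beta>_def)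
    ultimately show ?thesis by linarith
  qed
  then show ?thesis using that[OF G'(1) G'nz G'0 \<beta>] by blast
qed


section \<open>Exceptional sets of radii\<close>

lemma less_ln_if_exp_less:
  fixes x r :: real
  assumes "exp x < r" shows "x < ln r"
proof -
  have "0 < r" using less_trans[OF exp_gt_zero assms] .
  then show ?thesis using assms ln_less_cancel_iff[of "exp x" r] by simp
qed

definition log_exceptional :: "real set \<Rightarrow> bool" where
  "log_exceptional F \<longleftrightarrow> F \<in> sets lborel \<and> F \<subseteq> {1<..} \<and>
     (\<integral>\<^sup>+ t. indicator F t * ennreal (1 / (t * ln t)) \<partial>lborel) < \<infinity>"

lemma log_exceptional_Un:
  assumes "log_exceptional F" "log_exceptional F'"
  shows "log_exceptional (F \<union> F')"
proof -
  have [measurable]: "F \<in> sets borel" "F' \<in> sets borel" using assms by (auto simp: log_exceptional_def)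
  have "(\<integral>\<^sup>+ t. indicator (F \<union> F') t * ennreal (1 / (t * ln t)) \<partial>lborel) \<le>
    (\<integral>\<^sup>+ t. indicator F t * ennreal (1 / (t * ln t)) + indicator F' t * ennreal (1 / (t * ln t)) \<partial>lborel)"
    by (intro nn_integral_mono) (auto simp: indicator_def)
  also have "\<dots> = (\<integral>\<^sup>+ t. indicator F t * ennreal (1 / (t * ln t)) \<partial>lborel)
      + (\<integral>\<^sup>+ t. indicator F' t * ennreal (1 / (t * ln t)) \<partial>lborel)"
    by (rule nn_integral_add) measurable
  also have "\<dots> < \<infinity>" using assms by (simp add: log_exceptional_def)
  finally show ?thesis using assms by (simp add: log_exceptional_def)
qed

lemma log_exceptional_countable:
  assumes "countable E" shows "log_exceptional (E \<inter> {1<..})"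
proof -
  have "(\<integral>\<^sup>+ t. indicator (E \<inter> {1<..}) t * ennreal (1 / (t * ln t)) \<partial>lborel) = (\<integral>\<^sup>+ t. 0 \<partial>(lborel::real measure))"
  proof (rule nn_integral_cong_AE)
    have "AE t in lborel. t \<notin> E" using assms countable_imp_null_set_lborel AE_not_in by blast
    then show "AE t in lborel. indicator (E \<inter> {1<..}) t * ennreal (1 / (t * ln t)) = 0" by eventually_elim auto
  qed
  moreover have "E \<inter> {1<..} \<in> sets lborel"
    using countable_imp_null_set_lborel[OF countable_subset[OF Int_lower1 assms]] by (rule null_setsD2)
  ultimately show ?thesis by (simp add: log_exceptional_def)
qed

lemma log_exceptional_UN:
  assumes "finite I" "\<And>i. i \<in> I \<Longrightarrow> log_exceptional (F i)"
  shows "log_exceptional (\<Union>i\<in>I. F i)"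
  using assms
proof (induction I rule: finite_induct)
  case empty
  then show ?case using log_exceptional_countable[of "{}"] by simp
qed (auto intro: log_exceptional_Un)

section \<open>Increments on the logarithmic scale\<close>

lemma powr_neg_diff_le:
  fixes x \<sigma> :: real
  assumes "0 < x" "0 \<le> \<sigma>"
  shows "x powr (-\<sigma>) - (x + 1) powr (-\<sigma>) \<le> \<sigma> * x powr (-\<sigma> - 1)"
proof -
  have "ln (1 + 1 / x) \<le> 1 / x" using assms by (intro ln_add_one_self_le_self) auto
  then have "1 - \<sigma> * (1 / x) \<le> 1 + (- \<sigma> * ln (1 + 1 / x))"
    using mult_left_mono[of "ln (1 + 1 / x)" "1 / x" \<sigma>] assms by simp
  also have "\<dots> \<le> exp (- \<sigma> * ln (1 + 1 / x))" by (rule exp_ge_add_one_self)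
  also have "\<dots> = (1 + 1 / x) powr (-\<sigma>)" using assms by (simp add: powr_def add_pos_pos add_nonneg_eq_0_iff)
  finally have "x powr (-\<sigma>) * (1 - \<sigma> * (1 / x)) \<le> x powr (-\<sigma>) * (1 + 1 / x) powr (-\<sigma>)"
    by (intro mult_left_mono) auto
  also have "\<dots> = (x * (1 + 1 / x)) powr (-\<sigma>)" by (simp add: powr_mult)
  also have "x * (1 + 1 / x) = x + 1" using assms by (simp add: field_simps)
  finally show ?thesis using assms by (simp add: powr_diff algebra_simps)
qed

text \<open>Summation by parts moves the difference from \<open>A\<close> to the weight. The
  boundary terms tend to 0 because \<rho> < \<sigma>, and the remaining terms are of order
  \<open>m powr (\<rho> - \<sigma> - 1)\<close>.\<close>

lemma summable_increments_powr:
  fixes A :: "nat \<Rightarrow> real"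
  assumes nn: "\<And>m. 0 \<le> A m" and bd: "\<And>m. 1 \<le> m \<Longrightarrow> A m \<le> K * real m powr \<rho>"
    and \<rho>: "0 < \<rho>" "\<rho> < \<sigma>" and K: "0 \<le> K"
  shows "summable (\<lambda>m. (A (Suc m) - A m) * real m powr (-\<sigma>))"
proof -
  have eq: "(A (Suc m) - A m) * real m powr (-\<sigma>) =
    (A (Suc m) * real (Suc m) powr (-\<sigma>) - A m * real m powr (-\<sigma>))
    + A (Suc m) * (real m powr (-\<sigma>) - real (Suc m) powr (-\<sigma>))" for m by (simp add: algebra_simps)
  have lim: "(\<lambda>m. A m * real m powr (-\<sigma>)) \<longlonglongrightarrow> 0"
  proof (rule tendsto_sandwich[of "\<lambda>_. 0"])
    show "(\<lambda>m. K * real m powr (\<rho> - \<sigma>)) \<longlonglongrightarrow> 0"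
      using tendsto_mult[OF tendsto_const[of K] tendsto_neg_powr[of "\<rho> - \<sigma>", OF _ filterlim_real_sequentially]] \<rho> by simp
    show "\<forall>\<^sub>F m in sequentially. A m * real m powr (-\<sigma>) \<le> K * real m powr (\<rho> - \<sigma>)"
      using eventually_ge_at_top[of 1]
    proof eventually_elim
      case (elim m)
      then have "A m * real m powr (-\<sigma>) \<le> K * real m powr \<rho> * real m powr (-\<sigma>)" by (intro mult_right_mono bd) auto
      then show ?case by (simp add: mult.assoc powr_add[symmetric])
    qed
    show "\<forall>\<^sub>F m in sequentially. 0 \<le> A m * real m powr (-\<sigma>)" using nn by simp
  qed auto
  have s1: "summable (\<lambda>m. A (Suc m) * real (Suc m) powr (-\<sigma>) - A m * real m powr (-\<sigma>))"
    using telescope_summable[OF lim] .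
  have s2: "summable (\<lambda>m. A (Suc m) * (real m powr (-\<sigma>) - real (Suc m) powr (-\<sigma>)))"
  proof (rule summable_comparison_test_ev)
    show "summable (\<lambda>m. K * 2 powr \<rho> * \<sigma> * real m powr (\<rho> - \<sigma> - 1))"
      using \<rho> by (intro summable_mult) (simp add: summable_real_powr_iff)
    show "\<forall>\<^sub>F m in sequentially. norm (A (Suc m) * (real m powr (-\<sigma>) - real (Suc m) powr (-\<sigma>)))
       \<le> K * 2 powr \<rho> * \<sigma> * real m powr (\<rho> - \<sigma> - 1)"
      using eventually_ge_at_top[of 1]
    proof eventually_elim
      case (elim m)
      have m: "real m > 0" using elim by simp
      have d: "0 \<le> real m powr (-\<sigma>) - real (Suc m) powr (-\<sigma>)"
        using m \<rho> powr_mono2'[of "-\<sigma>" "real m" "real (Suc m)"] by simp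
      have "A (Suc m) \<le> K * real (Suc m) powr \<rho>" by (rule bd) simp
      also have "\<dots> \<le> K * (2 * real m) powr \<rho>" using elim \<rho> K by (intro mult_left_mono powr_mono2) auto
      finally have "A (Suc m) * (real m powr (-\<sigma>) - real (Suc m) powr (-\<sigma>)) \<le>
         (K * (2 * real m) powr \<rho>) * (\<sigma> * real m powr (-\<sigma> - 1))"
        using powr_neg_diff_le[OF m, of \<sigma>] \<rho> d nn K by (intro mult_mono) (auto simp: add.commute)
      also have "\<dots> = K * 2 powr \<rho> * \<sigma> * (real m powr \<rho> * real m powr (-\<sigma> - 1))"
        by (simp add: powr_mult mult_ac)
      also have "\<dots> = K * 2 powr \<rho> * \<sigma> * real m powr (\<rho> - \<sigma> - 1)"
        by (simp only: powr_add[symmetric] add_diff_eq) simp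
      finally show ?case using d nn by (simp add: abs_mult)
    qed
  qed
  show ?thesis unfolding eq by (rule summable_add[OF s1 s2])
qed

text \<open>On the logarithmic scale \<open>t = ln r\<close> the increments of \<open>\<psi>\<close> over unit steps have partial sums
  \<open>O(t powr \<rho>)\<close>, so those that exceed \<open>1 / ln t\<close> are sparse enough for \<open>\<integral> dt / t\<close> over them to converge.\<close>
lemma slow_increments_exceptional:
  fixes \<psi> :: "real \<Rightarrow> real"
  assumes mono: "\<And>r s. 1 \<le> r \<Longrightarrow> r \<le> s \<Longrightarrow> \<psi> r \<le> \<psi> s" and nn: "\<And>r. 1 \<le> r \<Longrightarrow> 0 \<le> \<psi> r"
    and bd: "\<And>r. 1 \<le> r \<Longrightarrow> \<psi> r \<le> K * (1 + ln r) powr \<rho>" and \<rho>: "0 < \<rho>" "\<rho> < 1"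
    and lam: "1 < L"
  obtains F R where "log_exceptional F"
    "\<And>r. R < r \<Longrightarrow> r \<notin> F \<Longrightarrow> \<psi> (L * r) - \<psi> (r / L) \<le> 1 / ln (ln r)"
proof -
  define a where "a = ln L"
  have a: "0 < a" using lam by (simp add: a_def)
  define b where "b m = \<psi> (L ^ m)" for m :: nat
  have lp: "1 \<le> L ^ m" for m using lam by simp
  have lnp: "ln (L ^ m) = real m * a" for m using lam by (simp add: ln_realpow a_def)
  have bmono: "b m \<le> b k" if "m \<le> k" for m k unfolding b_def
    using that lam by (intro mono lp power_increasing) auto
  have bm1: "b (m - 1) \<le> b m" "b (m - 1) \<le> b (Suc m)" "b (m - 1) \<le> b (Suc (Suc m))" for m
    by (rule bmono, linarith)+
  have b0: "0 \<le> b m" for m unfolding b_def by (intro nn lp)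
  have K0: "0 \<le> K" using bd[of 1] nn[of 1] by simp
  define K' where "K' = K * (1 + a) powr \<rho>"
  have bK: "b m \<le> K' * real m powr \<rho>" if "1 \<le> m" for m
  proof -
    have "b m \<le> K * (1 + real m * a) powr \<rho>" using bd[OF lp[of m]] by (simp add: b_def lnp)
    also have "\<dots> \<le> K * ((1 + a) * real m) powr \<rho>"
      using that a K0 \<rho> by (intro mult_left_mono powr_mono2) (auto simp: algebra_simps)
    finally show ?thesis by (simp add: K'_def powr_mult mult_ac)
  qed
  \<comment> \<open>The sum of three neighbours telescopes: \<open>A (Suc m) - A m\<close> is
    \<open>b (m + 2) - b (m - 1)\<close> for positive \<open>m\<close>. This covers the passage from
    \<open>r / L\<close> to \<open>L * r\<close> for every \<open>r\<close> between
    \<open>L ^ m\<close> and \<open>L ^ (m + 1)\<close>.\<close>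
  define A where "A m = b (m - 1) + b m + b (Suc m)" for m
  \<comment> \<open>Any value strictly between \<rho> and 1 serves: above \<rho> for summability of
    the increments, below 1 so that \<open>ln (m * a) / m\<close> is eventually at most
    \<open>m powr (- \<sigma>)\<close>.\<close>
  define \<sigma> where "\<sigma> = (1 + \<rho>) / 2"
  have \<sigma>: "\<rho> < \<sigma>" "\<sigma> < 1" using \<rho> by (auto simp: \<sigma>_def)
  have sum: "summable (\<lambda>m. (A (Suc m) - A m) * real m powr (-\<sigma>))"
  proof (rule summable_increments_powr)
    show "A m \<le> 3 * K' * 2 powr \<rho> * real m powr \<rho>" if m: "1 \<le> m" for m
    proof -
      have "A m \<le> 3 * b (Suc m)" unfolding A_def using bm1[of m] bmono[of m "Suc m"] by simp
      also have "\<dots> \<le> 3 * (K' * real (Suc m) powr \<rho>)" using bK[of "Suc m"] by simp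
      also have "\<dots> \<le> 3 * (K' * (2 * real m) powr \<rho>)"
        using m \<rho> K0 a by (intro mult_left_mono powr_mono2) (auto simp: K'_def)
      finally show ?thesis by (simp add: powr_mult mult_ac)
    qed
  qed (use \<rho> \<sigma> K0 b0 in \<open>auto simp: A_def K'_def\<close>)
  have ev: "\<forall>\<^sub>F m in sequentially. 0 < ln (real (Suc m) * a) \<and> ln (real (Suc m) * a) * real m powr (-1) \<le> real m powr (-\<sigma>)"
  proof -
    have "\<forall>\<^sub>F m in sequentially. ln (real (Suc m) * a) * real m powr (-1) \<le> real m powr (-\<sigma>)"
    proof -
      have "((\<lambda>m. ln (real (Suc m) * a) * real m powr (\<sigma> - 1)) \<longlongrightarrow> 0) sequentially"
        using \<sigma> a by real_asymp
      then have "\<forall>\<^sub>F m in sequentially. ln (real (Suc m) * a) * real m powr (\<sigma> - 1) < 1"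
        by (rule order_tendstoD) simp
      then show ?thesis using eventually_gt_at_top[of 0]
      proof eventually_elim
        case (elim m)
        have "ln (real (Suc m) * a) * real m powr (-1) = ln (real (Suc m) * a) * real m powr (\<sigma> - 1) * real m powr (-\<sigma>)"
          by (simp add: mult.assoc powr_add[symmetric])
        also have "\<dots> \<le> 1 * real m powr (-\<sigma>)" using elim by (intro mult_right_mono) auto
        finally show ?case by simp
      qed
    qed
    moreover have "\<forall>\<^sub>F m in sequentially. 0 < ln (real (Suc m) * a)" using a by real_asymp
    ultimately show ?thesis by eventually_elim auto
  qed
  then obtain m1 where m1: "\<And>m. m1 \<le> m \<Longrightarrow> 0 < ln (real (Suc m) * a)"
    "\<And>m. m1 \<le> m \<Longrightarrow> ln (real (Suc m) * a) * real m powr (-1) \<le> real m powr (-\<sigma>)"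
    by (auto simp: eventually_sequentially)
  define m0 where "m0 = max 1 m1"
  \<comment> \<open>The argument is \<open>Suc m\<close> because \<open>ln r\<close> is below
    \<open>(m + 1) * a\<close> on the grid interval; hence the threshold is at most
    \<open>1 / ln (ln r)\<close> there.\<close>
  define bad where "bad m \<longleftrightarrow> m0 \<le> m \<and> 1 / ln (real (Suc m) * a) < A (Suc m) - A m" for m
  define I where "I m = {L ^ m ..< L ^ Suc m}" for m
  define F where "F = (\<Union>m\<in>{m. bad m}. I m)"
  \<comment> \<open>The length \<open>L ^ m * (L - 1)\<close> of the bad interval times the bound
    \<open>1 / (L ^ m * (m * a))\<close> for the density on it.\<close>
  define w where "w m = (if bad m then (L - 1) / (real m * a) else 0)" for m
  have w0: "0 \<le> w m" for m using lam a by (simp add: w_def)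
  have sw: "summable w"
  proof (rule summable_comparison_test)
    show "summable (\<lambda>m. (L - 1) / a * ((A (Suc m) - A m) * real m powr (-\<sigma>)))"
      by (rule summable_mult[OF sum])
    have "norm (w m) \<le> (L - 1) / a * ((A (Suc m) - A m) * real m powr (-\<sigma>))" for m
    proof (cases "bad m")
      case True
      then have m: "m1 \<le> m" "1 \<le> m" by (auto simp: bad_def m0_def)
      have "1 \<le> (A (Suc m) - A m) * ln (real (Suc m) * a)" using True m1(1)[OF m(1)] by (simp add: bad_def divide_less_eq)
      then have "1 * real m powr (-1) \<le> (A (Suc m) - A m) * ln (real (Suc m) * a) * real m powr (-1)"
        by (intro mult_right_mono) auto
      also have "\<dots> \<le> (A (Suc m) - A m) * real m powr (-\<sigma>)"
        unfolding mult.assoc using m1(2)[OF m(1)] bm1[of m] m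
        by (intro mult_left_mono) (auto simp: A_def)
      finally have "1 / real m \<le> (A (Suc m) - A m) * real m powr (-\<sigma>)" using m by (simp add: powr_minus_divide)
      then have "(L - 1) / a * (1 / real m) \<le> (L - 1) / a * ((A (Suc m) - A m) * real m powr (-\<sigma>))"
        using lam a by (intro mult_left_mono) auto
      then show ?thesis using True lam a by (simp add: w_def mult.commute)
    next
      case False
      have "A m \<le> A (Suc m)" unfolding A_def using bm1[of m] bmono[of m "Suc m"] bmono[of "Suc m" "Suc (Suc m)"] by simp
      then show ?thesis using False lam a by (simp add: w_def)
    qed
    then show "\<exists>N. \<forall>m\<ge>N. norm (w m) \<le> (L - 1) / a * ((A (Suc m) - A m) * real m powr (-\<sigma>))" by blast
  qed
  define c where "c m = (if bad m then 1 / (L ^ m * (real m * a)) else 0)" for m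
  have c0: "0 \<le> c m" for m using lam a by (simp add: c_def)
  have cw: "c m * (L ^ Suc m - L ^ m) = w m" for m
  proof -
    have "1 / (L ^ m * (real m * a)) * (L ^ m * (L - 1)) = (L - 1) / (real m * a)" using lam by simp
    moreover have "L ^ Suc m - L ^ m = L ^ m * (L - 1)" by (simp add: algebra_simps)
    ultimately show ?thesis by (simp only: c_def w_def) simp
  qed
  have pt: "indicator F t * ennreal (1 / (t * ln t)) \<le> (\<Sum>m. ennreal (c m) * indicator (I m) t)" for t
  proof (cases "t \<in> F")
    case True
    then obtain m where m: "bad m" "t \<in> I m" by (auto simp: F_def)
    have m1': "1 \<le> m" using m(1) by (auto simp: bad_def m0_def)
    have t: "L ^ m \<le> t" "0 < t" using m(2) lp[of m] by (auto simp: I_def)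
    have "ln (L ^ m) \<le> ln t" using t(1) lam by (intro ln_mono) auto
    then have "real m * a \<le> ln t" by (simp only: lnp)
    then have "L ^ m * (real m * a) \<le> t * ln t" using t a lp[of m] by (intro mult_mono) auto
    moreover have "0 < L ^ m * (real m * a)" using a lam m1' by simp
    ultimately have "1 / (t * ln t) \<le> c m" using m(1) by (simp add: c_def frac_le)
    then have "ennreal (1 / (t * ln t)) \<le> ennreal (c m) * indicator (I m) t" using m(2) by (simp add: ennreal_leI)
    also have "\<dots> \<le> (\<Sum>m. ennreal (c m) * indicator (I m) t)"
      using sum_le_suminf[of "\<lambda>k. ennreal (c k) * indicator (I k) t" "{m}"] sum.insert[of "{}" m "\<lambda>k. ennreal (c k) * indicator (I k) t"]
      by (auto simp del: sum_indicator_mult)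
    finally show ?thesis using True by simp
  qed simp
  have "(\<integral>\<^sup>+ t. indicator F t * ennreal (1 / (t * ln t)) \<partial>lborel) \<le>
      (\<integral>\<^sup>+ t. (\<Sum>m. ennreal (c m) * indicator (I m) t) \<partial>lborel)"
    by (intro nn_integral_mono pt)
  also have "\<dots> = (\<Sum>m. \<integral>\<^sup>+ t. ennreal (c m) * indicator (I m) t \<partial>lborel)"
    by (rule nn_integral_suminf) (simp add: I_def)
  also have "\<dots> = (\<Sum>m. ennreal (w m))"
  proof (rule suminf_cong)
    fix m
    have "L ^ m \<le> L ^ Suc m" using lam by (intro power_increasing) auto
    then have "(\<integral>\<^sup>+ t. ennreal (c m) * indicator (I m) t \<partial>lborel) = ennreal (c m) * ennreal (L ^ Suc m - L ^ m)"
      by (subst nn_integral_cmult_indicator) (simp_all add: I_def)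
    then show "(\<integral>\<^sup>+ t. ennreal (c m) * indicator (I m) t \<partial>lborel) = ennreal (w m)"
      using c0[of m] by (simp only: ennreal_mult'[symmetric] cw)
  qed
  also have "\<dots> < \<infinity>" using suminf_ennreal2[OF w0 sw] by simp
  finally have fin: "(\<integral>\<^sup>+ t. indicator F t * ennreal (1 / (t * ln t)) \<partial>lborel) < \<infinity>" .
  have "1 < t" if tF: "t \<in> F" for t
  proof -
    obtain m where m: "bad m" "t \<in> I m" using tF by (auto simp: F_def)
    then have "1 < L ^ m" using lam by (intro one_less_power) (auto simp: bad_def m0_def)
    then show ?thesis using m(2) by (simp add: I_def)
  qed
  then have "F \<subseteq> {1<..}" by auto
  moreover have "F \<in> sets lborel" unfolding F_def I_def by auto
  ultimately have "log_exceptional F" using fin by (simp add: log_exceptional_def)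
  moreover have "\<psi> (L * r) - \<psi> (r / L) \<le> 1 / ln (ln r)" if r: "max (exp (exp 1)) (L ^ m0) < r" and rF: "r \<notin> F" for r
  proof -
    have r1: "L ^ m0 < r" "exp (exp 1) < r" using r by auto
    obtain k where "r < L ^ k" using real_arch_pow[OF lam] by blast
    \<comment> \<open>The grid interval that contains \<open>r\<close>; it is not bad because
      \<open>r\<close> lies outside \<open>F\<close>.\<close>
    define m where "m = (LEAST k. r < L ^ Suc k)"
    have "L ^ k \<le> L ^ Suc k" using lam by (intro power_increasing) auto
    then have ex: "r < L ^ Suc k" using \<open>r < L ^ k\<close> by linarith
    have m2: "r < L ^ Suc m" unfolding m_def by (rule LeastI[of "\<lambda>k. r < L ^ Suc k", OF ex])
    have "m0 < Suc m" using r1(1) m2 power_strict_increasing_iff[OF lam] by (meson less_trans)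
    then have mm0: "m0 \<le> m" by simp
    have m3: "L ^ m \<le> r"
    proof (cases m)
      case (Suc j)
      then have "\<not> r < L ^ Suc j" using not_less_Least[of j "\<lambda>k. r < L ^ Suc k"] by (simp add: m_def)
      then show ?thesis using Suc by simp
    qed (use r1 lp[of m0] in simp)
    have "\<not> bad m" using rF m2 m3 by (auto simp: F_def I_def)
    then have d: "A (Suc m) - A m \<le> 1 / ln (real (Suc m) * a)" using mm0 by (simp add: bad_def)
    have mpos: "1 \<le> m" using mm0 by (simp add: m0_def)
    have "\<psi> (L * r) \<le> b (Suc (Suc m))" unfolding b_def
    proof (rule mono)
      show "1 \<le> L * r" using lam less_imp_le[OF le_less_trans[OF lp[of m0] r1(1)]] mult_mono[of 1 L 1 r] by simp
    qed (use m2 lam in simp)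
    moreover have "b (m - 1) \<le> \<psi> (r / L)" unfolding b_def
    proof (rule mono[OF lp])
      have "L ^ (m - 1) * L = L ^ m" using mpos by (intro power_minus_mult) simp
      then show "L ^ (m - 1) \<le> r / L" using m3 lam by (simp add: le_divide_eq)
    qed
    moreover have "A (Suc m) - A m = b (Suc (Suc m)) - b (m - 1)" by (simp add: A_def)
    ultimately have "\<psi> (L * r) - \<psi> (r / L) \<le> 1 / ln (real (Suc m) * a)" using d by linarith
    also have "\<dots> \<le> 1 / ln (ln r)"
    proof -
      have rp: "0 < r" using r1(2) less_trans[OF exp_gt_zero] by blast
      have "exp 1 < ln r" by (rule less_ln_if_exp_less[OF r1(2)])
      then have "0 < ln r" "1 < ln (ln r)"
        using less_trans[OF exp_gt_zero] less_ln_if_exp_less by blast+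
      moreover have "ln r \<le> real (Suc m) * a" using ln_mono[OF less_imp_le[OF m2] rp] by (simp only: lnp)
      ultimately have "ln (ln r) \<le> ln (real (Suc m) * a)" by (intro ln_mono) linarith+
      then show ?thesis using \<open>1 < ln (ln r)\<close> by (intro divide_left_mono mult_pos_pos) linarith+
    qed
    finally show ?thesis .
  qed
  ultimately show ?thesis using that by blast
qed

section \<open>The logarithm of the maximum modulus\<close>

text \<open>With the supremum over the closed disc, monotonicity in \<open>r\<close> is a matter of
  inclusion.\<close>

definition log_maximum :: "(complex \<Rightarrow> complex) \<Rightarrow> real \<Rightarrow> real" where
  "log_maximum g r = ln (SUP x\<in>cball 0 r. cmod (g x))"

lemma log_maximum_attained:
  assumes g: "g holomorphic_on UNIV" and nz: "\<exists>w. g w \<noteq> 0" and r: "0 < r"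
  obtains x where "cmod x \<le> r" "g x \<noteq> 0" "log_maximum g r = ln (cmod (g x))"
    "\<And>y. cmod y \<le> r \<Longrightarrow> cmod (g y) \<le> cmod (g x)"
proof -
  have "continuous_on (cball 0 r) (\<lambda>x. cmod (g x))"
    by (intro continuous_intros continuous_on_subset[OF holomorphic_on_imp_continuous_on[OF g]]) auto
  then obtain x where x: "x \<in> cball 0 r" "\<And>y. y \<in> cball 0 r \<Longrightarrow> cmod (g y) \<le> cmod (g x)"
    using continuous_attains_sup[of "cball 0 r" "\<lambda>x. cmod (g x)"] r by auto
  have "(SUP x\<in>cball 0 r. cmod (g x)) = cmod (g x)"
    by (rule cSup_eq_maximum) (use x in auto)
  moreover have "g x \<noteq> 0"
  proof
    assume "g x = 0"
    then have "\<And>y. y \<in> cball 0 r \<Longrightarrow> g y = 0" using x by fastforce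
    then have "cball 0 r \<subseteq> {z. cmod z \<le> r \<and> g z = 0}" by auto
    then have "finite (cball (0::complex) r)" using entire_finite_zeros[OF g nz] finite_subset by blast
    then show False using uncountable_cball[OF r, of "0::complex"] countable_finite by blast
  qed
  ultimately show ?thesis using that[of x] x by (simp add: log_maximum_def)
qed

lemma log_norm_le_log_maximum:
  assumes "g holomorphic_on UNIV" "g x \<noteq> 0" "cmod x \<le> r" "0 < r"
  shows "ln (cmod (g x)) \<le> log_maximum g r"
proof -
  obtain y where y: "log_maximum g r = ln (cmod (g y))" "\<And>y'. cmod y' \<le> r \<Longrightarrow> cmod (g y') \<le> cmod (g y)"
    using log_maximum_attained[OF assms(1) _ assms(4)] assms(2) by blast
  show ?thesis unfolding y(1) using y(2)[OF assms(3)] assms(2) by (intro ln_mono) auto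
qed

lemma norm_le_exp_log_maximum:
  assumes "g holomorphic_on UNIV" "\<exists>w. g w \<noteq> 0" "cmod x \<le> r" "0 < r"
  shows "cmod (g x) \<le> exp (log_maximum g r)"
proof (cases "g x = 0")
  case False
  have "cmod (g x) = exp (ln (cmod (g x)))" using False by simp
  also have "\<dots> \<le> exp (log_maximum g r)" using log_norm_le_log_maximum[OF assms(1) False assms(3,4)] by simp
  finally show ?thesis .
qed simp

lemma log_maximum_le:
  assumes "g holomorphic_on UNIV" "\<exists>w. g w \<noteq> 0" "0 < r"
    "\<And>x. cmod x \<le> r \<Longrightarrow> g x \<noteq> 0 \<Longrightarrow> ln (cmod (g x)) \<le> M"
  shows "log_maximum g r \<le> M"
  using log_maximum_attained[OF assms(1-3)] assms(4) by metis

lemma log_maximum_mono: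
  assumes "g holomorphic_on UNIV" "\<exists>w. g w \<noteq> 0" "0 < r" "r \<le> s"
  shows "log_maximum g r \<le> log_maximum g s"
  by (rule log_maximum_le) (use assms log_norm_le_log_maximum in auto)

text \<open>The Harnack comparison at a point where the maximum over the disc of half the radius is
  attained. The defect is thus an increment of the maximum, which is small at regular radii.\<close>

lemma mean_log_ge_log_maximum:
  assumes g: "g holomorphic_on UNIV" and nz: "\<And>x. cmod x = R \<Longrightarrow> g x \<noteq> 0" and R: "0 < R"
  shows "circle_mean (\<lambda>w. ln (cmod (g w))) R \<ge> log_maximum g R - 3 * (log_maximum g R - log_maximum g (R / 2))"
proof -
  have ex: "\<exists>w. g w \<noteq> 0" using nz[of "of_real R"] R by auto
  obtain x where x: "cmod x \<le> R / 2" "g x \<noteq> 0" "log_maximum g (R / 2) = ln (cmod (g x))"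
    using log_maximum_attained[OF g ex, of "R / 2"] R by auto
  have M: "ln (cmod (g w)) \<le> log_maximum g R" if "cmod w = R" for w
    by (rule log_norm_le_log_maximum[OF g nz[OF that] _ R]) (use that in simp)
  show ?thesis using mean_log_ge_harnack[OF g nz M x(1,2) R] x(3) by simp
qed

text \<open>The increment lemma is applied to the logarithm of the maximum, so the additive bound 1
  / ln ln r turns into a factor \<open>exp \<epsilon>\<close> with \<epsilon> = 1 / ln ln r, at most
  \<open>1 + 2 * \<epsilon>\<close>: an increment that is small relative to the maximum
  itself.\<close>

lemma slow_log_maximum_regular:
  assumes g: "g holomorphic_on UNIV" and nz: "\<exists>w. g w \<noteq> 0" and slow: "log_slow \<rho> (log_maximum g)"
    and \<rho>: "0 < \<rho>" "\<rho> < 1" and L: "1 < L"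
  obtains F R c where "log_exceptional F"
    "\<And>r. R < r \<Longrightarrow> r \<notin> F \<Longrightarrow>
       log_maximum g (L * r) - log_maximum g (r / L) \<le> 2 * (log_maximum g r + c) / ln (ln r)"
    "\<And>r. 1 \<le> r \<Longrightarrow> 0 \<le> log_maximum g r + c"
proof -
  \<comment> \<open>The shift makes \<open>log_maximum g r + c\<close> at least 1 for
    \<open>r \<ge> 1\<close>, so its logarithm is nonnegative.\<close>
  define c where "c = 1 + \<bar>log_maximum g 1\<bar>"
  define \<psi> where "\<psi> r = ln (log_maximum g r + c)" for r
  have mono: "log_maximum g r \<le> log_maximum g s" if "1 \<le> r" "r \<le> s" for r s
    by (rule log_maximum_mono[OF g nz]) (use that in auto)
  have ge1: "1 \<le> log_maximum g r + c" if "1 \<le> r" for r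
    using mono[OF _ that] by (simp add: c_def)
  obtain K where K: "0 \<le> K" "\<And>r. 1 \<le> r \<Longrightarrow> log_maximum g r + c \<le> exp (K * (1 + ln r) powr \<rho>)"
    using log_slow_add[OF slow log_slow_const[of \<rho> c]] \<rho> by (auto elim: log_slowE)
  obtain F R where FR: "log_exceptional F"
    "\<And>r. R < r \<Longrightarrow> r \<notin> F \<Longrightarrow> \<psi> (L * r) - \<psi> (r / L) \<le> 1 / ln (ln r)"
  proof (rule slow_increments_exceptional[of \<psi> K \<rho> L])
    show "\<psi> r \<le> \<psi> s" if "1 \<le> r" "r \<le> s" for r s
      unfolding \<psi>_def using mono[OF that] ge1[OF that(1)] by (intro ln_mono) auto
    show "0 \<le> \<psi> r" if "1 \<le> r" for r unfolding \<psi>_def using ge1[OF that] by simp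
    show "\<psi> r \<le> K * (1 + ln r) powr \<rho>" if "1 \<le> r" for r
      unfolding \<psi>_def using ln_mono[OF K(2)[OF that]] ge1[OF that] by simp
  qed (use \<rho> L in auto)
  have "log_maximum g (L * r) - log_maximum g (r / L) \<le> 2 * (log_maximum g r + c) / ln (ln r)"
    if r: "max (max R L) (exp (exp 1)) < r" and rF: "r \<notin> F" for r
  proof -
    define \<epsilon> where "\<epsilon> = 1 / ln (ln r)"
    have r3: "R < r" "L < r" "exp (exp 1) < r" using r by auto
    have rp: "0 < r" using r3(3) less_trans[OF exp_gt_zero] by blast
    have "exp 1 < ln r" by (rule less_ln_if_exp_less[OF r3(3)])
    then have "1 < ln (ln r)" by (rule less_ln_if_exp_less)
    then have e: "0 \<le> \<epsilon>" "\<epsilon> \<le> 1" by (auto simp: \<epsilon>_def)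
    have rL: "1 \<le> r / L" "r / L \<le> r" "1 \<le> r" using r3 L rp by (auto simp: field_simps)
    have "1 \<le> L * r" using mult_mono[of 1 L 1 r] L rL by simp
    from ge1[OF this] ge1[OF rL(1)] have p: "0 < log_maximum g (L * r) + c" "0 < log_maximum g (r / L) + c" by auto
    have "\<psi> (L * r) \<le> \<epsilon> + \<psi> (r / L)" using FR(2)[OF r3(1) rF] by (simp add: \<epsilon>_def)
    then have "exp (\<psi> (L * r)) \<le> exp \<epsilon> * exp (\<psi> (r / L))" by (simp add: exp_add[symmetric])
    then have "log_maximum g (L * r) + c \<le> exp \<epsilon> * (log_maximum g (r / L) + c)"
      using p by (simp add: \<psi>_def)
    also have "exp \<epsilon> \<le> 1 + \<epsilon> + \<epsilon>\<^sup>2" using exp_bound[OF e] .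
    also have "1 + \<epsilon> + \<epsilon>\<^sup>2 \<le> 1 + 2 * \<epsilon>" using e mult_left_mono[of \<epsilon> 1 \<epsilon>] by (simp add: power2_eq_square)
    finally have "log_maximum g (L * r) + c \<le> (1 + 2 * \<epsilon>) * (log_maximum g (r / L) + c)"
      using p by (simp add: mult_right_mono)
    then have "log_maximum g (L * r) - log_maximum g (r / L) \<le> 2 * \<epsilon> * (log_maximum g (r / L) + c)"
      by (simp add: algebra_simps)
    also have "\<dots> \<le> 2 * \<epsilon> * (log_maximum g r + c)"
      using mono[OF rL(1,2)] e by (intro mult_left_mono) auto
    finally show ?thesis by (simp add: \<epsilon>_def)
  qed
  then show ?thesis using that[OF FR(1), of "max (max R L) (exp (exp 1))" c] ge1 by force
qed

text \<open>Circles through zeros are thus negligible in exceptional sets and can be avoided in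
  every interval of radii; on the other circles the logarithm of the modulus is continuous.\<close>

lemma countable_zero_radii:
  assumes "f holomorphic_on UNIV" "\<exists>w. f w \<noteq> 0"
  shows "countable {r. \<exists>z. cmod z = r \<and> f z = 0}"
proof -
  have "countable (\<Union>k::nat. {z. cmod z \<le> real k \<and> f z = 0})"
    by (rule countable_UN) (auto intro: countable_finite entire_finite_zeros[OF assms])
  moreover have "{z. f z = 0} \<subseteq> (\<Union>k::nat. {z. cmod z \<le> real k \<and> f z = 0})"
  proof
    fix z assume "z \<in> {z. f z = 0}"
    moreover obtain k :: nat where "cmod z \<le> real k" using real_arch_simple by blast
    ultimately show "z \<in> (\<Union>k::nat. {z. cmod z \<le> real k \<and> f z = 0})" by blast
  qed
  ultimately have "countable (cmod ` {z. f z = 0})" using countable_subset by blast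
  then show ?thesis by (rule countable_subset[rotated]) auto
qed

lemma avoid_countable_radius:
  assumes "countable E" "0 < (r::real)"
  obtains R where "r < R" "R < 2 * r" "R \<notin> E"
proof -
  have "\<not> {r<..<2 * r} \<subseteq> E"
    using assms uncountable_open_interval[of r "2 * r"] countable_subset by auto
  then obtain R where "R \<in> {r<..<2 * r}" "R \<notin> E" by blast
  then show ?thesis using that[of R] by auto
qed


section \<open>Askey-Wilson operators on entire functions\<close>

definition joukowski :: "complex \<Rightarrow> complex" where
  "joukowski z = (z + inverse z) / 2"

lemma joukowski_eq_cases:
  assumes "joukowski z = joukowski w" "z \<noteq> 0" "w \<noteq> 0"
  shows "z = w \<or> z * w = 1"
proof -
  have "z + inverse z = w + inverse w" using assms(1) unfolding joukowski_def by (metis divide_cancel_right zero_neq_numeral)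
  then have "z * w * (z + inverse z) = z * w * (w + inverse w)" by simp
  then have "(z - w) * (z * w - 1) = 0" using assms by (simp add: algebra_simps)
  then show ?thesis by auto
qed

lemma aw_z_joukowski:
  assumes "1 < cmod z" shows "aw_z (joukowski z) = z"
proof -
  have z: "1 < cmod z \<and> joukowski z = (z + inverse z) / 2" using assms by (simp add: joukowski_def)
  have "w = z" if w: "1 < cmod w" "joukowski z = (w + inverse w) / 2" for w
  proof -
    have "joukowski z = joukowski w" "z \<noteq> 0" "w \<noteq> 0" using w assms by (auto simp: joukowski_def)
    then consider "z = w" | "z * w = 1" using joukowski_eq_cases by blast
    then show ?thesis
    proof cases
      case 2
      have "1 < cmod z * cmod w" using less_1_mult[OF assms w(1)] .
      moreover have "cmod z * cmod w = 1" using 2 by (metis norm_mult norm_one)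
      ultimately show ?thesis by simp
    qed simp
  qed
  then have "(THE w. 1 < cmod w \<and> joukowski z = (w + inverse w) / 2) = z"
    using z by (intro the_equality) auto
  moreover have "\<exists>w. 1 < cmod w \<and> joukowski z = (w + inverse w) / 2" using z by blast
  ultimately show ?thesis by (simp add: aw_z_def)
qed

lemma aw_z_nonzero: "aw_z x \<noteq> 0"
  and joukowski_aw_z: "joukowski (aw_z x) = x"
proof -
  have "aw_z x \<noteq> 0 \<and> joukowski (aw_z x) = x"
  proof (cases "\<exists>z. 1 < cmod z \<and> x = (z + inverse z) / 2")
    case True
    then obtain z where z: "1 < cmod z" "x = joukowski z" by (auto simp: joukowski_def)
    then show ?thesis using aw_z_joukowski[OF z(1)] by auto
  next
    case False
    define v where "v = \<i> * csqrt (1 - x\<^sup>2)"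
    have "(x + v) * (x - v) = 1" by (simp add: v_def algebra_simps power2_eq_square[symmetric] power_mult_distrib)
    then have "x + v \<noteq> 0" "inverse (x + v) = x - v" by (auto simp: inverse_unique)
    moreover have "aw_z x = x + v" unfolding aw_z_def v_def by (rule if_not_P[OF False])
    ultimately show ?thesis by (simp add: joukowski_def)
  qed
  then show "aw_z x \<noteq> 0" "joukowski (aw_z x) = x" by auto
qed

section \<open>The shifts in terms of a square root\<close>

text \<open>With this root, \<open>aw_z x\<close> is \<open>x + aw_root x\<close> and its inverse is
  \<open>x - aw_root x\<close>, so opposite shifts differ only in the sign of the root.\<close>

definition aw_root :: "complex \<Rightarrow> complex" where
  "aw_root x = aw_z x - x"

lemma inverse_aw_z: "inverse (aw_z x) = x - aw_root x"
  using joukowski_aw_z[of x] by (simp add: joukowski_def aw_root_def field_simps)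

lemma aw_root_square: "(aw_root x)\<^sup>2 = x\<^sup>2 - 1"
proof -
  have "aw_z x * inverse (aw_z x) = 1" using aw_z_nonzero by simp
  then have "(x + aw_root x) * (x - aw_root x) = 1" unfolding inverse_aw_z by (simp add: aw_root_def)
  then show ?thesis by (simp add: algebra_simps power2_eq_square)
qed

lemma aw_eta_eq:
  "aw_eta t f x = f ((t + inverse t) / 2 * x + (t - inverse t) / 2 * aw_root x)"
proof -
  have "t * aw_z x + inverse t * inverse (aw_z x) = t * (x + aw_root x) + inverse t * (x - aw_root x)"
    unfolding inverse_aw_z by (simp add: aw_root_def)
  moreover have "(t * (x + aw_root x) + inverse t * (x - aw_root x)) / 2 =
      (t + inverse t) / 2 * x + (t - inverse t) / 2 * aw_root x"
    by (simp add: algebra_simps add_divide_distrib diff_divide_distrib)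
  ultimately show ?thesis unfolding aw_eta_def by (simp only:)
qed

lemma aw_eta_inverse_eq:
  "aw_eta (inverse t) f x = f ((t + inverse t) / 2 * x - (t - inverse t) / 2 * aw_root x)"
  unfolding aw_eta_eq by (rule arg_cong[of _ _ f]) (simp add: algebra_simps diff_divide_distrib)

lemma aw_eta_joukowski:
  assumes "1 < cmod z" shows "aw_eta t f (joukowski z) = f (joukowski (t * z))"
  unfolding aw_eta_def aw_z_joukowski[OF assms] by (simp add: joukowski_def)

text \<open>\<open>aw_root\<close> is a discontinuous branch of \<open>sqrt (x\<^sup>2 - 1)\<close>, but an expression that is even in it does not
  see the choice of the branch.\<close>
lemma even_in_root_holomorphic:
  fixes \<Phi> :: "complex \<Rightarrow> complex \<Rightarrow> complex"
  assumes even: "\<And>x w. \<Phi> x (- w) = \<Phi> x w"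
    and hol: "\<And>S \<omega>. open S \<Longrightarrow> \<omega> holomorphic_on S \<Longrightarrow> (\<And>x. x \<in> S \<Longrightarrow> \<omega> x \<noteq> 0) \<Longrightarrow>
      (\<lambda>x. \<Phi> x (\<omega> x)) holomorphic_on S"
  shows "(\<lambda>x. \<Phi> x (aw_root x)) holomorphic_on - {1, -1}"
proof -
  \<comment> \<open>On \<open>S1\<close> the branch \<open>csqrt (x^2 - 1)\<close> is holomorphic,
    on \<open>S2\<close> the branch \<open>\<i> * csqrt (1 - x^2)\<close>. The nonzero number
    \<open>x^2 - 1\<close> and its negative cannot both lie on the cut, so the two sets cover
    everything but 1 and -1.\<close>
  define S1 where "S1 = (\<lambda>x::complex. x\<^sup>2 - 1) -` (- \<real>\<^sub>\<le>\<^sub>0)"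
  define S2 where "S2 = (\<lambda>x::complex. 1 - x\<^sup>2) -` (- \<real>\<^sub>\<le>\<^sub>0)"
  have op: "open S1" "open S2" unfolding S1_def S2_def
    by (intro open_vimage open_Compl closed_nonpos_Reals_complex continuous_intros)+
  have eq: "\<Phi> x (aw_root x) = \<Phi> x w" if "w\<^sup>2 = x\<^sup>2 - 1" for x w
  proof -
    have "aw_root x = w \<or> aw_root x = - w" using that aw_root_square[of x] by (metis power2_eq_iff)
    then show ?thesis using even by auto
  qed
  have "(\<lambda>x. \<Phi> x (csqrt (x\<^sup>2 - 1))) holomorphic_on S1"
    by (rule hol[OF op(1)]) (auto simp: S1_def intro!: holomorphic_intros)
  then have h1: "(\<lambda>x. \<Phi> x (aw_root x)) holomorphic_on S1"
    by (rule holomorphic_transform) (rule eq[symmetric], simp)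
  have "(\<lambda>x. \<Phi> x (\<i> * csqrt (1 - x\<^sup>2))) holomorphic_on S2"
    by (rule hol[OF op(2)]) (auto simp: S2_def intro!: holomorphic_intros)
  then have h2: "(\<lambda>x. \<Phi> x (aw_root x)) holomorphic_on S2"
    by (rule holomorphic_transform) (rule eq[symmetric], simp add: power_mult_distrib)
  have "- {1, -1} \<subseteq> S1 \<union> S2"
  proof
    fix x :: complex assume x: "x \<in> - {1, -1}"
    then have "x\<^sup>2 - 1 \<noteq> 0" by (auto simp: power2_eq_1_iff)
    then show "x \<in> S1 \<union> S2"
      by (auto simp: S1_def S2_def complex_nonpos_Reals_iff complex_eq_iff)
  qed
  then show ?thesis using holomorphic_on_Un[OF h1 h2 op] holomorphic_on_subset by blast
qed

lemma norm_aw_root: "cmod (aw_root x) = sqrt (cmod (x\<^sup>2 - 1))"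
  unfolding aw_root_square[symmetric] by (simp add: norm_power)

text \<open>The modulus of the root is independent of the branch and tends to 0 at the branch
  points.\<close>

lemma isCont_aw_root:
  assumes "x \<in> {1, -1}" shows "isCont aw_root x"
proof -
  have "(\<lambda>y. sqrt (cmod (y\<^sup>2 - 1))) \<midarrow>x\<rightarrow> sqrt (cmod (x\<^sup>2 - 1))" by (intro tendsto_intros)
  then have "(\<lambda>y. cmod (aw_root y)) \<midarrow>x\<rightarrow> 0" using assms by (auto simp: norm_aw_root)
  then have "aw_root \<midarrow>x\<rightarrow> 0" by (rule tendsto_norm_zero_cancel)
  moreover have "aw_root x = 0" using norm_aw_root[of x] assms by auto
  ultimately show ?thesis by (simp add: isCont_def)
qed

lemma entire_isCont:
  assumes "f holomorphic_on UNIV" shows "isCont f x"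
  using holomorphic_on_imp_differentiable_at[OF assms] by (simp add: field_differentiable_imp_continuous_at)

lemma entire_comp:
  assumes "f holomorphic_on UNIV" "g holomorphic_on S"
  shows "(\<lambda>x. f (g x)) holomorphic_on S"
  using holomorphic_on_compose_gen[OF assms(2,1)] by (simp add: o_def)

section \<open>Averages and difference quotients of entire functions are entire\<close>

text \<open>A change of sign of the root exchanges the two shifts, so their sum is even in it;
  continuity at 1 and -1 removes the two singularities.\<close>

lemma aw_A_entire:
  assumes f: "f holomorphic_on UNIV"
  shows "aw_A q k f holomorphic_on UNIV"
proof (cases "k = 0")
  case True
  then have "aw_A q k f = f" by (simp add: aw_A_def fun_eq_iff)
  then show ?thesis using f by simp
next
  case False
  define \<alpha> where "\<alpha> = (csqrt q ^ k + inverse (csqrt q ^ k)) / 2"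
  define \<beta> where "\<beta> = (csqrt q ^ k - inverse (csqrt q ^ k)) / 2"
  have eq: "aw_A q k f x = (f (\<alpha> * x + \<beta> * aw_root x) + f (\<alpha> * x - \<beta> * aw_root x)) / 2" for x
    using False by (simp add: aw_A_def power_inverse aw_eta_inverse_eq aw_eta_eq[of "csqrt q ^ k"] \<alpha>_def \<beta>_def)
  have hol: "aw_A q k f holomorphic_on - {1, -1}"
    unfolding eq[abs_def]
    by (rule even_in_root_holomorphic[where \<Phi> = "\<lambda>x w. (f (\<alpha> * x + \<beta> * w) + f (\<alpha> * x - \<beta> * w)) / 2"])
       (auto intro!: holomorphic_intros entire_comp[OF f] simp: add.commute)
  have "isCont (aw_A q k f) x" for x
  proof (cases "x \<in> {1, -1}")
    case True
    have "isCont (\<lambda>x. \<alpha> * x + \<beta> * aw_root x) x" "isCont (\<lambda>x. \<alpha> * x - \<beta> * aw_root x) x"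
      by (intro continuous_intros isCont_aw_root[OF True])+
    from isCont_o2[OF this(1) entire_isCont[OF f]] isCont_o2[OF this(2) entire_isCont[OF f]]
    show ?thesis unfolding eq[abs_def] by (intro continuous_intros) auto
  next
    case False
    moreover have "open (- {1, -1} :: complex set)" by (intro open_Compl finite_imp_closed) auto
    ultimately show ?thesis using hol
      by (metis Compl_iff continuous_on_eq_continuous_at holomorphic_on_imp_continuous_on)
  qed
  then have "continuous_on UNIV (aw_A q k f)" by (simp add: continuous_on_eq_continuous_at)
  then show ?thesis
    by (rule no_isolated_singularity[where K = "{1, -1}"]) (use hol in \<open>auto simp: Compl_eq_Diff_UNIV\<close>)
qed

text \<open>Riemann's removable singularity theorem, with the value at the centre identified as the
  \<open>Lim\<close> that \<open>aw_D\<close> prescribes at 1 and -1.\<close>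

lemma holomorphic_fill_puncture:
  assumes "f holomorphic_on ball \<xi> 1 - {\<xi>}" "\<And>x. x \<in> ball \<xi> 1 - {\<xi>} \<Longrightarrow> cmod (f x) \<le> B"
  shows "(\<lambda>x. if x = \<xi> then Lim (at \<xi>) f else f x) holomorphic_on ball \<xi> 1"
proof -
  have "\<forall>\<^sub>F x in at \<xi>. cmod (f x) \<le> B"
    using assms(2) eventually_at_ball'[of 1 \<xi> UNIV] by (auto elim!: eventually_mono)
  then have "\<exists>g. g holomorphic_on ball \<xi> 1 \<and> (\<forall>z \<in> ball \<xi> 1 - {\<xi>}. g z = f z)"
    using holomorphic_on_extend_bounded[OF assms(1)] by auto
  then obtain g where g: "g holomorphic_on ball \<xi> 1" "\<And>z. z \<in> ball \<xi> 1 - {\<xi>} \<Longrightarrow> g z = f z" by blast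
  have "isCont g \<xi>" using g(1) holomorphic_on_imp_continuous_on continuous_on_interior[of "ball \<xi> 1"] by fastforce
  then have "(g \<longlongrightarrow> g \<xi>) (at \<xi>)" by (simp add: isCont_def)
  then have "(f \<longlongrightarrow> g \<xi>) (at \<xi>)"
    by (rule Lim_transform_eventually)
       (use g(2) eventually_at_ball'[of 1 \<xi> UNIV] in \<open>auto elim!: eventually_mono\<close>)
  then have "Lim (at \<xi>) f = g \<xi>" by (intro tendsto_Lim) auto
  then show ?thesis using holomorphic_transform[OF g(1)] g(2) by auto
qed

lemma entire_lipschitz_ball:
  assumes f: "f holomorphic_on UNIV"
  obtains B where "\<And>x y. cmod x \<le> M \<Longrightarrow> cmod y \<le> M \<Longrightarrow> cmod (f x - f y) \<le> B * cmod (x - y)"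
proof -
  have "continuous_on (cball 0 M) (deriv f)"
    using holomorphic_deriv[OF f] holomorphic_on_imp_continuous_on continuous_on_subset by blast
  then have "bounded (deriv f ` cball 0 M)" by (intro compact_imp_bounded compact_continuous_image) auto
  then obtain B where "\<forall>y\<in>deriv f ` cball 0 M. cmod y \<le> B" unfolding bounded_iff by blast
  then have B: "cmod (deriv f x) \<le> B" if "cmod x \<le> M" for x using that by auto
  have "cmod (f x - f y) \<le> B * cmod (x - y)" if "cmod x \<le> M" "cmod y \<le> M" for x y
    by (rule field_differentiable_bound[of "cball 0 M" f "deriv f"])
       (use that B holomorphic_derivI[OF f open_UNIV] in \<open>auto intro: has_field_derivative_at_within\<close>)
  then show ?thesis using that by blast
qed

text \<open>Numerator and denominator are both odd in the root, so the quotient is even. Near 1 and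
  -1, where the root vanishes, a Lipschitz bound for \<open>f\<close> keeps the quotient
  bounded.\<close>

lemma aw_D_entire:
  assumes f: "f holomorphic_on UNIV" and q: "0 < cmod q" "cmod q < 1"
  shows "aw_D q f holomorphic_on UNIV"
proof -
  define s where "s = csqrt q"
  have s: "s \<noteq> 0" "s\<^sup>2 = q" using q by (auto simp: s_def)
  define \<alpha> where "\<alpha> = (s + inverse s) / 2"
  define \<beta> where "\<beta> = (s - inverse s) / 2"
  have b: "\<beta> \<noteq> 0"
  proof
    assume "\<beta> = 0"
    then have "q = 1" using s by (simp add: \<beta>_def field_simps power2_eq_square)
    then show False using q by simp
  qed
  have eq: "aw_quot q f x = (f (\<alpha> * x + \<beta> * aw_root x) - f (\<alpha> * x - \<beta> * aw_root x)) / (2 * \<beta> * aw_root x)" for x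
    unfolding aw_quot_def s_def[symmetric] aw_eta_inverse_eq aw_eta_eq[of s] id_apply
      \<alpha>_def[symmetric] \<beta>_def[symmetric] by (simp add: algebra_simps)
  have hol: "aw_quot q f holomorphic_on - {1, -1}"
    unfolding eq[abs_def]
  proof (rule even_in_root_holomorphic[where \<Phi> = "\<lambda>x w. (f (\<alpha> * x + \<beta> * w) - f (\<alpha> * x - \<beta> * w)) / (2 * \<beta> * w)"])
    show "(f (\<alpha> * x + \<beta> * - w) - f (\<alpha> * x - \<beta> * - w)) / (2 * \<beta> * - w) =
      (f (\<alpha> * x + \<beta> * w) - f (\<alpha> * x - \<beta> * w)) / (2 * \<beta> * w)" for x w
    proof -
      have "(a - b) / (- c) = (b - a) / c" for a b c :: complex
        by (metis minus_diff_eq minus_divide_divide)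
      then show ?thesis by simp
    qed
  qed (use b in \<open>auto intro!: holomorphic_intros entire_comp[OF f]\<close>)
  \<comment> \<open>For \<open>cmod x \<le> 3\<close> the number \<open>x^2 - 1\<close> has modulus
    at most 16, so the root has modulus at most 4 and both shifted points stay within
    \<open>M\<close>.\<close>
  define M where "M = cmod \<alpha> * 3 + cmod \<beta> * 4"
  obtain B where B: "\<And>x y. cmod x \<le> M \<Longrightarrow> cmod y \<le> M \<Longrightarrow> cmod (f x - f y) \<le> B * cmod (x - y)"
    using entire_lipschitz_ball[OF f] by blast
  have bound: "cmod (aw_quot q f x) \<le> B" if x: "cmod x \<le> 3" "x \<noteq> 1" "x \<noteq> -1" for x
  proof -
    have v0: "aw_root x \<noteq> 0" using aw_root_square[of x] x by (auto simp: power2_eq_1_iff)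
    have "cmod (x\<^sup>2 - 1) \<le> 16"
      using norm_triangle_ineq4[of "x\<^sup>2" 1] power_mono[OF x(1), of 2] by (simp add: norm_power)
    then have v: "cmod (aw_root x) \<le> 4" using real_sqrt_le_mono[of _ 16] by (simp add: norm_aw_root)
    have "cmod (\<alpha> * x) + cmod (\<beta> * aw_root x) \<le> M"
      unfolding M_def norm_mult using x v by (intro add_mono mult_left_mono) auto
    then have "cmod (\<alpha> * x + \<beta> * aw_root x) \<le> M" "cmod (\<alpha> * x - \<beta> * aw_root x) \<le> M"
      using norm_triangle_ineq[of "\<alpha> * x" "\<beta> * aw_root x"] norm_triangle_ineq4[of "\<alpha> * x" "\<beta> * aw_root x"] by linarith+
    from B[OF this] have "cmod (f (\<alpha> * x + \<beta> * aw_root x) - f (\<alpha> * x - \<beta> * aw_root x)) \<le> B * cmod (2 * \<beta> * aw_root x)"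
      by (simp add: algebra_simps)
    then show ?thesis unfolding eq norm_divide using v0 b by (simp add: divide_le_eq)
  qed
  have loc: "aw_D q f holomorphic_on ball \<xi> 1" if xi: "\<xi> \<in> {1, -1}" for \<xi>
  proof -
    have sub: "ball \<xi> 1 - {\<xi>} \<subseteq> - {1, -1}" using xi by (auto simp: dist_norm)
    have "(\<lambda>x. if x = \<xi> then Lim (at \<xi>) (aw_quot q f) else aw_quot q f x) holomorphic_on ball \<xi> 1"
    proof (rule holomorphic_fill_puncture[OF holomorphic_on_subset[OF hol sub]])
      fix x assume x: "x \<in> ball \<xi> 1 - {\<xi>}"
      then have "x \<in> - {1, -1}" using sub by blast
      moreover have "cmod x \<le> 3" using x xi norm_triangle_ineq2[of x \<xi>] by (auto simp: dist_norm norm_minus_commute)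
      ultimately show "cmod (aw_quot q f x) \<le> B" using bound by auto
    qed
    then show ?thesis
      by (rule holomorphic_transform) (use sub xi in \<open>auto simp: aw_D_def\<close>)
  qed
  have op: "open (- {1, -1} :: complex set)" by (intro open_Compl finite_imp_closed) auto
  have "aw_D q f holomorphic_on - {1, -1}"
    by (rule holomorphic_transform[OF hol]) (auto simp: aw_D_def)
  then have "aw_D q f holomorphic_on (- {1, -1} \<union> (ball 1 1 \<union> ball (-1) 1))"
    using loc op by (intro holomorphic_on_Un open_Un) auto
  moreover have "- {1, -1} \<union> (ball 1 1 \<union> ball (-1) 1) = (UNIV :: complex set)" by auto
  ultimately show ?thesis by simp
qed

lemma aw_D_pow_entire:
  assumes "f holomorphic_on UNIV" "0 < cmod q" "cmod q < 1"
  shows "aw_D_pow q i f holomorphic_on UNIV"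
proof (induction i)
  case (Suc i)
  then show ?case using aw_D_entire[OF _ assms(2,3)] by (simp add: aw_D_pow_def)
qed (use assms in \<open>simp add: aw_D_pow_def\<close>)

lemma aw_wronskian_entire:
  assumes "\<And>k. k \<le> n \<Longrightarrow> fs k holomorphic_on UNIV" "0 < cmod q" "cmod q < 1"
  shows "aw_wronskian q n fs holomorphic_on UNIV"
proof -
  have "aw_A q (n - i) (aw_D_pow q i (fs (\<sigma> i))) holomorphic_on UNIV"
    if "\<sigma> permutes {0..n}" "i \<in> {0..n}" for \<sigma> i
    using permutes_in_image[OF that(1), of i] that(2) assms by (intro aw_A_entire aw_D_pow_entire) auto
  then have "(\<lambda>x. aw_wronskian q n fs x) holomorphic_on UNIV" 
    unfolding aw_wronskian_def by (intro holomorphic_intros) auto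
  then show ?thesis by simp
qed


section \<open>The Wronskian as a determinant of point values\<close>

text \<open>\<open>aw_z\<close> inverts the Joukowski map where \<open>1 < cmod z\<close>. In this
  coordinate the shifts are multiplications, so the operators can be iterated explicitly.\<close>

lemma aw_D_joukowski:
  assumes "2 < cmod z"
  shows "aw_D q f (joukowski z) =
    (f (joukowski (csqrt q * z)) - f (joukowski (inverse (csqrt q) * z))) /
    (joukowski (csqrt q * z) - joukowski (inverse (csqrt q) * z))"
proof -
  have z: "1 < cmod z" using assms by simp
  have n: "z \<noteq> 1" "z \<noteq> -1" "z \<noteq> 0" using assms by auto
  have "z * (-1) \<noteq> 1" using n(2) by (metis minus_equation_iff mult_minus1_right)
  then have "joukowski z \<noteq> joukowski 1" "joukowski z \<noteq> joukowski (-1)"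
    using joukowski_eq_cases[of z 1] joukowski_eq_cases[of z "-1"] n by auto
  then have "joukowski z \<noteq> 1" "joukowski z \<noteq> -1" by (auto simp: joukowski_def)
  then show ?thesis by (simp add: aw_D_def aw_quot_def aw_eta_joukowski[OF z])
qed

lemma aw_A_joukowski:
  assumes "1 < cmod z"
  shows "aw_A q m f (joukowski z) =
    (f (joukowski (csqrt q ^ m * z)) + f (joukowski (inverse (csqrt q) ^ m * z))) / 2"
  using assms by (simp add: aw_A_def aw_eta_joukowski)

text \<open>Keeps the denominators away from 0, so that iterated difference quotients have bounded
  coefficients.\<close>

lemma joukowski_diff_ge:
  assumes "s \<noteq> 0" "2 \<le> cmod z"
  shows "cmod (s - inverse s) / 2 \<le> cmod (joukowski (s * z) - joukowski (inverse s * z))"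
proof -
  have "joukowski (s * z) - joukowski (inverse s * z) = (s - inverse s) / 2 * (z - inverse z)"
    using assms by (simp add: joukowski_def algebra_simps add_divide_distrib diff_divide_distrib)
  moreover have "1 \<le> cmod (z - inverse z)"
  proof -
    have "cmod (inverse z) \<le> 1" using assms by (simp add: norm_inverse inverse_le_1_iff)
    then show ?thesis using norm_triangle_ineq2[of z "inverse z"] assms by linarith
  qed
  ultimately show ?thesis
    using mult_left_mono[of 1 "cmod (z - inverse z)" "cmod ((s - inverse s) / 2)"]
    by (simp only: norm_mult) (simp add: norm_divide)
qed

text \<open>Each application multiplies \<open>z\<close> by \<open>csqrt q\<close> or its inverse,
  so after \<open>i\<close> steps the exponents are i, i - 2, ..., -i. The coefficients do not
  depend on \<open>f\<close>, which is what makes the later matrix factorisation possible.\<close>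

lemma aw_D_pow_joukowski:
  assumes q: "0 < cmod q" "cmod q < 1"
  shows "\<exists>c R B. 0 \<le> B \<and> (\<forall>z. R \<le> cmod z \<longrightarrow> (\<forall>k\<le>i. cmod (c k z) \<le> B) \<and>
     (\<forall>f. aw_D_pow q i f (joukowski z) =
        (\<Sum>k\<le>i. c k z * f (joukowski (csqrt q powi (int i - 2 * int k) * z)))))"
proof (induction i)
  case 0
  show ?case
    by (intro exI[of _ "\<lambda>k z. 1"] exI[of _ "0::real"] exI[of _ "1::real"]) (auto simp: aw_D_pow_def)
next
  case (Suc i)
  define s where "s = csqrt q"
  have s: "s \<noteq> 0" "s\<^sup>2 = q" using q by (auto simp: s_def)
  have s1: "cmod s < 1" 
  proof -
    have "(cmod s)\<^sup>2 < 1" using s(2) q by (metis norm_power)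
    then show ?thesis by (simp add: power_less_one_iff abs_square_less_1)
  qed
  obtain c R B where IH: "0 \<le> B" "\<And>z k. R \<le> cmod z \<Longrightarrow> k \<le> i \<Longrightarrow> cmod (c k z) \<le> B"
    "\<And>z f. R \<le> cmod z \<Longrightarrow> aw_D_pow q i f (joukowski z) =
        (\<Sum>k\<le>i. c k z * f (joukowski (s powi (int i - 2 * int k) * z)))"
    using Suc unfolding s_def by blast
  define den where "den z = joukowski (s * z) - joukowski (inverse s * z)" for z
  \<comment> \<open>Multiplying \<open>z\<close> by \<open>s\<close> keeps the index
    \<open>k\<close> when \<open>i\<close> is raised by one, multiplying by the inverse raises
    \<open>k\<close> by one; hence the shift to \<open>k - 1\<close> in the second term.\<close>
  define c' where "c' k z = ((if k \<le> i then c k (s * z) else 0) - (if 1 \<le> k then c (k - 1) (inverse s * z) else 0)) / den z" for k z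
  define d where "d = cmod (s - inverse s) / 2"
  have d: "0 < d"
  proof -
    have "s - inverse s \<noteq> 0"
    proof
      assume "s - inverse s = 0"
      then have "s * (s - inverse s) = 0" by simp
      then have "q = 1" using s by (simp add: right_diff_distrib power2_eq_square)
      then show False using q by simp
    qed
    then show ?thesis by (simp add: d_def)
  qed
  \<comment> \<open>Since \<open>cmod s < 1\<close>, the point \<open>s * z\<close> lies closer to
    the origin; \<open>R / cmod s\<close> keeps it in the domain of the induction
    hypothesis.\<close>
  define R' where "R' = max 3 (max R (R / cmod s))"
  have main: "(\<forall>k\<le>Suc i. cmod (c' k z) \<le> 2 * B / d) \<and> (\<forall>f. aw_D_pow q (Suc i) f (joukowski z) =
        (\<Sum>k\<le>Suc i. c' k z * f (joukowski (s powi (int (Suc i) - 2 * int k) * z))))" if z: "R' \<le> cmod z" for z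
  proof -
    have z3: "3 \<le> cmod z" "R \<le> cmod z" "R / cmod s \<le> cmod z" using z by (auto simp: R'_def)
    have zs: "R \<le> cmod (s * z)" using z3 s by (simp add: norm_mult divide_le_eq mult.commute)
    have "1 * cmod z \<le> cmod (inverse s) * cmod z"
      using s1 s by (intro mult_right_mono) (auto simp: norm_inverse one_le_inverse_iff)
    then have zs': "R \<le> cmod (inverse s * z)" using z3 by (simp add: norm_mult)
    have dz: "d \<le> cmod (den z)" unfolding d_def den_def using joukowski_diff_ge[OF s(1)] z3 by simp
    have "cmod (c' k z) \<le> 2 * B / d" if k: "k \<le> Suc i" for k
    proof -
      have "cmod ((if k \<le> i then c k (s * z) else 0) - (if 1 \<le> k then c (k - 1) (inverse s * z) else 0))
         \<le> cmod (if k \<le> i then c k (s * z) else 0) + cmod (if 1 \<le> k then c (k - 1) (inverse s * z) else 0)"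
        by (rule norm_triangle_ineq4)
      also have "\<dots> \<le> B + B" using IH(1) IH(2)[OF zs, of k] IH(2)[OF zs', of "k - 1"] k by (intro add_mono) auto
      finally show ?thesis unfolding c'_def norm_divide using dz d IH(1) by (intro frac_le) auto
    qed
    moreover have "aw_D_pow q (Suc i) f (joukowski z) =
        (\<Sum>k\<le>Suc i. c' k z * f (joukowski (s powi (int (Suc i) - 2 * int k) * z)))" for f
    proof -
      define y where "y k = f (joukowski (s powi (int (Suc i) - 2 * int k) * z))" for k
      have p1: "s powi (int i - 2 * int k) * (s * z) = s powi (int (Suc i) - 2 * int k) * z" for k
      proof -
        have "s powi (int i - 2 * int k) * s = s powi (int i - 2 * int k + 1)"
          using s by (simp add: power_int_add)
        moreover have "int i - 2 * int k + 1 = int (Suc i) - 2 * int k" by simp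
        ultimately show ?thesis by (simp only: mult.assoc[symmetric])
      qed
      have p2: "s powi (int i - 2 * int k) * (inverse s * z) = s powi (int (Suc i) - 2 * int (Suc k)) * z" for k
      proof -
        have "s powi (int i - 2 * int k) * inverse s = s powi (int i - 2 * int k - 1)"
          using s by (simp add: power_int_diff divide_inverse)
        moreover have "int i - 2 * int k - 1 = int (Suc i) - 2 * int (Suc k)" by simp
        ultimately show ?thesis by (simp only: mult.assoc[symmetric])
      qed
      have "aw_D_pow q (Suc i) f (joukowski z) = aw_D q (aw_D_pow q i f) (joukowski z)" by (simp add: aw_D_pow_def)
      also have "\<dots> = (aw_D_pow q i f (joukowski (s * z)) - aw_D_pow q i f (joukowski (inverse s * z))) / den z"
        unfolding s_def den_def by (rule aw_D_joukowski) (use z3 in simp)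
      also have "aw_D_pow q i f (joukowski (s * z)) = (\<Sum>k\<le>i. c k (s * z) * y k)"
        unfolding IH(3)[OF zs] p1 y_def ..
      also have "\<dots> = (\<Sum>k\<le>Suc i. (if k \<le> i then c k (s * z) else 0) * y k)" by simp
      also have "aw_D_pow q i f (joukowski (inverse s * z)) = (\<Sum>k\<le>i. c k (inverse s * z) * y (Suc k))"
        unfolding IH(3)[OF zs'] p2 y_def ..
      also have "\<dots> = (\<Sum>k\<le>Suc i. (if 1 \<le> k then c (k - 1) (inverse s * z) else 0) * y k)"
        by (subst sum.atMost_Suc_shift) simp
      finally show ?thesis
        by (simp only: c'_def y_def sum_subtractf[symmetric] sum_divide_distrib left_diff_distrib[symmetric]
          times_divide_eq_left)
    qed
    ultimately show ?thesis by blast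
  qed
  have "0 \<le> 2 * B / d" using IH(1) d by simp
  then show ?case using main unfolding s_def by blast
qed

lemma sum_shift_index:
  fixes a :: "nat \<Rightarrow> 'a::comm_ring_1"
  assumes "i \<le> n"
  shows "(\<Sum>k\<le>n. (if n - i \<le> k then a (k - (n - i)) else 0) * y k) = (\<Sum>k\<le>i. a k * y (k + (n - i)))"
proof -
  have "(\<Sum>k\<le>i. a k * y (k + (n - i))) = (\<Sum>k\<in>(\<lambda>k. k + (n - i)) ` {..i}. a (k - (n - i)) * y k)"
    by (subst sum.reindex) (auto simp: inj_on_def)
  also have "\<dots> = (\<Sum>k\<le>n. (if n - i \<le> k then a (k - (n - i)) else 0) * y k)"
  proof (rule sum.mono_neutral_cong_left)
    have "k \<in> (\<lambda>k. k + (n - i)) ` {..i}" if "k \<le> n" "n - i \<le> k" for k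
      using that assms by (intro image_eqI[of _ _ "k - (n - i)"]) auto
    then show "\<forall>k\<in>{..n} - (\<lambda>k. k + (n - i)) ` {..i}. (if n - i \<le> k then a (k - (n - i)) else 0) * y k = 0" by auto
  qed (use assms in auto)
  finally show ?thesis ..
qed

text \<open>Averaging over the shifts by \<open>n - i\<close> moves the exponents i, ..., -i of the
  difference operator up and down by \<open>n - i\<close>, into the list n, n - 2, ..., -n. So every
  row of the Wronskian uses the same \<open>n + 1\<close> points.\<close>

lemma aw_row_joukowski:
  assumes q: "0 < cmod q" "cmod q < 1" and i: "i \<le> n"
  shows "\<exists>c R B. 0 \<le> B \<and> (\<forall>z. R \<le> cmod z \<longrightarrow> (\<forall>k\<le>n. cmod (c k z) \<le> B) \<and>
     (\<forall>f. aw_A q (n - i) (aw_D_pow q i f) (joukowski z) =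
        (\<Sum>k\<le>n. c k z * f (joukowski (csqrt q powi (int n - 2 * int k) * z)))))"
proof -
  define s where "s = csqrt q"
  have s: "s \<noteq> 0" "s\<^sup>2 = q" using q by (auto simp: s_def)
  have s1: "cmod s < 1" 
  proof -
    have "(cmod s)\<^sup>2 < 1" using s(2) q by (metis norm_power)
    then show ?thesis by (simp add: power_less_one_iff abs_square_less_1)
  qed
  define m where "m = n - i"
  obtain c R B where IH: "0 \<le> B" "\<And>z k. R \<le> cmod z \<Longrightarrow> k \<le> i \<Longrightarrow> cmod (c k z) \<le> B"
    "\<And>z f. R \<le> cmod z \<Longrightarrow> aw_D_pow q i f (joukowski z) =
        (\<Sum>k\<le>i. c k z * f (joukowski (s powi (int i - 2 * int k) * z)))"
    using aw_D_pow_joukowski[OF q, of i] unfolding s_def by blast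
  define c' where "c' k z = ((if k \<le> i then c k (s ^ m * z) else 0) + (if n - i \<le> k then c (k - (n - i)) (inverse s ^ m * z) else 0)) / 2" for k z
  define R' where "R' = max 2 (max R (R / cmod (s ^ m)))"
  have main: "(\<forall>k\<le>n. cmod (c' k z) \<le> B) \<and> (\<forall>f. aw_A q (n - i) (aw_D_pow q i f) (joukowski z) =
        (\<Sum>k\<le>n. c' k z * f (joukowski (s powi (int n - 2 * int k) * z))))" if z: "R' \<le> cmod z" for z
  proof -
    have z3: "2 \<le> cmod z" "R \<le> cmod z" "R / cmod (s ^ m) \<le> cmod z" using z by (auto simp: R'_def)
    have zs: "R \<le> cmod (s ^ m * z)" using z3 s by (simp add: norm_mult divide_le_eq mult.commute norm_power)
    have "1 * cmod z \<le> cmod (inverse s ^ m) * cmod z"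
      using s1 s by (intro mult_right_mono) (auto simp: norm_inverse norm_power one_le_inverse_iff intro!: one_le_power)
    then have zs': "R \<le> cmod (inverse s ^ m * z)" using z3 by (simp add: norm_mult)
    have "cmod (c' k z) \<le> B" if k: "k \<le> n" for k
    proof -
      have "cmod ((if k \<le> i then c k (s ^ m * z) else 0) + (if n - i \<le> k then c (k - (n - i)) (inverse s ^ m * z) else 0))
         \<le> cmod (if k \<le> i then c k (s ^ m * z) else 0) + cmod (if n - i \<le> k then c (k - (n - i)) (inverse s ^ m * z) else 0)"
        by (rule norm_triangle_ineq)
      also have "\<dots> \<le> B + B" using IH(1) IH(2)[OF zs, of k] IH(2)[OF zs', of "k - (n - i)"] k i by (intro add_mono) auto
      finally show ?thesis unfolding c'_def norm_divide by simp
    qed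
    moreover have "aw_A q (n - i) (aw_D_pow q i f) (joukowski z) =
        (\<Sum>k\<le>n. c' k z * f (joukowski (s powi (int n - 2 * int k) * z)))" for f
    proof -
      define y where "y k = f (joukowski (s powi (int n - 2 * int k) * z))" for k
      have p1: "s powi (int i - 2 * int k) * (s ^ m * z) = s powi (int n - 2 * int k) * z" for k
      proof -
        have "s powi (int i - 2 * int k) * s ^ m = s powi (int i - 2 * int k + int m)"
          using s by (simp add: power_int_add)
        moreover have "int i - 2 * int k + int m = int n - 2 * int k" using i by (simp add: m_def of_nat_diff)
        ultimately show ?thesis by (simp only: mult.assoc[symmetric])
      qed
      have p2: "s powi (int i - 2 * int k) * (inverse s ^ m * z) = s powi (int n - 2 * int (k + (n - i))) * z" for k
      proof -
        have "s powi (int i - 2 * int k) * inverse s ^ m = s powi (int i - 2 * int k - int m)"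
          using s by (simp add: power_int_diff divide_inverse power_inverse)
        moreover have "int i - 2 * int k - int m = int n - 2 * int (k + (n - i))" using i by (simp add: m_def of_nat_diff)
        ultimately show ?thesis by (simp only: mult.assoc[symmetric])
      qed
      have "aw_A q (n - i) (aw_D_pow q i f) (joukowski z) =
        (aw_D_pow q i f (joukowski (s ^ m * z)) + aw_D_pow q i f (joukowski (inverse s ^ m * z))) / 2"
        unfolding s_def m_def by (rule aw_A_joukowski) (use z3 in simp)
      also have "aw_D_pow q i f (joukowski (s ^ m * z)) = (\<Sum>k\<le>i. c k (s ^ m * z) * y k)"
        unfolding IH(3)[OF zs] p1 y_def ..
      also have "\<dots> = (\<Sum>k\<le>n. (if k \<le> i then c k (s ^ m * z) else 0) * y k)"
        by (rule sum.mono_neutral_cong_left) (use i in auto)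
      also have "aw_D_pow q i f (joukowski (inverse s ^ m * z)) = (\<Sum>k\<le>i. c k (inverse s ^ m * z) * y (k + (n - i)))"
        unfolding IH(3)[OF zs'] p2 y_def ..
      also have "\<dots> = (\<Sum>k\<le>n. (if n - i \<le> k then c (k - (n - i)) (inverse s ^ m * z) else 0) * y k)"
        using sum_shift_index[OF i, of "\<lambda>k. c k (inverse s ^ m * z)" y] by simp
      finally show ?thesis
        by (simp only: c'_def y_def sum.distrib[symmetric] sum_divide_distrib distrib_right[symmetric]
          times_divide_eq_left)
    qed
    ultimately show ?thesis by blast
  qed
  then show ?thesis using IH(1) unfolding s_def by blast
qed

section \<open>Leibniz determinants\<close>

text \<open>The Leibniz sum in the form used by \<open>aw_wronskian\<close>; multiplicativity is
  carried over from the determinant of matrices.\<close>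

definition nat_det :: "nat \<Rightarrow> (nat \<Rightarrow> nat \<Rightarrow> complex) \<Rightarrow> complex" where
  "nat_det n M = (\<Sum>\<sigma> | \<sigma> permutes {0..n}. of_int (sign \<sigma>) * (\<Prod>i\<in>{0..n}. M i (\<sigma> i)))"

lemma nat_det_cong:
  assumes "\<And>i j. i \<le> n \<Longrightarrow> j \<le> n \<Longrightarrow> M i j = M' i j"
  shows "nat_det n M = nat_det n M'"
  unfolding nat_det_def
proof (rule sum.cong)
  fix \<sigma> assume "\<sigma> \<in> {\<sigma>. \<sigma> permutes {0..n}}"
  then have "\<sigma> i \<le> n" if "i \<le> n" for i using permutes_in_image[of \<sigma> "{0..n}" i] that by auto
  then show "of_int (sign \<sigma>) * (\<Prod>i\<in>{0..n}. M i (\<sigma> i)) = of_int (sign \<sigma>) * (\<Prod>i\<in>{0..n}. M' i (\<sigma> i))"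
    using assms by (intro arg_cong2[of _ _ _ _ "(*)"] prod.cong) auto
qed simp

lemma nat_det_eq_det: "nat_det n M = det (mat (Suc n) (Suc n) (\<lambda>(i, j). M i j))"
proof -
  have "det (mat (Suc n) (Suc n) (\<lambda>(i, j). M i j)) = (\<Sum>\<sigma> | \<sigma> permutes {0..<Suc n}. of_int (sign \<sigma>) *
      (\<Prod>i = 0..<Suc n. mat (Suc n) (Suc n) (\<lambda>(i, j). M i j) $$ (i, \<sigma> i)))"
    by (rule det_def') auto
  also have "\<dots> = nat_det n M" unfolding nat_det_def atLeastLessThanSuc_atLeastAtMost
  proof (rule sum.cong)
    fix \<sigma> assume "\<sigma> \<in> {\<sigma>. \<sigma> permutes {0..n}}"
    then have "\<sigma> i \<le> n" if "i \<le> n" for i using permutes_in_image[of \<sigma> "{0..n}" i] that by auto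
    then show "of_int (sign \<sigma>) * (\<Prod>i\<in>{0..n}. mat (Suc n) (Suc n) (\<lambda>(i, j). M i j) $$ (i, \<sigma> i)) =
        of_int (sign \<sigma>) * (\<Prod>i\<in>{0..n}. M i (\<sigma> i))"
      by (intro arg_cong2[of _ _ _ _ "(*)"] prod.cong) (auto simp: le_imp_less_Suc)
  qed simp
  finally show ?thesis ..
qed

lemma nat_det_mult:
  "nat_det n (\<lambda>i j. \<Sum>k\<le>n. A i k * B k j) = nat_det n A * nat_det n B"
proof -
  let ?M = "\<lambda>A. mat (Suc n) (Suc n) (\<lambda>(i, j). A i j)"
  have "?M A * ?M B = ?M (\<lambda>i j. \<Sum>k\<le>n. A i k * B k j)"
    by (rule eq_matI) (auto simp: scalar_prod_def atLeast0LessThan lessThan_Suc_atMost)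
  then show ?thesis unfolding nat_det_eq_det by (simp flip: det_mult[of _ "Suc n"])
qed

lemma nat_det_scale_rows:
  "nat_det n (\<lambda>i j. e i * M i j) = (\<Prod>i\<le>n. e i) * nat_det n M"
  by (simp add: nat_det_def prod.distrib sum_distrib_left atLeast0AtMost mult_ac)

text \<open>The bound is by columns because in the application a column belongs to a function and a
  row to an evaluation point, and only the functions have different growth.\<close>

lemma norm_nat_det_le:
  assumes "\<And>i j. i \<le> n \<Longrightarrow> j \<le> n \<Longrightarrow> cmod (M i j) \<le> b j" "\<And>j. j \<le> n \<Longrightarrow> 0 \<le> b j"
  shows "cmod (nat_det n M) \<le> fact (Suc n) * (\<Prod>j\<le>n. b j)"
proof -
  have "cmod (nat_det n M) \<le> (\<Sum>\<sigma> | \<sigma> permutes {0..n}. \<Prod>j\<le>n. b j)"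
    unfolding nat_det_def
  proof (rule sum_norm_le)
    fix \<sigma> assume "\<sigma> \<in> {\<sigma>. \<sigma> permutes {0..n}}"
    then have \<sigma>: "\<sigma> permutes {0..n}" by simp
    have "cmod (of_int (sign \<sigma>) * (\<Prod>i\<in>{0..n}. M i (\<sigma> i))) = (\<Prod>i\<in>{0..n}. cmod (M i (\<sigma> i)))"
      by (simp add: norm_mult sign_def prod_norm)
    also have "\<dots> \<le> (\<Prod>i\<in>{0..n}. b (\<sigma> i))"
      by (intro prod_mono conjI assms) (use permutes_in_image[OF \<sigma>] in auto)
    also have "\<dots> = (\<Prod>j\<in>{0..n}. b j)" using prod.permute[OF \<sigma>, of b] by (simp add: o_def)
    finally show "cmod (of_int (sign \<sigma>) * (\<Prod>i\<in>{0..n}. M i (\<sigma> i))) \<le> (\<Prod>j\<le>n. b j)"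
      by (simp add: atLeast0AtMost)
  qed
  also have "\<dots> = fact (Suc n) * (\<Prod>j\<le>n. b j)"
    by (simp add: card_permutations[of _ "Suc n"] del: fact_Suc)
  finally show ?thesis .
qed


section \<open>Completing independent forms to a basis\<close>

lemma forms_indep_subset:
  assumes "forms_indep n a K" "K' \<subseteq> K" "finite K"
  shows "forms_indep n a K'"
  unfolding forms_indep_def
proof (intro allI impI ballI)
  fix c :: "nat \<Rightarrow> complex" and j assume c: "\<forall>k\<le>n. (\<Sum>j\<in>K'. c j * a j k) = 0" and j: "j \<in> K'"
  define c' where "c' j = (if j \<in> K' then c j else 0)" for j
  have "(\<Sum>j\<in>K. c' j * a j k) = (\<Sum>j\<in>K'. c j * a j k)" for k
    by (rule sum.mono_neutral_cong_right) (use assms in \<open>auto simp: c'_def\<close>)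
  then have "\<forall>j\<in>K. c' j = 0" using c assms(1) by (auto simp: forms_indep_def)
  then have "c' j = 0" using j assms(2) by blast
  then show "c j = 0" using j by (simp add: c'_def)
qed

text \<open>Steinitz exchange: the independent rows \<open>a j\<close> replace unit rows of the identity matrix, and the
  result \<open>G\<close> keeps a left inverse \<open>D\<close>.\<close>
lemma forms_indep_extend:
  assumes "finite K" "forms_indep n a K"
  shows "\<exists>\<pi> G D. inj_on \<pi> K \<and> \<pi> ` K \<subseteq> {..n} \<and> (\<forall>j\<in>K. \<forall>k\<le>n. G (\<pi> j) k = a j k) \<and>
     (\<forall>i\<in>{..n} - \<pi> ` K. \<forall>k\<le>n. G i k = (if i = k then 1 else 0)) \<and>
     (\<forall>m\<le>n. \<forall>k\<le>n. (\<Sum>i\<le>n. D m i * G i k) = (if m = k then 1 else (0::complex)))"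
  using assms
proof (induction K rule: finite_induct)
  case empty
  have "(\<Sum>i\<le>n. (if m = i then 1 else 0) * (if i = k then 1 else 0)) = (if m = k then 1 else (0::complex))"
    if "m \<le> n" "k \<le> n" for m k
    using that by (subst sum.remove[of _ m]) (auto intro!: sum.neutral)
  then show ?case
    by (intro exI[of _ id] exI[of _ "\<lambda>i k. if i = k then 1 else 0"]) auto
next
  case (insert j0 K)
  have "forms_indep n a K" using forms_indep_subset[OF insert.prems] insert.hyps by auto
  then obtain \<pi> G D where IH': "inj_on \<pi> K" "\<pi> ` K \<subseteq> {..n}" "\<forall>j\<in>K. \<forall>k\<le>n. G (\<pi> j) k = a j k"
     "\<forall>i\<in>{..n} - \<pi> ` K. \<forall>k\<le>n. G i k = (if i = k then 1 else 0)"
     "\<forall>m\<le>n. \<forall>k\<le>n. (\<Sum>i\<le>n. D m i * G i k) = (if m = k then 1 else (0::complex))"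
    using insert.IH by blast
  then have IH: "inj_on \<pi> K" "\<pi> ` K \<subseteq> {..n}" "\<And>j k. j \<in> K \<Longrightarrow> k \<le> n \<Longrightarrow> G (\<pi> j) k = a j k"
     "\<And>i k. i \<le> n \<Longrightarrow> i \<notin> \<pi> ` K \<Longrightarrow> k \<le> n \<Longrightarrow> G i k = (if i = k then 1 else 0)"
     "\<And>m k. m \<le> n \<Longrightarrow> k \<le> n \<Longrightarrow> (\<Sum>i\<le>n. D m i * G i k) = (if m = k then 1 else (0::complex))"
    by simp_all
  \<comment> \<open>The coordinates of the new row with respect to the rows of
    \<open>G\<close>.\<close>
  define c where "c i = (\<Sum>m\<le>n. a j0 m * D m i)" for i
  have span: "(\<Sum>i\<le>n. c i * G i k) = a j0 k" if k: "k \<le> n" for k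
  proof -
    have "(\<Sum>i\<le>n. c i * G i k) = (\<Sum>i\<le>n. \<Sum>m\<le>n. a j0 m * (D m i * G i k))"
      by (simp add: c_def sum_distrib_right mult.assoc)
    also have "\<dots> = (\<Sum>m\<le>n. a j0 m * (\<Sum>i\<le>n. D m i * G i k))"
      by (subst sum.swap) (simp add: sum_distrib_left)
    also have "\<dots> = (\<Sum>m\<le>n. if m = k then a j0 m else 0)"
      by (rule sum.cong) (use k IH(5) in auto)
    finally show ?thesis using k by simp
  qed
  \<comment> \<open>Otherwise the new row would be a combination of the rows already exchanged,
    against independence.\<close>
  have "\<exists>i0\<le>n. i0 \<notin> \<pi> ` K \<and> c i0 \<noteq> 0"
  proof (rule ccontr)
    assume "\<not> ?thesis"
    then have z: "c i = 0" if "i \<le> n" "i \<notin> \<pi> ` K" for i using that by blast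
    define c' where "c' j = (if j = j0 then - 1 else c (\<pi> j))" for j
    have "(\<Sum>j\<in>insert j0 K. c' j * a j k) = 0" if k: "k \<le> n" for k
    proof -
      have "a j0 k = (\<Sum>i\<in>\<pi> ` K. c i * G i k)" unfolding span[OF k, symmetric]
        by (rule sum.mono_neutral_right) (use z IH(2) in auto)
      also have "\<dots> = (\<Sum>j\<in>K. c (\<pi> j) * G (\<pi> j) k)" by (subst sum.reindex[OF IH(1)]) simp
      also have "\<dots> = (\<Sum>j\<in>K. c' j * a j k)"
        by (rule sum.cong) (use insert.hyps k IH(3) in \<open>auto simp: c'_def\<close>)
      finally show ?thesis using insert.hyps by (simp add: c'_def)
    qed
    then have "c' j0 = 0" using insert.prems unfolding forms_indep_def by blast
    then show False by (simp add: c'_def)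
  qed
  then obtain i0 where i0: "i0 \<le> n" "i0 \<notin> \<pi> ` K" "c i0 \<noteq> 0" by blast
  define \<pi>' where "\<pi>' = \<pi>(j0 := i0)"
  define G' where "G' = G(i0 := a j0)"
  \<comment> \<open>Solving the expansion of \<open>a j0\<close> for the old row \<open>G i0\<close>
    and substituting; the division is by the nonzero coordinate \<open>c i0\<close>.\<close>
  define D' where "D' m i = (if i = i0 then D m i0 / c i0 else D m i - D m i0 * c i / c i0)" for m i
  have im: "\<pi>' ` insert j0 K = insert i0 (\<pi> ` K)" using insert.hyps by (auto simp: \<pi>'_def)
  have "inj_on \<pi>' (insert j0 K)"
    using IH(1) i0(2) insert.hyps by (auto simp: \<pi>'_def inj_on_def)
  moreover have "\<pi>' ` insert j0 K \<subseteq> {..n}" unfolding im using IH(2) i0 by auto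
  moreover have "\<forall>j\<in>insert j0 K. \<forall>k\<le>n. G' (\<pi>' j) k = a j k"
    using IH(3) i0(2) insert.hyps by (auto simp: G'_def \<pi>'_def)
  moreover have "\<forall>i\<in>{..n} - \<pi>' ` insert j0 K. \<forall>k\<le>n. G' i k = (if i = k then 1 else 0)"
    unfolding im using IH(4) by (auto simp: G'_def)
  moreover have "(\<Sum>i\<le>n. D' m i * G' i k) = (if m = k then 1 else 0)" if mk: "m \<le> n" "k \<le> n" for m k
  proof -
    let ?S = "\<Sum>i\<in>{..n} - {i0}. c i * G i k"
    have a: "a j0 k = c i0 * G i0 k + ?S"
      unfolding span[OF mk(2), symmetric] using i0(1) by (subst sum.remove[of _ i0]) auto
    have "(\<Sum>i\<le>n. D' m i * G' i k) = D' m i0 * G' i0 k + (\<Sum>i\<in>{..n} - {i0}. D' m i * G' i k)"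
      using i0(1) by (subst sum.remove[of _ i0]) auto
    also have "(\<Sum>i\<in>{..n} - {i0}. D' m i * G' i k) = (\<Sum>i\<in>{..n} - {i0}. D m i * G i k - D m i0 / c i0 * (c i * G i k))"
      by (rule sum.cong) (auto simp: D'_def G'_def algebra_simps)
    also have "\<dots> = (\<Sum>i\<in>{..n} - {i0}. D m i * G i k) - D m i0 / c i0 * ?S"
      by (simp add: sum_subtractf sum_distrib_left)
    also have "D' m i0 * G' i0 k = D m i0 * G i0 k + D m i0 / c i0 * ?S"
      using i0(3) by (simp add: D'_def G'_def a distrib_left)
    finally have "(\<Sum>i\<le>n. D' m i * G' i k) = D m i0 * G i0 k + (\<Sum>i\<in>{..n} - {i0}. D m i * G i k)" by simp
    also have "\<dots> = (\<Sum>i\<le>n. D m i * G i k)" using i0(1) by (subst sum.remove[of _ i0]) auto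
    finally show ?thesis using IH(5)[OF mk] by simp
  qed
  ultimately show ?case
    by (intro exI[of _ \<pi>'] exI[of _ G'] exI[of _ D'] conjI allI impI) (assumption | simp only:)+
qed

section \<open>Upper bounds for the Wronskian\<close>

text \<open>One of \<open>aw_z x\<close> and its inverse has modulus at least 1. The other then has
  modulus at most 1, so \<open>2 * cmod x\<close> and \<open>cmod z\<close> differ from what the
  dominant term gives by at most 1.\<close>

lemma joukowski_preimage:
  obtains z where "joukowski z = x" "1 \<le> cmod z" "cmod x \<le> cmod z" "cmod z \<le> 2 * cmod x + 1"
proof -
  have "\<exists>z. joukowski z = x \<and> 1 \<le> cmod z"
  proof (cases "1 \<le> cmod (aw_z x)")
    case False
    have "0 < cmod (aw_z x)" using aw_z_nonzero by simp
    then have "1 \<le> cmod (inverse (aw_z x))" using False by (simp add: norm_inverse one_le_inverse_iff)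
    moreover have "joukowski (inverse (aw_z x)) = x"
      using joukowski_aw_z[of x] by (simp add: joukowski_def add.commute)
    ultimately show ?thesis by blast
  qed (use joukowski_aw_z in blast)
  then obtain z where z: "joukowski z = x" "1 \<le> cmod z" by blast
  have i: "cmod (inverse z) \<le> 1" using z(2) by (simp add: norm_inverse inverse_le_1_iff)
  have "2 * x = z + inverse z" using z(1) by (simp add: joukowski_def flip: z(1))
  then have "2 * cmod x = cmod (z + inverse z)" by (metis norm_mult norm_numeral)
  then have "2 * cmod x \<le> cmod z + 1" "cmod z \<le> 2 * cmod x + 1"
    using norm_triangle_ineq[of z "inverse z"] norm_triangle_ineq4[of "z + inverse z" "inverse z"] i by auto
  then show ?thesis using that[OF z] z(2) by linarith
qed

lemma norm_joukowski_mult_le: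
  assumes "1 \<le> cmod z" "t \<noteq> 0"
  shows "cmod (joukowski (t * z)) \<le> (cmod t + cmod (inverse t)) * cmod z"
proof -
  have "cmod (inverse t) * cmod (inverse z) \<le> cmod (inverse t) * cmod z"
  proof -
    have "cmod (inverse z) \<le> 1" using assms(1) by (simp add: norm_inverse inverse_le_1_iff)
    then show ?thesis using assms(1) by (intro mult_left_mono) auto
  qed
  moreover have "cmod (joukowski (t * z)) = cmod (t * z + inverse t * inverse z) / 2"
    by (simp add: joukowski_def norm_divide)
  moreover have "cmod (t * z + inverse t * inverse z) \<le> cmod t * cmod z + cmod (inverse t) * cmod (inverse z)"
    using norm_triangle_ineq[of "t * z" "inverse t * inverse z"] by (simp only: norm_mult)
  moreover have "0 \<le> cmod t * cmod z" "0 \<le> cmod (inverse t) * cmod z" by simp_all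
  ultimately show ?thesis unfolding distrib_right by linarith
qed

text \<open>The indices \<open>k\<close> and \<open>n - k\<close> have opposite exponents, so
  reversing the order of summation pairs the values into averages. This expresses a sum over points
  depending on \<open>z\<close> by entire functions of \<open>x\<close>.\<close>

lemma sum_shifts_eq_sum_aw_A:
  assumes z: "1 < cmod z" and q: "q \<noteq> 0"
  shows "(\<Sum>k\<le>n. h (joukowski (csqrt q powi (int n - 2 * int k) * z))) =
    (\<Sum>k\<le>n. aw_A q (nat \<bar>int n - 2 * int k\<bar>) h (joukowski z))"
proof -
  define y where "y k = h (joukowski (csqrt q powi (int n - 2 * int k) * z))" for k
  have pair: "aw_A q (nat \<bar>int n - 2 * int k\<bar>) h (joukowski z) = (y k + y (n - k)) / 2" if k: "k \<le> n" for k
  proof -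
    have e: "int n - 2 * int (n - k) = - (int n - 2 * int k)" using k by (simp add: of_nat_diff)
    show ?thesis
    proof (cases "0 \<le> int n - 2 * int k")
      case True
      then show ?thesis unfolding aw_A_joukowski[OF z] y_def e
        by (simp add: power_int_def power_int_minus power_inverse)
    next
      case False
      then show ?thesis unfolding aw_A_joukowski[OF z] y_def e
        by (simp add: power_int_def power_int_minus power_inverse add.commute)
    qed
  qed
  have "(\<Sum>k\<le>n. aw_A q (nat \<bar>int n - 2 * int k\<bar>) h (joukowski z)) = (\<Sum>k\<le>n. (y k + y (n - k)) / 2)"
    by (intro sum.cong refl pair) simp
  also have "\<dots> = ((\<Sum>k\<le>n. y k) + (\<Sum>k\<le>n. y (n - k))) / 2"
    by (simp add: sum.distrib sum_divide_distrib[symmetric])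
  also have "(\<Sum>k\<le>n. y (n - k)) = (\<Sum>k\<le>n. y k)"
    by (rule sum.reindex_bij_witness[of _ "\<lambda>k. n - k" "\<lambda>k. n - k"]) auto
  finally show ?thesis by (simp add: y_def)
qed

text \<open>As all rows share their evaluation points, the matrix is a coefficient matrix times the
  matrix of point values. The factor \<open>\<gamma> z\<close> is the determinant of the
  former.\<close>

lemma aw_wronskian_joukowski:
  assumes q: "0 < cmod q" "cmod q < 1"
  obtains \<gamma> R B where "\<And>z. R \<le> cmod z \<Longrightarrow> cmod (\<gamma> z) \<le> B"
    "\<And>z fs. R \<le> cmod z \<Longrightarrow> aw_wronskian q n fs (joukowski z) =
       \<gamma> z * nat_det n (\<lambda>k j. fs j (joukowski (csqrt q powi (int n - 2 * int k) * z)))"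
proof -
  define P where "P i c R B \<longleftrightarrow> 0 \<le> B \<and> (\<forall>z. R \<le> cmod z \<longrightarrow> (\<forall>k\<le>n. cmod (c k z) \<le> B) \<and>
     (\<forall>f. aw_A q (n - i) (aw_D_pow q i f) (joukowski z) =
        (\<Sum>k\<le>n. c k z * f (joukowski (csqrt q powi (int n - 2 * int k) * z)))))" for i c R and B :: real
  have "\<forall>i\<in>{..n}. \<exists>c R B. P i c R B"
    unfolding P_def using aw_row_joukowski[OF q] by blast
  then obtain c where "\<forall>i\<in>{..n}. \<exists>R B. P i (c i) R B" using bchoice by metis
  then obtain R where "\<forall>i\<in>{..n}. \<exists>B. P i (c i) (R i) B" using bchoice by metis
  then obtain B where cP: "\<forall>i\<in>{..n}. P i (c i) (R i) (B i)" using bchoice by metis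
  have c: "0 \<le> B i" "\<And>z k. R i \<le> cmod z \<Longrightarrow> k \<le> n \<Longrightarrow> cmod (c i k z) \<le> B i"
    "\<And>z f. R i \<le> cmod z \<Longrightarrow> aw_A q (n - i) (aw_D_pow q i f) (joukowski z) =
        (\<Sum>k\<le>n. c i k z * f (joukowski (csqrt q powi (int n - 2 * int k) * z)))"
    if i: "i \<le> n" for i
  proof -
    have "P i (c i) (R i) (B i)" using cP i by simp
    note p = this[unfolded P_def]
    note p2 = conjunct2[OF p, THEN spec, THEN mp]
    show "0 \<le> B i" by (rule conjunct1[OF p])
    show "cmod (c i k z) \<le> B i" if "R i \<le> cmod z" "k \<le> n" for z k
      by (rule conjunct1[OF p2[OF that(1)], THEN spec, THEN mp, OF that(2)])
    show "aw_A q (n - i) (aw_D_pow q i f) (joukowski z) =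
        (\<Sum>k\<le>n. c i k z * f (joukowski (csqrt q powi (int n - 2 * int k) * z)))" if "R i \<le> cmod z" for z f
      by (rule conjunct2[OF p2[OF that], THEN spec])
  qed
  define R' where "R' = Max (R ` {..n})"
  have R': "R i \<le> R'" if "i \<le> n" for i using that by (simp add: R'_def)
  define B' where "B' = (\<Sum>i\<le>n. B i)"
  have B': "B i \<le> B'" if "i \<le> n" for i unfolding B'_def by (rule member_le_sum) (use that c in auto)
  define \<gamma> where "\<gamma> z = nat_det n (\<lambda>i k. c i k z)" for z
  show ?thesis
  proof (rule that[of R' \<gamma> "fact (Suc n) * (\<Prod>j\<le>n. B')"])
    fix z assume z: "R' \<le> cmod z"
    show "cmod (\<gamma> z) \<le> fact (Suc n) * (\<Prod>j\<le>n. B')"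
      unfolding \<gamma>_def
    proof (rule norm_nat_det_le)
      show "cmod (c i j z) \<le> B'" if "i \<le> n" "j \<le> n" for i j
        using c(2)[OF that(1) order_trans[OF R'[OF that(1)] z] that(2)] B'[OF that(1)] by linarith
      show "0 \<le> B'" unfolding B'_def by (rule sum_nonneg) (use c in auto)
    qed
    fix fs
    have "aw_wronskian q n fs (joukowski z) =
       nat_det n (\<lambda>i j. aw_A q (n - i) (aw_D_pow q i (fs j)) (joukowski z))"
      by (simp add: aw_wronskian_def nat_det_def)
    also have "\<dots> = nat_det n (\<lambda>i j. \<Sum>k\<le>n. c i k z * fs j (joukowski (csqrt q powi (int n - 2 * int k) * z)))"
    proof (rule nat_det_cong)
      fix i j assume i: "i \<le> n"
      show "aw_A q (n - i) (aw_D_pow q i (fs j)) (joukowski z) =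
        (\<Sum>k\<le>n. c i k z * fs j (joukowski (csqrt q powi (int n - 2 * int k) * z)))"
        by (rule c(3)[OF i order_trans[OF R'[OF i] z]])
    qed
    also have "\<dots> = \<gamma> z * nat_det n (\<lambda>k j. fs j (joukowski (csqrt q powi (int n - 2 * int k) * z)))"
      unfolding \<gamma>_def by (rule nat_det_mult)
    finally show "aw_wronskian q n fs (joukowski z) =
       \<gamma> z * nat_det n (\<lambda>k j. fs j (joukowski (csqrt q powi (int n - 2 * int k) * z)))" .
  qed
qed

text \<open>The matrix of point values is the product of the diagonal matrix of the
  \<open>exp (h (y k))\<close>, the matrix of the \<open>g m (y k)\<close> and a constant matrix.
  The order of quantifiers matters: \<open>C\<close> and \<open>R\<close> serve all bases
  \<open>g\<close>, only \<open>c\<close> depends on the basis.\<close>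

lemma aw_wronskian_bound:
  assumes q: "0 < cmod q" "cmod q < 1"
  obtains C R where "2 \<le> C"
    "\<And>h fs g D. h holomorphic_on UNIV \<Longrightarrow>
      (\<And>j x. j \<le> n \<Longrightarrow> fs j x = exp (h x) * (\<Sum>m\<le>n. D j m * g m x)) \<Longrightarrow>
      (\<And>m. m \<le> n \<Longrightarrow> g m holomorphic_on UNIV \<and> (\<exists>w. g m w \<noteq> 0)) \<Longrightarrow>
      \<exists>c. \<forall>x. R \<le> cmod x \<longrightarrow> aw_wronskian q n fs x \<noteq> 0 \<longrightarrow>
        ln (cmod (aw_wronskian q n fs x)) \<le> Re (\<Sum>k\<le>n. aw_A q (nat \<bar>int n - 2 * int k\<bar>) h x)
          + (\<Sum>m\<le>n. log_maximum (g m) (C * cmod x)) + c"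
proof -
  define s where "s = csqrt q"
  have s: "s \<noteq> 0" using q by (auto simp: s_def)
  obtain \<gamma> R B where W: "\<And>z. R \<le> cmod z \<Longrightarrow> cmod (\<gamma> z) \<le> B"
    "\<And>z fs. R \<le> cmod z \<Longrightarrow> aw_wronskian q n fs (joukowski z) =
       \<gamma> z * nat_det n (\<lambda>k j. fs j (joukowski (s powi (int n - 2 * int k) * z)))"
    unfolding s_def by (rule aw_wronskian_joukowski[OF q, of n]) blast
  define T where "T k = cmod (s powi (int n - 2 * int k)) + cmod (inverse (s powi (int n - 2 * int k)))" for k
  have T0: "0 \<le> T k" for k by (simp add: T_def)
  \<comment> \<open>The 3 comes from \<open>cmod z \<le> 2 * cmod x + 1 \<le> 3 * cmod x\<close>.
    The 2 gives \<open>r / C \<le> r / 2\<close>, so that one regularity estimate also covers the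
    half radius of the Harnack comparison.\<close>
  define C where "C = 2 + 3 * (\<Sum>k\<le>n. T k)"
  have TC: "3 * T k \<le> C" if "k \<le> n" for k
    using member_le_sum[of k "{..n}" T] that T0 by (auto simp: C_def)
  show ?thesis
  proof (rule that[of C "max 2 R"])
    show "2 \<le> C" using T0 by (simp add: C_def sum_nonneg)
    fix h fs g D
    assume fs: "\<And>j x. j \<le> n \<Longrightarrow> fs j x = exp (h x) * (\<Sum>m\<le>n. D j m * g m x)"
      and g: "\<And>m. m \<le> n \<Longrightarrow> g m holomorphic_on UNIV \<and> (\<exists>w. g m w \<noteq> 0)"
    define d where "d = cmod (nat_det n (\<lambda>m j. D j m))"
    define M where "M = B * fact (Suc n) * d"
    have "ln (cmod (aw_wronskian q n fs x)) \<le> Re (\<Sum>k\<le>n. aw_A q (nat \<bar>int n - 2 * int k\<bar>) h x)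
          + (\<Sum>m\<le>n. log_maximum (g m) (C * cmod x)) + ln M"
      if x: "max 2 R \<le> cmod x" and nz: "aw_wronskian q n fs x \<noteq> 0" for x
    proof -
      obtain z where z: "joukowski z = x" "1 \<le> cmod z" "cmod x \<le> cmod z" "cmod z \<le> 2 * cmod x + 1"
        using joukowski_preimage by blast
      have z1: "1 < cmod z" "R \<le> cmod z" using x z(3) by auto
      define y where "y k = joukowski (s powi (int n - 2 * int k) * z)" for k
      have yC: "cmod (y k) \<le> C * cmod x" if "k \<le> n" for k
      proof -
        have "cmod (y k) \<le> T k * cmod z" unfolding y_def T_def
          by (rule norm_joukowski_mult_le) (use z s in auto)
        also have "\<dots> \<le> T k * (3 * cmod x)" using z(4) x T0 by (intro mult_left_mono) auto
        also have "\<dots> = 3 * T k * cmod x" by simp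
        also have "\<dots> \<le> C * cmod x" using TC[OF that] by (intro mult_right_mono) auto
        finally show ?thesis .
      qed
      define H where "H = (\<Sum>k\<le>n. h (y k))"
      have H: "H = (\<Sum>k\<le>n. aw_A q (nat \<bar>int n - 2 * int k\<bar>) h x)"
        unfolding H_def y_def s_def using sum_shifts_eq_sum_aw_A[OF z1(1)] s z(1) by (simp add: s_def)
      have "nat_det n (\<lambda>k j. fs j (y k)) = nat_det n (\<lambda>k j. exp (h (y k)) * (\<Sum>m\<le>n. g m (y k) * D j m))"
        by (rule nat_det_cong) (simp add: fs mult.commute)
      also have "\<dots> = exp H * (nat_det n (\<lambda>k m. g m (y k)) * nat_det n (\<lambda>m j. D j m))"
        unfolding nat_det_scale_rows nat_det_mult by (simp add: H_def exp_sum)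
      finally have "cmod (aw_wronskian q n fs x) = cmod (\<gamma> z) * (exp (Re H) * (cmod (nat_det n (\<lambda>k m. g m (y k))) * d))"
        using W(2)[OF z1(2), of fs] by (simp add: z(1) y_def norm_mult d_def)
      also have "\<dots> \<le> B * (exp (Re H) * ((fact (Suc n) * (\<Prod>m\<le>n. exp (log_maximum (g m) (C * cmod x)))) * d))"
      proof (intro mult_mono mult_left_mono mult_right_mono W z1 norm_nat_det_le)
        show "cmod (g j (y i)) \<le> exp (log_maximum (g j) (C * cmod x))" if "i \<le> n" "j \<le> n" for i j
        proof (rule norm_le_exp_log_maximum)
          show "0 < C * cmod x" using x \<open>2 \<le> C\<close> by (intro mult_pos_pos) linarith+
        qed (use g[OF that(2)] yC[OF that(1)] in auto)
        show "0 \<le> B" using W(1)[OF z1(2)] norm_ge_zero order_trans by blast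
      qed (auto simp: d_def intro!: mult_nonneg_nonneg prod_nonneg)
      also have "\<dots> = exp (Re H + (\<Sum>m\<le>n. log_maximum (g m) (C * cmod x))) * M"
        by (simp add: M_def exp_add exp_sum mult_ac)
      finally have le: "cmod (aw_wronskian q n fs x) \<le> exp (Re H + (\<Sum>m\<le>n. log_maximum (g m) (C * cmod x))) * M" .
      moreover have pos: "0 < cmod (aw_wronskian q n fs x)" using nz by simp
      ultimately have "0 < exp (Re H + (\<Sum>m\<le>n. log_maximum (g m) (C * cmod x))) * M" by linarith
      then have M: "0 < M" by (simp add: zero_less_mult_iff)
      have "ln (cmod (aw_wronskian q n fs x)) \<le> ln (exp (Re H + (\<Sum>m\<le>n. log_maximum (g m) (C * cmod x))) * M)"
        using le pos by (rule ln_mono)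
      also have "\<dots> = Re H + (\<Sum>m\<le>n. log_maximum (g m) (C * cmod x)) + ln M"
        using M by (subst ln_mult_pos) auto
      finally show ?thesis unfolding H .
    qed
    then show "\<exists>c. \<forall>x. max 2 R \<le> cmod x \<longrightarrow> aw_wronskian q n fs x \<noteq> 0 \<longrightarrow>
        ln (cmod (aw_wronskian q n fs x)) \<le> Re (\<Sum>k\<le>n. aw_A q (nat \<bar>int n - 2 * int k\<bar>) h x)
          + (\<Sum>m\<le>n. log_maximum (g m) (C * cmod x)) + c" by blast
  qed
qed


section \<open>Slowly growing systems and the main inequality\<close>

lemma continuous_on_Max_image:
  fixes g :: "'b \<Rightarrow> 'a::topological_space \<Rightarrow> real"
  assumes "finite A" "A \<noteq> {}" "\<And>k. k \<in> A \<Longrightarrow> continuous_on S (g k)"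
  shows "continuous_on S (\<lambda>x. Max ((\<lambda>k. g k x) ` A))"
  using assms
proof (induction A rule: finite_ne_induct)
  case (insert b A)
  then have "continuous_on S (\<lambda>x. max (g b x) (Max ((\<lambda>k. g k x) ` A)))"
    by (intro continuous_intros) auto
  then show ?case using insert by simp
qed simp

lemma vnorm_ge: "k \<le> n \<Longrightarrow> cmod (fs k x) \<le> vnorm n fs x"
  by (simp add: vnorm_def)

lemma vnorm_attained: obtains k where "k \<le> n" "vnorm n fs x = cmod (fs k x)"
proof -
  have "vnorm n fs x \<in> (\<lambda>k. cmod (fs k x)) ` {0..n}"
    unfolding vnorm_def by (rule Max_in) auto
  then show ?thesis using that by auto
qed

lemma vnorm_pos:
  assumes "\<exists>k\<le>n. fs k x \<noteq> 0" shows "0 < vnorm n fs x"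
  using assms vnorm_ge[of _ n fs x] by (meson less_le_trans zero_less_norm_iff)

lemma vnorm_exp_factor:
  assumes "\<And>k. k \<le> n \<Longrightarrow> fs k x = exp (h x) * ft k x"
  shows "vnorm n fs x = exp (Re (h x)) * vnorm n ft x"
proof (rule antisym)
  obtain k where k: "k \<le> n" "vnorm n fs x = cmod (fs k x)" using vnorm_attained .
  then show "vnorm n fs x \<le> exp (Re (h x)) * vnorm n ft x"
    using assms[OF k(1)] vnorm_ge[OF k(1), of ft x] by (simp add: norm_mult)
  obtain k where k: "k \<le> n" "vnorm n ft x = cmod (ft k x)" using vnorm_attained .
  then show "exp (Re (h x)) * vnorm n ft x \<le> vnorm n fs x"
    using assms[OF k(1)] vnorm_ge[OF k(1), of fs x] by (simp add: norm_mult)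
qed

lemma continuous_on_log_vnorm:
  assumes "\<And>k. k \<le> n \<Longrightarrow> fs k holomorphic_on UNIV" "\<And>x. \<exists>k\<le>n. fs k x \<noteq> 0"
  shows "continuous_on S (\<lambda>x. ln (vnorm n fs x))"
proof -
  have "continuous_on S (\<lambda>x. vnorm n fs x)" unfolding vnorm_def
    by (intro continuous_on_Max_image continuous_intros)
       (use assms(1) in \<open>auto intro: continuous_on_subset[OF holomorphic_on_imp_continuous_on]\<close>)
  then show ?thesis using vnorm_pos[OF assms(2)] by (intro continuous_intros) (auto simp: less_imp_neq[symmetric])
qed

lemma char_T_eq_circle_mean: "char_T n fs r = circle_mean (\<lambda>x. ln (vnorm n fs x)) r"
  by (simp add: char_T_def circle_mean_def)

lemma circle_mean_Re_entire:
  assumes "h holomorphic_on UNIV" "0 < r"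
  shows "circle_mean (\<lambda>x. Re (h x)) r = Re (h 0)"
  using poisson_formula[of h "r + 1" r 0] assms holomorphic_on_subset[OF assms(1)]
  by (simp add: poisson_mean_0)

lemma char_T_ge_mean_log:
  assumes "\<And>k. k \<le> n \<Longrightarrow> fs k holomorphic_on UNIV" "\<And>x. \<exists>k\<le>n. fs k x \<noteq> 0" "k \<le> n"
    "\<And>x. cmod x = r \<Longrightarrow> fs k x \<noteq> 0" "0 \<le> r"
  shows "circle_mean (\<lambda>x. ln (cmod (fs k x))) r \<le> char_T n fs r"
  unfolding char_T_eq_circle_mean
proof (rule circle_mean_mono)
  show "continuous_on (sphere 0 r) (\<lambda>x. ln (cmod (fs k x)))"
    by (rule continuous_on_log_norm) (use assms in auto)
  show "continuous_on (sphere 0 r) (\<lambda>x. ln (vnorm n fs x))"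
    by (rule continuous_on_log_vnorm) (use assms in auto)
  show "ln (cmod (fs k x)) \<le> ln (vnorm n fs x)" if "cmod x = r" for x
    using assms(4)[OF that] vnorm_ge[OF assms(3), of fs x] by (intro ln_mono) auto
qed (use assms in auto)

lemma char_T_exp_factor:
  assumes hol: "\<And>k. k \<le> n \<Longrightarrow> ft k holomorphic_on UNIV" and nz: "\<And>x. \<exists>k\<le>n. ft k x \<noteq> 0"
    and h: "h holomorphic_on UNIV" and eq: "\<And>k x. k \<le> n \<Longrightarrow> fs k x = exp (h x) * ft k x" and r: "0 < r"
  shows "char_T n fs r = char_T n ft r + Re (h 0)"
proof -
  have "ln (vnorm n fs x) = ln (vnorm n ft x) + Re (h x)" for x
  proof -
    have "vnorm n fs x = exp (Re (h x)) * vnorm n ft x" by (rule vnorm_exp_factor) (rule eq)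
    moreover have "0 < vnorm n ft x" by (rule vnorm_pos[OF nz])
    ultimately show ?thesis by (simp add: ln_mult_pos)
  qed
  then have "char_T n fs r = circle_mean (\<lambda>x. ln (vnorm n ft x) + Re (h x)) r"
    by (simp add: char_T_eq_circle_mean)
  also have "\<dots> = char_T n ft r + Re (h 0)"
    unfolding char_T_eq_circle_mean circle_mean_Re_entire[OF h r, symmetric]
    by (intro circle_mean_add continuous_on_log_vnorm hol nz continuous_intros
        continuous_on_subset[OF holomorphic_on_imp_continuous_on[OF h]]) (use r in auto)
  finally show ?thesis .
qed

text \<open>A small \<open>r\<close> is pushed beyond \<open>R\<close> by the factor
  \<open>max 1 R\<close>, at the cost of a scaling.\<close>

lemma log_slow_eventually:
  assumes "\<And>r s. 1 \<le> r \<Longrightarrow> r \<le> s \<Longrightarrow> \<phi> r \<le> \<phi> s" "\<And>r. R \<le> r \<Longrightarrow> \<phi> r \<le> \<psi> r" "log_slow \<rho> \<psi>" "0 \<le> \<rho>"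
  shows "log_slow \<rho> \<phi>"
proof (rule log_slow_mono[OF log_slow_scale[OF assms(3), of "max 1 R"]])
  fix r :: real assume r: "1 \<le> r"
  have 1: "r \<le> max 1 R * r" using mult_right_mono[of 1 "max 1 R" r] r by simp
  have "R \<le> max 1 R * r" using mult_left_mono[of 1 r "max 1 R"] r by linarith
  then show "\<phi> r \<le> \<psi> (max 1 R * r)" using assms(1)[OF r 1] assms(2) order_trans by blast
qed (use assms in auto)

lemma growth_order_bound:
  assumes "Limsup at_top (\<lambda>r. ereal (log_plus (log_plus (T r)) / ln (ln r))) < 1"
  obtains \<rho> R where "0 < \<rho>" "\<rho> < 1" "1 \<le> R" "\<And>r. R \<le> r \<Longrightarrow> T r \<le> exp ((ln r) powr \<rho>)"
proof -
  obtain y where y: "Limsup at_top (\<lambda>r. ereal (log_plus (log_plus (T r)) / ln (ln r))) < ereal y" "ereal y < 1"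
    using ereal_dense2[OF assms] by blast
  \<comment> \<open>The limit superior may be at most 0, so \<open>y\<close> need not be
    positive.\<close>
  define \<rho> where "\<rho> = max y (1/2)"
  have \<rho>: "0 < \<rho>" "\<rho> < 1" using y(2) by (auto simp: \<rho>_def)
  have "\<forall>\<^sub>F r in at_top. ereal (log_plus (log_plus (T r)) / ln (ln r)) < ereal y"
    by (rule Limsup_lessD[OF y(1)])
  then obtain R where R: "\<And>r. R \<le> r \<Longrightarrow> log_plus (log_plus (T r)) / ln (ln r) < y"
    by (auto simp: eventually_at_top_linorder)
  \<comment> \<open>\<open>exp (exp 1)\<close> makes \<open>ln (ln r)\<close> at least 1, so the
    quotient in the hypothesis can be cleared.\<close>
  have "T r \<le> exp ((ln r) powr \<rho>)" if r: "max R (exp (exp 1)) \<le> r" for r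
  proof -
    have r2: "R \<le> r" "exp (exp 1) \<le> r" using r by auto
    have rp: "0 < r" using r2(2) less_le_trans[OF exp_gt_zero] by blast
    have e: "exp 1 \<le> ln r" using r2(2) rp by (simp add: ln_ge_iff)
    then have lp: "0 < ln r" using less_le_trans[OF exp_gt_zero] by blast
    then have ll: "1 \<le> ln (ln r)" using e lp by (simp add: ln_ge_iff)
    have "log_plus (log_plus (T r)) < y * ln (ln r)" using R[OF r2(1)] ll by (simp add: divide_less_eq)
    also have "\<dots> \<le> \<rho> * ln (ln r)" using ll by (intro mult_right_mono) (auto simp: \<rho>_def)
    finally have u: "log_plus (log_plus (T r)) \<le> \<rho> * ln (ln r)" by simp
    have "log_plus (T r) \<le> exp (log_plus (log_plus (T r)))"
    proof (cases "0 < log_plus (T r)")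
      case True
      have "log_plus (T r) = exp (ln (log_plus (T r)))" using True by simp
      also have "\<dots> \<le> exp (log_plus (log_plus (T r)))" by (simp add: log_plus_def)
      finally show ?thesis .
    qed (use exp_gt_zero[of "log_plus (log_plus (T r))"] in linarith)
    also have "\<dots> \<le> exp (\<rho> * ln (ln r))" using u by simp
    also have "\<dots> = (ln r) powr \<rho>" using lp by (simp add: powr_def)
    finally have v: "log_plus (T r) \<le> (ln r) powr \<rho>" .
    show ?thesis
    proof (cases "0 < T r")
      case True
      then have "T r = exp (ln (T r))" by simp
      also have "\<dots> \<le> exp (log_plus (T r))" by (simp add: log_plus_def)
      finally show ?thesis using v by (meson exp_le_cancel_iff order_trans)
    qed (use exp_gt_zero[of "(ln r) powr \<rho>"] in linarith)
  qed
  moreover have "1 \<le> max R (exp (exp 1))" using one_le_exp_iff[of "exp 1"] by (simp add: le_max_iff_disj)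
  ultimately show ?thesis using that[OF \<rho>] by blast
qed

text \<open>The factor \<open>exp h\<close> is chosen so that one component of \<open>ft\<close> is slow. The others are slow as well,
  because the mean of \<open>ln \<parallel>ft\<parallel>\<close> is the characteristic and the negative part of \<open>ln \<parallel>ft\<parallel>\<close> is controlled by
  that one component.\<close>
lemma slow_system:
  assumes hol: "\<And>k. k \<le> n \<Longrightarrow> fs k holomorphic_on UNIV" and red: "\<And>x. \<exists>k\<le>n. fs k x \<noteq> 0"
    and nz: "\<And>k. k \<le> n \<Longrightarrow> \<exists>w. fs k w \<noteq> 0"
    and \<rho>: "0 < \<rho>" "\<rho> < 1" and R1: "1 \<le> R1" and T: "\<And>r. R1 \<le> r \<Longrightarrow> char_T n fs r \<le> exp ((ln r) powr \<rho>)"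
  obtains h ft where "h holomorphic_on UNIV" "\<And>k. k \<le> n \<Longrightarrow> ft k holomorphic_on UNIV"
    "\<And>k x. fs k x = exp (h x) * ft k x" "\<And>k. k \<le> n \<Longrightarrow> log_slow \<rho> (log_maximum (ft k))"
proof -
  define \<tau> where "\<tau> r = exp ((1 + ln r) powr \<rho>)" for r
  have \<tau>slow: "log_slow \<rho> \<tau>" by (rule log_slowI[of 1]) (auto simp: \<tau>_def)
  have T\<tau>: "char_T n fs R \<le> \<tau> (4 * r)" if "R1 \<le> R" "R \<le> 4 * r" for r R
  proof -
    have "ln R \<le> ln (4 * r)" "0 \<le> ln R" using that R1 by (auto intro: ln_mono)
    then have "(ln R) powr \<rho> \<le> (1 + ln (4 * r)) powr \<rho>" using \<rho> by (intro powr_mono2) auto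
    then show ?thesis using T[OF that(1)] unfolding \<tau>_def by (meson exp_le_cancel_iff order_trans)
  qed
  \<comment> \<open>A component that does not vanish at 0 exists by reducedness; Jensen's formula at
    0 needs it.\<close>
  obtain k0 where k0: "k0 \<le> n" "fs k0 0 \<noteq> 0" using red by blast
  define f where "f = fs k0"
  have f: "f holomorphic_on UNIV" "f 0 \<noteq> 0" "\<exists>w. f w \<noteq> 0" using hol k0 by (auto simp: f_def)
  have "log_slow \<rho> (zero_count f)"
  proof (rule log_slow_eventually[where R = R1])
    show "zero_count f r \<le> zero_count f s" if "r \<le> s" for r s
      using zero_count_mono[OF f(1,3) that] .
    fix r assume r: "R1 \<le> r"
    have r1: "0 < 2 * r" using r R1 by simp
    obtain R where R: "2 * r < R" "R < 2 * (2 * r)" "R \<notin> {R. \<exists>z. cmod z = R \<and> f z = 0}"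
      using avoid_countable_radius[OF countable_zero_radii[OF f(1,3)] r1] by blast
    have nzR: "f x \<noteq> 0" if "cmod x = R" for x using R(3) that by auto
    let ?m = "\<lambda>a. real (nat (zorder f a))"
    \<comment> \<open>\<open>R\<close> exceeds \<open>2 * r\<close>, so each zero of modulus at most
      \<open>r\<close> has weight at least \<open>ln 2\<close> in Jensen's formula.\<close>
    have "zero_count f r * ln 2 = (\<Sum>a | cmod a \<le> r \<and> f a = 0. ?m a * ln 2)"
      by (simp add: zero_count_def sum_distrib_right)
    also have "\<dots> \<le> (\<Sum>a | cmod a \<le> r \<and> f a = 0. ?m a * (ln R - ln (cmod a)))"
    proof (intro sum_mono mult_left_mono)
      fix a assume a: "a \<in> {a. cmod a \<le> r \<and> f a = 0}"
      then have a0: "0 < cmod a" using f(2) by auto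
      have "ln (2 * cmod a) \<le> ln R" using a a0 R(1) by (intro ln_mono) auto
      then show "ln 2 \<le> ln R - ln (cmod a)" using a0 by (simp add: ln_mult)
    qed auto
    also have "\<dots> \<le> (\<Sum>a | cmod a \<le> R \<and> f a = 0. ?m a * (ln R - ln (cmod a)))"
    proof (rule sum_mono2)
      show "0 \<le> ?m a * (ln R - ln (cmod a))" if "a \<in> {a. cmod a \<le> R \<and> f a = 0} - {a. cmod a \<le> r \<and> f a = 0}" for a
        using that f(2) R r1 by (intro mult_nonneg_nonneg) (auto intro!: ln_mono)
    qed (use R r1 entire_finite_zeros[OF f(1,3)] in auto)
    also have "\<dots> = circle_mean (\<lambda>w. ln (cmod (f w))) R - ln (cmod (f 0))"
      by (rule jensen_zeros) (use f nzR R r1 in auto)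
    also have "\<dots> \<le> \<tau> (4 * r) + \<bar>ln (cmod (f 0))\<bar>"
      using char_T_ge_mean_log[OF hol red k0(1), of R] nzR T\<tau>[of R r] R r r1 by (auto simp: f_def)
    finally show "zero_count f r \<le> 1 / ln 2 * (\<tau> (4 * r) + \<bar>ln (cmod (f 0))\<bar>)"
      by (simp add: field_simps)
  next
    show "log_slow \<rho> (\<lambda>r. 1 / ln 2 * (\<tau> (4 * r) + \<bar>ln (cmod (f 0))\<bar>))"
      using \<rho> by (intro log_slow_mult log_slow_add log_slow_const log_slow_scale[OF \<tau>slow]) (auto simp: \<tau>_def)
  qed (use \<rho> in auto)
  then obtain G \<beta> where G: "G holomorphic_on UNIV" "\<And>x. G x \<noteq> 0" "G 0 = f 0" "log_slow \<rho> \<beta>"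
    "\<And>x r. cmod x \<le> r \<Longrightarrow> 1 \<le> r \<Longrightarrow> cmod (f x) \<le> exp (\<beta> r) * cmod (G x)"
    using slow_zeros_factor[OF f(1,2) _ \<rho>] by blast
  have "contractible (UNIV :: complex set)" by (simp add: convex_imp_contractible)
  then obtain h where h: "h holomorphic_on UNIV" "\<And>z. G z = exp (h z)"
    using contractible_imp_holomorphic_log[OF G(1)] G(2) by auto
  \<comment> \<open>The zero-free part \<open>G = exp h\<close> of \<open>f = fs k0\<close> is
    divided out of all components at once, and \<open>ft k0\<close> becomes 1 at 0.\<close>
  define ft where "ft k x = exp (- h x) * fs k x" for k x
  have fteq: "fs k x = exp (h x) * ft k x" for k x
    by (simp add: ft_def mult.assoc[symmetric] exp_add[symmetric])
  have fthol: "ft k holomorphic_on UNIV" if "k \<le> n" for k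
  proof -
    have "(\<lambda>x. exp (- h x) * fs k x) holomorphic_on UNIV" by (intro holomorphic_intros h hol that)
    then show ?thesis by (simp add: ft_def[abs_def])
  qed
  have ftnz: "\<exists>w. ft k w \<noteq> 0" if "k \<le> n" for k using nz[OF that] by (auto simp: ft_def)
  have ftred: "\<exists>k\<le>n. ft k x \<noteq> 0" for x using red[of x] by (auto simp: ft_def)
  have ft0: "ft k0 0 = 1" using G(3) h(2)[of 0] fteq[of k0 0] by (simp add: f_def)
  have ftk0: "ln (cmod (ft k0 x)) \<le> \<beta> r" if "cmod x \<le> r" "1 \<le> r" "ft k0 x \<noteq> 0" for x r
  proof -
    have "cmod (exp (h x)) * cmod (ft k0 x) \<le> cmod (exp (h x)) * exp (\<beta> r)"
      using G(5)[OF that(1,2)] h(2)[of x] fteq[of k0 x] by (simp add: f_def norm_mult mult.commute)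
    then have "cmod (ft k0 x) \<le> exp (\<beta> r)" by simp
    then have "ln (cmod (ft k0 x)) \<le> ln (exp (\<beta> r))" using that(3) by (intro ln_mono) auto
    then show ?thesis by simp
  qed
  have "log_slow \<rho> (log_maximum (ft j))" if j: "j \<le> n" for j
  proof (rule log_slow_eventually[where R = R1])
    show "log_maximum (ft j) r \<le> log_maximum (ft j) s" if "1 \<le> r" "r \<le> s" for r s
      by (rule log_maximum_mono[OF fthol[OF j] ftnz[OF j]]) (use that in auto)
    fix r assume r: "R1 \<le> r"
    have r1: "0 < 2 * r" using r R1 by simp
    let ?E = "{R. \<exists>z. cmod z = R \<and> ft j z = 0} \<union> {R. \<exists>z. cmod z = R \<and> ft k0 z = 0}"
    have "countable ?E" by (intro countable_Un countable_zero_radii fthol ftnz j k0)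
    then obtain R where R: "2 * r < R" "R < 2 * (2 * r)" "R \<notin> ?E"
      using avoid_countable_radius[OF _ r1] by blast
    have nzj: "ft j x \<noteq> 0" and nzk: "ft k0 x \<noteq> 0" if "cmod x = R" for x using R(3) that by auto
    have Rp: "0 < R" using R r1 by linarith
    have cj: "continuous_on (sphere 0 R) (\<lambda>w. ln (cmod (ft j w)))"
      by (rule continuous_on_log_norm[OF fthol[OF j]]) (use nzj in auto)
    have ck: "continuous_on (sphere 0 R) (\<lambda>w. ln (cmod (ft k0 w)))"
      by (rule continuous_on_log_norm[OF fthol[OF k0(1)]]) (use nzk in auto)
    have cv: "continuous_on (sphere 0 R) (\<lambda>w. ln (vnorm n ft w))"
      by (rule continuous_on_log_vnorm[OF fthol ftred])
    define b where "b = max 0 (\<beta> (4 * r))"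
    \<comment> \<open>Both \<open>ln (vnorm n ft w) - ln (cmod (ft k0 w))\<close> and
      \<open>b - ln (cmod (ft k0 w))\<close> are nonnegative, so the right side dominates 0 and
      \<open>ln (cmod (ft j w))\<close>. Jensen's inequality with \<open>ft k0 0 = 1\<close> then
      discards the subtracted mean.\<close>
    have "circle_mean (\<lambda>w. max 0 (ln (cmod (ft j w)))) R
        \<le> circle_mean (\<lambda>w. (ln (vnorm n ft w) + b) - ln (cmod (ft k0 w))) R"
    proof (rule circle_mean_mono)
      fix x assume x: "cmod x = R"
      have "ln (cmod (ft j x)) \<le> ln (vnorm n ft x)"
        using nzj[OF x] vnorm_ge[OF j, of ft x] by (intro ln_mono) auto
      moreover have "ln (cmod (ft k0 x)) \<le> ln (vnorm n ft x)"
        using nzk[OF x] vnorm_ge[OF k0(1), of ft x] by (intro ln_mono) auto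
      moreover have "ln (cmod (ft k0 x)) \<le> \<beta> (4 * r)"
        by (rule ftk0) (use x R r R1 nzk[OF x] in auto)
      ultimately show "max 0 (ln (cmod (ft j x))) \<le> ln (vnorm n ft x) + b - ln (cmod (ft k0 x))"
        unfolding b_def by linarith
    qed (use Rp cj ck cv in \<open>auto intro!: continuous_intros\<close>)
    also have "\<dots> = char_T n ft R + b - circle_mean (\<lambda>w. ln (cmod (ft k0 w))) R"
      using Rp ck cv by (simp add: circle_mean_diff circle_mean_add char_T_eq_circle_mean continuous_intros)
    also have "\<dots> \<le> char_T n ft R + b"
      using jensen_inequality[OF fthol[OF k0(1)] nzk Rp] ft0 by simp
    also have "\<dots> \<le> \<tau> (4 * r) + cmod (h 0) + b"
      using char_T_exp_factor[OF fthol ftred h(1) fteq Rp] T\<tau>[of R r] R r r1 abs_Re_le_cmod[of "h 0"] by simp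
    finally have le: "circle_mean (\<lambda>w. max 0 (ln (cmod (ft j w)))) R \<le> \<tau> (4 * r) + cmod (h 0) + b" .
    show "log_maximum (ft j) r \<le> 3 * (\<tau> (4 * r) + cmod (h 0) + max 0 (\<beta> (4 * r)))"
    proof (rule log_maximum_le[OF fthol[OF j] ftnz[OF j]])
      fix x assume "cmod x \<le> r" "ft j x \<noteq> 0"
      then have "ln (cmod (ft j x)) \<le> 3 * circle_mean (\<lambda>w. max 0 (ln (cmod (ft j w)))) R"
        by (intro log_norm_le_mean_plus[OF fthol[OF j] nzj] Rp) (use R in auto)
      then show "ln (cmod (ft j x)) \<le> 3 * (\<tau> (4 * r) + cmod (h 0) + max 0 (\<beta> (4 * r)))"
        using le by (simp add: b_def)
    qed (use r1 in simp)
  next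
    have "log_slow \<rho> (\<lambda>r. max 0 (\<beta> r))"
    proof -
      obtain K where "0 \<le> K" "\<And>r. 1 \<le> r \<Longrightarrow> \<beta> r \<le> exp (K * (1 + ln r) powr \<rho>)" using G(4) by (auto elim: log_slowE)
      then show ?thesis by (intro log_slowI[of K]) auto
    qed
    from log_slow_scale[OF this, of 4]
    show "log_slow \<rho> (\<lambda>r. 3 * (\<tau> (4 * r) + cmod (h 0) + max 0 (\<beta> (4 * r))))"
      using \<rho> by (intro log_slow_mult log_slow_add log_slow_const log_slow_scale[OF \<tau>slow]) (auto simp: \<tau>_def)
  qed (use \<rho> in auto)
  then show ?thesis using that[OF h(1) fthol fteq] by blast
qed

text \<open>For \<open>g = 0\<close> the zero sets of positive radius are infinite, so that \<open>zero_count\<close> has the junk value \<open>0\<close>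
  there but possibly not at radius \<open>0\<close>. This covers a Wronskian that vanishes identically.\<close>
lemma count_N_le_if_zero:
  assumes "\<And>z. g z = 0" "0 < r"
  shows "count_N g r \<le> zero_count g 0 * ln r"
proof -
  have "zero_count g t = 0" if "0 < t" for t
  proof -
    have "{z. cmod z \<le> t \<and> g z = 0} = cball 0 t" using assms(1) by auto
    moreover have "infinite (cball (0::complex) t)" using uncountable_cball[OF that, of "0::complex"] countable_finite by blast
    ultimately show ?thesis by (simp add: zero_count_def)
  qed
  then have neg: "(zero_count g t - zero_count g 0) / t \<le> 0" if "t \<in> {0..r}" for t
    using that zero_count_nonneg[of g 0] by (cases "t = 0") (auto simp: divide_le_0_iff)
  have "integral {0..r} (\<lambda>t. (zero_count g t - zero_count g 0) / t) \<le> 0"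
  proof (cases "(\<lambda>t. (zero_count g t - zero_count g 0) / t) integrable_on {0..r}")
    case True
    then have "integral {0..r} (\<lambda>t. (zero_count g t - zero_count g 0) / t) \<le> integral {0..r} (\<lambda>t. 0)"
      by (intro integral_le) (use neg in auto)
    then show ?thesis by simp
  qed (simp add: not_integrable_integral)
  then show ?thesis by (simp add: count_N_def)
qed

text \<open>Integrating the pointwise bound over the circle leaves only the constant
  \<open>Re (H 0)\<close> of the factor \<open>exp h\<close>, and Jensen's formula turns the mean
  into the count. The error is \<open>c * (1 + ln r)\<close> because a Wronskian vanishing
  identically may carry a default order at 0 weighted by \<open>ln r\<close>.\<close>

lemma aw_wronskian_count_bound:
  assumes q: "0 < cmod q" "cmod q < 1"
  obtains C R where "2 \<le> C"
    "\<And>h fs g D. h holomorphic_on UNIV \<Longrightarrow> (\<And>j. j \<le> n \<Longrightarrow> fs j holomorphic_on UNIV) \<Longrightarrow>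
      (\<And>j x. j \<le> n \<Longrightarrow> fs j x = exp (h x) * (\<Sum>m\<le>n. D j m * g m x)) \<Longrightarrow>
      (\<And>m. m \<le> n \<Longrightarrow> g m holomorphic_on UNIV \<and> (\<exists>w. g m w \<noteq> 0)) \<Longrightarrow>
      \<exists>c\<ge>0. \<forall>r\<ge>R. ((\<exists>w. aw_wronskian q n fs w \<noteq> 0) \<longrightarrow> (\<forall>x. cmod x = r \<longrightarrow> aw_wronskian q n fs x \<noteq> 0)) \<longrightarrow>
        count_N (aw_wronskian q n fs) r \<le> (\<Sum>m\<le>n. log_maximum (g m) (C * r)) + c * (1 + ln r)"
proof -
  obtain C R where C: "2 \<le> C" and
    bound: "\<And>h fs g D. h holomorphic_on UNIV \<Longrightarrow>
      (\<And>j x. j \<le> n \<Longrightarrow> fs j x = exp (h x) * (\<Sum>m\<le>n. D j m * g m x)) \<Longrightarrow>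
      (\<And>m. m \<le> n \<Longrightarrow> g m holomorphic_on UNIV \<and> (\<exists>w. g m w \<noteq> 0)) \<Longrightarrow>
      \<exists>c. \<forall>x. R \<le> cmod x \<longrightarrow> aw_wronskian q n fs x \<noteq> 0 \<longrightarrow>
        ln (cmod (aw_wronskian q n fs x)) \<le> Re (\<Sum>k\<le>n. aw_A q (nat \<bar>int n - 2 * int k\<bar>) h x)
          + (\<Sum>m\<le>n. log_maximum (g m) (C * cmod x)) + c"
    using aw_wronskian_bound[OF q, of n] by blast
  show ?thesis
  proof (rule that[OF C, of "max 1 R"])
    fix h fs g D
    assume h: "h holomorphic_on UNIV" and fs: "\<And>j. j \<le> n \<Longrightarrow> fs j holomorphic_on UNIV"
      and eq: "\<And>j x. j \<le> n \<Longrightarrow> fs j x = exp (h x) * (\<Sum>m\<le>n. D j m * g m x)"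
      and g: "\<And>m. m \<le> n \<Longrightarrow> g m holomorphic_on UNIV \<and> (\<exists>w. g m w \<noteq> 0)"
    let ?W = "aw_wronskian q n fs"
    have Whol: "?W holomorphic_on UNIV" by (rule aw_wronskian_entire[OF fs q])
    show "\<exists>c\<ge>0. \<forall>r\<ge>max 1 R. ((\<exists>w. ?W w \<noteq> 0) \<longrightarrow> (\<forall>x. cmod x = r \<longrightarrow> ?W x \<noteq> 0)) \<longrightarrow>
        count_N ?W r \<le> (\<Sum>m\<le>n. log_maximum (g m) (C * r)) + c * (1 + ln r)"
    proof (cases "\<exists>w. ?W w \<noteq> 0")
      case True
      obtain c where c: "\<And>x. R \<le> cmod x \<Longrightarrow> ?W x \<noteq> 0 \<Longrightarrow>
        ln (cmod (?W x)) \<le> Re (\<Sum>k\<le>n. aw_A q (nat \<bar>int n - 2 * int k\<bar>) h x)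
          + (\<Sum>m\<le>n. log_maximum (g m) (C * cmod x)) + c"
        using bound[of h fs D g, OF h eq g] by blast
      define H where "H x = (\<Sum>k\<le>n. aw_A q (nat \<bar>int n - 2 * int k\<bar>) h x)" for x
      have H: "H holomorphic_on UNIV"
      proof -
        have "(\<lambda>x. \<Sum>k\<le>n. aw_A q (nat \<bar>int n - 2 * int k\<bar>) h x) holomorphic_on UNIV"
          by (intro holomorphic_on_sum aw_A_entire[OF h])
        then show ?thesis by (simp add: H_def[abs_def])
      qed
      define d where "d = \<bar>Re (H 0)\<bar> + \<bar>c\<bar> + \<bar>ln (cmod (Lim (at 0) (\<lambda>x. ?W x / x ^ nat (zorder ?W 0))))\<bar>"
      have "count_N ?W r \<le> (\<Sum>m\<le>n. log_maximum (g m) (C * r)) + d * (1 + ln r)"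
        if r: "max 1 R \<le> r" and nz: "\<And>x. cmod x = r \<Longrightarrow> ?W x \<noteq> 0" for r
      proof -
        have r0: "0 < r" "1 \<le> r" using r by auto
        let ?s = "(\<Sum>m\<le>n. log_maximum (g m) (C * r)) + c"
        have "circle_mean (\<lambda>x. ln (cmod (?W x))) r \<le> circle_mean (\<lambda>x. Re (H x) + ?s) r"
        proof (rule circle_mean_mono)
          show "continuous_on (sphere 0 r) (\<lambda>x. ln (cmod (?W x)))"
            by (rule continuous_on_log_norm[OF Whol]) (use nz in auto)
          show "continuous_on (sphere 0 r) (\<lambda>x. Re (H x) + ?s)"
            by (intro continuous_intros continuous_on_subset[OF holomorphic_on_imp_continuous_on[OF H]]) auto
          show "ln (cmod (?W x)) \<le> Re (H x) + ?s" if "cmod x = r" for x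
            using c[of x] nz[OF that] r that by (simp add: H_def)
        qed (use r0 in simp)
        also have "\<dots> = Re (H 0) + ?s"
          using circle_mean_add[of r "\<lambda>x. Re (H x)" "\<lambda>x. ?s"] r0 circle_mean_Re_entire[OF H r0(1)]
            continuous_on_subset[OF holomorphic_on_imp_continuous_on[OF H]] by (simp add: continuous_intros)
        finally have "count_N ?W r \<le> (\<Sum>m\<le>n. log_maximum (g m) (C * r)) + d * 1"
          using jensen_count[OF Whol nz r0(1)] by (simp add: d_def)
        also have "d * 1 \<le> d * (1 + ln r)" using r0 by (intro mult_left_mono) (auto simp: d_def)
        finally show ?thesis by simp
      qed
      moreover have "0 \<le> d" by (simp add: d_def)
      ultimately show ?thesis using True by blast
    next
      case False
      then have W0: "\<And>z. ?W z = 0" by blast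
      \<comment> \<open>The maxima on the right may be negative, but they are bounded below by their
        values at radius 1.\<close>
      define d where "d = zero_count ?W 0 + \<bar>\<Sum>m\<le>n. log_maximum (g m) 1\<bar>"
      have "count_N ?W r \<le> (\<Sum>m\<le>n. log_maximum (g m) (C * r)) + d * (1 + ln r)" if r: "max 1 R \<le> r" for r
      proof -
        have r0: "1 \<le> r" "0 < r" using r by auto
        have Cr: "1 \<le> C * r" using mult_mono[of 1 C 1 r] C r0 by simp
        have "(\<Sum>m\<le>n. log_maximum (g m) 1) \<le> (\<Sum>m\<le>n. log_maximum (g m) (C * r))"
          by (intro sum_mono log_maximum_mono) (use g Cr in auto)
        moreover have "zero_count ?W 0 * ln r \<le> zero_count ?W 0 * (1 + ln r)"
          using zero_count_nonneg by (intro mult_left_mono) auto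
        moreover have "\<bar>\<Sum>m\<le>n. log_maximum (g m) 1\<bar> * 1 \<le> \<bar>\<Sum>m\<le>n. log_maximum (g m) 1\<bar> * (1 + ln r)"
          using r0 by (intro mult_left_mono) auto
        ultimately show ?thesis
          using count_N_le_if_zero[of ?W r, OF W0 r0(2)] unfolding d_def distrib_right by linarith
      qed
      moreover have "0 \<le> d" using zero_count_nonneg by (simp add: d_def)
      ultimately show ?thesis by blast
    qed
  qed
qed


section \<open>Assembly of the estimate\<close>

lemma log_slow_sum:
  assumes "finite A" "\<And>a. a \<in> A \<Longrightarrow> log_slow \<rho> (\<phi> a)" "0 \<le> \<rho>"
  shows "log_slow \<rho> (\<lambda>r. \<Sum>a\<in>A. \<phi> a r)"
  using assms
proof (induction A rule: finite_induct)
  case empty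
  then show ?case using log_slow_const[of \<rho> 0] by simp
qed (simp add: log_slow_add)

lemma log_maximum_lin_form_le:
  assumes ft: "\<And>k. k \<le> n \<Longrightarrow> ft k holomorphic_on UNIV \<and> (\<exists>w. ft k w \<noteq> 0)"
    and L: "lin_form n c ft holomorphic_on UNIV" "\<exists>w. lin_form n c ft w \<noteq> 0" and r: "0 < r"
  shows "log_maximum (lin_form n c ft) r \<le> Max ((\<lambda>k. log_maximum (ft k) r) ` {..n}) + ln (\<Sum>k\<le>n. cmod (c k))"
proof (rule log_maximum_le[OF L r])
  fix x assume x: "cmod x \<le> r" "lin_form n c ft x \<noteq> 0"
  let ?M = "Max ((\<lambda>k. log_maximum (ft k) r) ` {..n})"
  have "cmod (lin_form n c ft x) \<le> (\<Sum>k\<le>n. cmod (c k) * exp ?M)"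
    unfolding lin_form_def
  proof (rule sum_norm_le)
    fix k assume k: "k \<in> {..n}"
    have "cmod (ft k x) \<le> exp (log_maximum (ft k) r)"
      by (rule norm_le_exp_log_maximum) (use ft k x r in auto)
    also have "\<dots> \<le> exp ?M" using k by simp
    finally show "cmod (c k * ft k x) \<le> cmod (c k) * exp ?M" by (simp add: norm_mult mult_left_mono)
  qed
  also have "\<dots> = (\<Sum>k\<le>n. cmod (c k)) * exp ?M" by (simp add: sum_distrib_right)
  finally have le: "cmod (lin_form n c ft x) \<le> (\<Sum>k\<le>n. cmod (c k)) * exp ?M" .
  have pos: "0 < cmod (lin_form n c ft x)" using x(2) by simp
  then have "0 < (\<Sum>k\<le>n. cmod (c k)) * exp ?M" using le by linarith
  then have s: "0 < (\<Sum>k\<le>n. cmod (c k))" by (simp add: zero_less_mult_iff)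
  have "ln (cmod (lin_form n c ft x)) \<le> ln ((\<Sum>k\<le>n. cmod (c k)) * exp ?M)" using le pos by (rule ln_mono)
  also have "\<dots> = ?M + ln (\<Sum>k\<le>n. cmod (c k))" using s by (subst ln_mult_pos) auto
  finally show "ln (cmod (lin_form n c ft x)) \<le> ?M + ln (\<Sum>k\<le>n. cmod (c k))" .
qed

theorem theorem5p1:
  fixes q :: complex and n p :: nat
    and a :: "nat \<Rightarrow> nat \<Rightarrow> complex"
    and fs :: "nat \<Rightarrow> complex \<Rightarrow> complex"
  assumes q: "0 < cmod q" "cmod q < 1"
    and hyperplanes: "\<forall>j\<in>{1..p}. \<exists>k\<le>n. a j k \<noteq> 0"
    and entire: "\<forall>k\<le>n. fs k holomorphic_on UNIV"
    and reduced: "\<forall>z. \<exists>k\<le>n. fs k z \<noteq> 0"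
    and lin_indep: "\<forall>c :: nat \<Rightarrow> complex. (\<forall>z. (\<Sum>k\<le>n. c k * fs k z) = 0) \<longrightarrow> (\<forall>k\<le>n. c k = 0)"
    and growth: "Limsup at_top (\<lambda>r. ereal (log_plus (log_plus (char_T n fs r)) / ln (ln r))) < 1"
  shows "\<exists>F C R. F \<in> sets lborel \<and> F \<subseteq> {1<..} \<and>
           (\<integral>\<^sup>+ t. indicator F t * ennreal (1 / (t * ln t)) \<partial>lborel) < \<infinity> \<and>
           (\<forall>r. R < r \<and> r \<notin> F \<longrightarrow>
              integral {0..2*pi} (\<lambda>\<theta>. Max ((\<lambda>K. \<Sum>j\<in>K.
                   ln (vnorm n fs (of_real r * cis \<theta>) /
                       cmod (lin_form n (a j) fs (of_real r * cis \<theta>))))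
                 ` {K. K \<subseteq> {1..p} \<and> forms_indep n a K})) / (2*pi)
              + count_N (aw_wronskian q n fs) r
              \<le> real (n + 1) * char_T n fs r
                 + C * (char_T n fs r / ln (ln r)) + C * ln r)"
proof -
  have fs: "\<And>k. k \<le> n \<Longrightarrow> fs k holomorphic_on UNIV" and red: "\<And>x. \<exists>k\<le>n. fs k x \<noteq> 0"
    using entire reduced by auto
  have comb: "\<exists>w. (\<Sum>k\<le>n. c k * fs k w) \<noteq> 0" if "\<exists>k\<le>n. c k \<noteq> 0" for c :: "nat \<Rightarrow> complex"
    using lin_indep that by blast
  have fsnz: "\<exists>w. fs k w \<noteq> 0" if k: "k \<le> n" for k
  proof -
    have "(\<Sum>i\<le>n. (if i = k then 1 else 0) * fs i w) = fs k w" for w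
      using k by (simp add: if_distrib[of "\<lambda>c. c * _"] cong: if_cong)
    then show ?thesis using comb[of "\<lambda>i. if i = k then 1 else 0"] k by auto
  qed
  obtain \<rho> R1 where \<rho>: "0 < \<rho>" "\<rho> < 1" "1 \<le> R1" "\<And>r. R1 \<le> r \<Longrightarrow> char_T n fs r \<le> exp ((ln r) powr \<rho>)"
    using growth_order_bound[OF growth] by blast
  obtain h ft where h: "h holomorphic_on UNIV" and ft: "\<And>k. k \<le> n \<Longrightarrow> ft k holomorphic_on UNIV"
    and fteq: "\<And>k x. fs k x = exp (h x) * ft k x"
    and ftslow: "\<And>k. k \<le> n \<Longrightarrow> log_slow \<rho> (log_maximum (ft k))"
    using slow_system[OF fs red fsnz \<rho>] by blast
  have ftnz: "\<exists>w. ft k w \<noteq> 0" if k: "k \<le> n" for k using fsnz[OF k] fteq by auto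
  have ftred: "\<exists>k\<le>n. ft k x \<noteq> 0" for x using red[of x] fteq by auto
  have lin: "lin_form n c fs x = exp (h x) * lin_form n c ft x" for c x
    by (simp add: lin_form_def fteq sum_distrib_left mult_ac)
  \<comment> \<open>One family for all functions involved: the components have indices 0 to
    \<open>n\<close>, the form with index \<open>j\<close> in 1 to \<open>p\<close> has index
    \<open>n + j\<close>.\<close>
  define U where "U i = (if i \<le> n then ft i else lin_form n (a (i - n)) ft)" for i
  have Uj: "U (n + j) = lin_form n (a j) ft" if "j \<in> {1..p}" for j using that by (auto simp: U_def)
  have Uhol: "U i holomorphic_on UNIV" for i
  proof -
    have "(\<lambda>x. lin_form n (a (i - n)) ft x) holomorphic_on UNIV"
      unfolding lin_form_def by (intro holomorphic_intros ft) auto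
    then show ?thesis using ft by (simp add: U_def)
  qed
  have Unz: "\<exists>w. U i w \<noteq> 0" if i: "i \<le> n + p" for i
  proof (cases "i \<le> n")
    case False
    then have "i - n \<in> {1..p}" using i by auto
    then have "\<exists>k\<le>n. a (i - n) k \<noteq> 0" using hyperplanes by blast
    then have "\<exists>w. lin_form n (a (i - n)) fs w \<noteq> 0" using comb by (simp add: lin_form_def)
    then show ?thesis using False lin by (auto simp: U_def)
  qed (use ftnz in \<open>auto simp: U_def\<close>)
  define \<phi> where "\<phi> i r = log_maximum (U i) r" for i r
  define \<Phi> where "\<Phi> r = Max ((\<lambda>k. log_maximum (ft k) r) ` {..n})" for r
  have \<Phi>ge: "\<phi> k r \<le> \<Phi> r" if "k \<le> n" for k r using that by (simp add: \<phi>_def \<Phi>_def U_def)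
  have \<Phi>at: "\<exists>k\<le>n. \<Phi> r = \<phi> k r" for r
  proof -
    have "\<Phi> r \<in> (\<lambda>k. log_maximum (ft k) r) ` {..n}" unfolding \<Phi>_def by (rule Max_in) auto
    then show ?thesis by (auto simp: \<phi>_def U_def)
  qed
  define d where "d = (\<Sum>j\<in>{1..p}. \<bar>ln (\<Sum>k\<le>n. cmod (a j k))\<bar>)"
  have d0: "0 \<le> d" by (simp add: d_def sum_nonneg)
  have \<phi>d: "\<phi> i r \<le> \<Phi> r + d" if i: "i \<le> n + p" and r: "0 < r" for i r
  proof (cases "i \<le> n")
    case True then show ?thesis using \<Phi>ge[OF True, of r] d0 by simp
  next
    case False
    then have j: "i - n \<in> {1..p}" using i by auto
    have "\<phi> i r \<le> \<Phi> r + ln (\<Sum>k\<le>n. cmod (a (i - n) k))"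
      using log_maximum_lin_form_le[of n ft "a (i - n)" r] ft ftnz Uhol[of i] Unz[OF i] r False
      by (simp add: \<phi>_def \<Phi>_def U_def)
    also have "ln (\<Sum>k\<le>n. cmod (a (i - n) k)) \<le> \<bar>ln (\<Sum>k\<le>n. cmod (a (i - n) k))\<bar>" by simp
    also have "\<dots> \<le> d" unfolding d_def by (rule member_le_sum[OF j]) auto
    finally show ?thesis by simp
  qed
  have mono: "\<phi> i r \<le> \<phi> i s" if "i \<le> n + p" "0 < r" "r \<le> s" for i r s
    unfolding \<phi>_def by (rule log_maximum_mono[OF Uhol Unz]) (use that in auto)
  have \<phi>slow: "log_slow \<rho> (log_maximum (U i))" if i: "i \<le> n + p" for i
  proof (rule log_slow_mono)
    \<comment> \<open>Adding the modulus at radius 1 makes every summand nonnegative for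
      \<open>r \<ge> 1\<close>, so the sum dominates the largest component.\<close>
    show "log_slow \<rho> (\<lambda>r. (\<Sum>k\<le>n. log_maximum (ft k) r + \<bar>log_maximum (ft k) 1\<bar>) + d)"
      using \<rho> by (intro log_slow_add log_slow_sum log_slow_const ftslow) auto
    fix r :: real assume r: "1 \<le> r"
    obtain k where k: "k \<le> n" "\<Phi> r = \<phi> k r" using \<Phi>at by blast
    have "log_maximum (ft j) 1 \<le> log_maximum (ft j) r" if "j \<le> n" for j
      by (rule log_maximum_mono[OF ft ftnz]) (use that r in auto)
    then have "log_maximum (ft k) r + \<bar>log_maximum (ft k) 1\<bar> \<le> (\<Sum>k\<le>n. log_maximum (ft k) r + \<bar>log_maximum (ft k) 1\<bar>)"
      using k(1) by (intro member_le_sum[of k "{..n}" "\<lambda>k. log_maximum (ft k) r + \<bar>log_maximum (ft k) 1\<bar>"]) force+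
    then show "log_maximum (U i) r \<le> (\<Sum>k\<le>n. log_maximum (ft k) r + \<bar>log_maximum (ft k) 1\<bar>) + d"
      using \<phi>d[OF i, of r] r k by (simp add: \<phi>_def U_def)
  qed
  let ?W = "aw_wronskian q n fs"
  obtain C R2 where C: "2 \<le> C" and
    B: "\<And>h fs g D. h holomorphic_on UNIV \<Longrightarrow> (\<And>j. j \<le> n \<Longrightarrow> fs j holomorphic_on UNIV) \<Longrightarrow>
      (\<And>j x. j \<le> n \<Longrightarrow> fs j x = exp (h x) * (\<Sum>m\<le>n. D j m * g m x)) \<Longrightarrow>
      (\<And>m. m \<le> n \<Longrightarrow> g m holomorphic_on UNIV \<and> (\<exists>w. g m w \<noteq> 0)) \<Longrightarrow>
      \<exists>c\<ge>0. \<forall>r\<ge>R2. ((\<exists>w. aw_wronskian q n fs w \<noteq> 0) \<longrightarrow> (\<forall>x. cmod x = r \<longrightarrow> aw_wronskian q n fs x \<noteq> 0)) \<longrightarrow>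
        count_N (aw_wronskian q n fs) r \<le> (\<Sum>m\<le>n. log_maximum (g m) (C * r)) + c * (1 + ln r)"
    by (rule aw_wronskian_count_bound[OF q, of n]) blast
  note Nbound = B[of h fs, OF h fs]
  define \<K> where "\<K> = {K. K \<subseteq> {1..p} \<and> forms_indep n a K}"
  have fin\<K>: "finite \<K>" by (rule finite_subset[of _ "Pow {1..p}"]) (auto simp: \<K>_def)
  \<comment> \<open>The empty set is independent, so the maximum is over a nonempty family, also for
    \<open>p = 0\<close>.\<close>
  have ne\<K>: "\<K> \<noteq> {}" by (auto simp: \<K>_def forms_indep_def intro!: exI[of _ "{}"])
  \<comment> \<open>In a basis containing the forms of \<open>K\<close>, the Wronskian costs one
    maximum per basis element: the forms enter with their own \<open>\<phi>\<close>, the others with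
    at most \<open>\<Phi>\<close>. The number \<open>e\<close> is a common bound for the growth from
    \<open>r\<close> to \<open>C * r\<close>.\<close>
  have "\<exists>c\<ge>0. \<forall>r\<ge>R2. \<forall>e\<ge>0. 0 < r \<longrightarrow> ((\<exists>w. ?W w \<noteq> 0) \<longrightarrow> (\<forall>x. cmod x = r \<longrightarrow> ?W x \<noteq> 0)) \<longrightarrow>
      (\<forall>i\<le>n + p. \<phi> i (C * r) \<le> \<phi> i r + e) \<longrightarrow>
      count_N ?W r \<le> (\<Sum>j\<in>K. \<phi> (n + j) r - \<Phi> r) + real (n + 1) * \<Phi> r + real (n + 1) * e + c * (1 + ln r)"
    if K: "K \<in> \<K>" for K
  proof -
    have Kp: "K \<subseteq> {1..p}" "forms_indep n a K" "finite K" using K finite_subset by (auto simp: \<K>_def)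
    obtain \<pi> G D where E: "inj_on \<pi> K" "\<pi> ` K \<subseteq> {..n}" "\<forall>j\<in>K. \<forall>k\<le>n. G (\<pi> j) k = a j k"
     "\<forall>i\<in>{..n} - \<pi> ` K. \<forall>k\<le>n. G i k = (if i = k then 1 else 0)"
     "\<forall>m\<le>n. \<forall>k\<le>n. (\<Sum>i\<le>n. D m i * G i k) = (if m = k then 1 else (0::complex))"
      using forms_indep_extend[OF Kp(3,2)] by blast
    define g where "g m = lin_form n (G m) ft" for m
    have g1: "g (\<pi> j) = U (n + j)" if "j \<in> K" for j
      using E(3) that Kp(1) Uj[of j] by (auto simp: g_def lin_form_def fun_eq_iff)
    have g2: "g m = U m" if m: "m \<in> {..n} - \<pi> ` K" for m
    proof
      fix x
      have "g m x = (\<Sum>k\<le>n. if k = m then ft k x else 0)"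
        unfolding g_def lin_form_def by (rule sum.cong) (use E(4) m in auto)
      then show "g m x = U m x" using m by (simp add: U_def)
    qed
    have gU: "\<exists>i\<le>n + p. g m = U i" if "m \<le> n" for m
    proof (cases "m \<in> \<pi> ` K")
      case True
      then obtain j where j: "j \<in> K" "m = \<pi> j" by blast
      then show ?thesis using g1[OF j(1)] Kp(1) by (intro exI[of _ "n + j"]) auto
    qed (use g2[of m] that in \<open>auto intro!: exI[of _ m]\<close>)
    have "fs j x = exp (h x) * (\<Sum>m\<le>n. D j m * g m x)" if j: "j \<le> n" for j x
    proof -
      have "(\<Sum>m\<le>n. D j m * g m x) = (\<Sum>m\<le>n. \<Sum>k\<le>n. D j m * G m k * ft k x)"
        by (simp add: g_def lin_form_def sum_distrib_left mult.assoc)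
      also have "\<dots> = (\<Sum>k\<le>n. (\<Sum>m\<le>n. D j m * G m k) * ft k x)"
        by (subst sum.swap) (simp add: sum_distrib_right)
      also have "\<dots> = (\<Sum>k\<le>n. if k = j then ft k x else 0)"
        by (rule sum.cong) (use E(5) j in auto)
      finally show ?thesis using j by (simp add: fteq)
    qed
    moreover have "g m holomorphic_on UNIV \<and> (\<exists>w. g m w \<noteq> 0)" if "m \<le> n" for m
      using gU[OF that] Uhol Unz by auto
    ultimately obtain c where c: "0 \<le> c" "\<And>r. R2 \<le> r \<Longrightarrow> ((\<exists>w. ?W w \<noteq> 0) \<longrightarrow> (\<forall>x. cmod x = r \<longrightarrow> ?W x \<noteq> 0)) \<Longrightarrow>
        count_N ?W r \<le> (\<Sum>m\<le>n. log_maximum (g m) (C * r)) + c * (1 + ln r)"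
      using Nbound[of D g] by blast
    have "count_N ?W r \<le> (\<Sum>j\<in>K. \<phi> (n + j) r - \<Phi> r) + real (n + 1) * \<Phi> r + real (n + 1) * e + c * (1 + ln r)"
      if r: "R2 \<le> r" "0 < r" and e: "0 \<le> e" and W: "(\<exists>w. ?W w \<noteq> 0) \<longrightarrow> (\<forall>x. cmod x = r \<longrightarrow> ?W x \<noteq> 0)"
        and \<phi>e: "\<forall>i\<le>n + p. \<phi> i (C * r) \<le> \<phi> i r + e" for r e
    proof -
      have "(\<Sum>m\<le>n. log_maximum (g m) (C * r)) = (\<Sum>m\<in>{..n} - \<pi> ` K. log_maximum (g m) (C * r)) + (\<Sum>m\<in>\<pi> ` K. log_maximum (g m) (C * r))"
        by (rule sum.subset_diff) (use E(2) in auto)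
      also have "(\<Sum>m\<in>\<pi> ` K. log_maximum (g m) (C * r)) = (\<Sum>j\<in>K. \<phi> (n + j) (C * r))"
        by (subst sum.reindex[OF E(1)]) (simp add: g1 \<phi>_def)
      also have "\<dots> \<le> (\<Sum>j\<in>K. \<phi> (n + j) r + e)"
        by (rule sum_mono) (use \<phi>e Kp(1) in auto)
      also have "(\<Sum>m\<in>{..n} - \<pi> ` K. log_maximum (g m) (C * r)) \<le> (\<Sum>m\<in>{..n} - \<pi> ` K. \<Phi> r + e)"
      proof (rule sum_mono)
        fix m assume m: "m \<in> {..n} - \<pi> ` K"
        then show "log_maximum (g m) (C * r) \<le> \<Phi> r + e"
          using g2[OF m] \<phi>e[rule_format, of m] \<Phi>ge[of m r] by (simp add: \<phi>_def)
      qed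
      also have "\<dots> = (real (n + 1) - real (card K)) * (\<Phi> r + e)"
      proof -
        have "card (\<pi> ` K) = card K" by (rule card_image[OF E(1)])
        moreover have "card (\<pi> ` K) \<le> card {..n}" by (rule card_mono) (use E(2) in auto)
        ultimately show ?thesis using E(2) Kp(3) by (simp add: card_Diff_subset of_nat_diff)
      qed
      finally show ?thesis using c(2)[OF r(1) W] by (simp add: sum.distrib sum_subtractf algebra_simps)
    qed
    then show ?thesis using c(1) by blast
  qed
  then obtain cN where cN: "\<And>K. K \<in> \<K> \<Longrightarrow> 0 \<le> cN K"
    "\<And>K r e. K \<in> \<K> \<Longrightarrow> R2 \<le> r \<Longrightarrow> 0 \<le> e \<Longrightarrow> 0 < r \<Longrightarrow> ((\<exists>w. ?W w \<noteq> 0) \<longrightarrow> (\<forall>x. cmod x = r \<longrightarrow> ?W x \<noteq> 0)) \<Longrightarrow>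
      (\<And>i. i \<le> n + p \<Longrightarrow> \<phi> i (C * r) \<le> \<phi> i r + e) \<Longrightarrow>
      count_N ?W r \<le> (\<Sum>j\<in>K. \<phi> (n + j) r - \<Phi> r) + real (n + 1) * \<Phi> r + real (n + 1) * e + cN K * (1 + ln r)"
    by metis
  define P where "P i F R c \<longleftrightarrow> log_exceptional F \<and> (\<forall>r. R < r \<longrightarrow> r \<notin> F \<longrightarrow>
       \<phi> i (C * r) - \<phi> i (r / C) \<le> 2 * (\<phi> i r + c) / ln (ln r)) \<and> (\<forall>r\<ge>1. 0 \<le> \<phi> i r + c)" for i F R c
  have "\<forall>i\<in>{..n + p}. \<exists>F R c. P i F R c"
  proof
    fix i assume "i \<in> {..n + p}"
    then have i: "i \<le> n + p" by simp
    have "1 < C" using C by simp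
    from slow_log_maximum_regular[OF Uhol Unz[OF i] \<phi>slow[OF i] \<rho>(1,2) this]
    obtain F R c where "log_exceptional F"
      "\<And>r. R < r \<Longrightarrow> r \<notin> F \<Longrightarrow> log_maximum (U i) (C * r) - log_maximum (U i) (r / C) \<le> 2 * (log_maximum (U i) r + c) / ln (ln r)"
      "\<And>r. 1 \<le> r \<Longrightarrow> 0 \<le> log_maximum (U i) r + c" by blast
    then have "P i F R c" by (simp add: P_def \<phi>_def)
    then show "\<exists>F R c. P i F R c" by blast
  qed
  then obtain F0 where "\<forall>i\<in>{..n + p}. \<exists>R c. P i (F0 i) R c" using bchoice by metis
  then obtain R0 where "\<forall>i\<in>{..n + p}. \<exists>c. P i (F0 i) (R0 i) c" using bchoice by metis
  then obtain c0 where P: "\<And>i. i \<le> n + p \<Longrightarrow> P i (F0 i) (R0 i) (c0 i)" using bchoice by (metis atMost_iff)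
  \<comment> \<open>Circles through zeros are excluded so that all logarithms are continuous on the circle.\<close>
  define E where "E = (\<Union>i\<in>{..n + p}. {r. \<exists>z. cmod z = r \<and> U i z = 0}) \<union>
     (if \<exists>w. ?W w \<noteq> 0 then {r. \<exists>z. cmod z = r \<and> ?W z = 0} else {})"
  have "countable E" unfolding E_def
    using countable_zero_radii[OF aw_wronskian_entire[OF fs q]]
    by (intro countable_Un countable_UN countable_zero_radii Uhol Unz) auto
  then have Eexc: "log_exceptional (E \<inter> {1<..})" by (rule log_exceptional_countable)
  define F where "F = (\<Union>i\<in>{..n + p}. F0 i) \<union> (E \<inter> {1<..})"
  have Fexc: "log_exceptional F" unfolding F_def
    by (intro log_exceptional_Un log_exceptional_UN Eexc) (use P in \<open>auto simp: P_def\<close>)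
  \<comment> \<open>A single constant that dominates all shifts \<open>c0\<close>, the loss
    \<open>d\<close> of the linear forms and all constants \<open>cN\<close>.\<close>
  define cs where "cs = (\<Sum>i\<le>n + p. \<bar>c0 i\<bar>) + d + (\<Sum>K\<in>\<K>. cN K)"
  have cNnn: "0 \<le> (\<Sum>K\<in>\<K>. cN K)" by (rule sum_nonneg) (rule cN)
  have csc: "c0 i \<le> cs" if "i \<le> n + p" for i
    using member_le_sum[of i "{..n + p}" "\<lambda>i. \<bar>c0 i\<bar>"] that d0 cNnn by (simp add: cs_def)
  have c0nn: "0 \<le> (\<Sum>i\<le>n + p. \<bar>c0 i\<bar>)" by (rule sum_nonneg) simp
  have csd: "d \<le> cs" using cNnn c0nn by (simp add: cs_def)
  have csN: "cN K \<le> cs" if "K \<in> \<K>" for K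
  proof -
    have "cN K \<le> (\<Sum>K\<in>\<K>. cN K)" by (rule member_le_sum) (use that cN(1) fin\<K> in auto)
    then show ?thesis using d0 c0nn unfolding cs_def by linarith
  qed
  have cs0: "0 \<le> cs" using csd d0 by linarith
  define b where "b = Re (h 0)"
  define c2 where "c2 = 2 * cs + \<bar>b\<bar>"
  \<comment> \<open>In units of the error \<open>e\<close>: each of the \<open>n + 1\<close> basis
    elements loses 12 in comparing \<open>\<Phi>\<close> with the characteristic and 6 in passing to
    radius \<open>C * r\<close>; each of the \<open>p\<close> forms loses 18 in its circle
    mean.\<close>
  define A where "A = 18 * real (n + 1) + 18 * real p"
  \<comment> \<open>\<open>A\<close> pays for the error term, \<open>cs\<close> for
    \<open>cs * ln r\<close>, and 1 for the constant \<open>Dl\<close>, which is below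
    \<open>ln r\<close>.\<close>
  define Cf where "Cf = A + cs + 1"
  define Dl where "Dl = real (n + 1) * \<bar>b\<bar> + Cf * c2 + cs"
  \<comment> \<open>\<open>exp (exp 12)\<close> yields \<open>12 * \<epsilon> \<le> 1\<close>, which
    lets error terms be absorbed; \<open>exp Dl\<close> puts all additive constants below
    \<open>ln r\<close>.\<close>
  define Rf where "Rf = Max (insert R2 (insert (exp (exp 12)) (insert (exp Dl) (R0 ` {..n + p}))))"
  have Rf: "R2 \<le> Rf" "exp (exp 12) \<le> Rf" "exp Dl \<le> Rf" "\<And>i. i \<le> n + p \<Longrightarrow> R0 i \<le> Rf"
    unfolding Rf_def by (rule Max_ge; simp)+
  define m where "m x = Max ((\<lambda>K. \<Sum>j\<in>K. ln (vnorm n fs x / cmod (lin_form n (a j) fs x))) ` \<K>)" for x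
  have "circle_mean m r + count_N ?W r \<le> real (n + 1) * char_T n fs r + Cf * (char_T n fs r / ln (ln r)) + Cf * ln r"
    if rR: "Rf < r" and rF: "r \<notin> F" for r
  proof -
    define \<epsilon> where "\<epsilon> = 1 / ln (ln r)"
    have r1: "exp (exp 12) < r" "exp Dl < r" "R2 < r" using rR Rf by linarith+
    have r0: "0 < r" using r1(1) less_trans[OF exp_gt_zero] by blast
    have lr: "exp 12 < ln r" "Dl < ln r" by (rule less_ln_if_exp_less[OF r1(1)] less_ln_if_exp_less[OF r1(2)])+
    have lr0: "0 < ln r" using lr(1) less_trans[OF exp_gt_zero] by blast
    have llr: "12 < ln (ln r)" by (rule less_ln_if_exp_less[OF lr(1)])
    have r1': "1 < r" using lr0 r0 by simp
    have eps: "0 < \<epsilon>" "12 * \<epsilon> \<le> 1" using llr by (auto simp: \<epsilon>_def)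
    have Unz_r: "U i x \<noteq> 0" if "i \<le> n + p" "cmod x = r" for i x
      using rF r1' that by (auto simp: F_def E_def)
    have W_r: "(\<exists>w. ?W w \<noteq> 0) \<longrightarrow> (\<forall>x. cmod x = r \<longrightarrow> ?W x \<noteq> 0)"
      using rF r1' by (auto simp: F_def E_def split: if_splits)
    have cont: "continuous_on (sphere 0 r) (\<lambda>x. ln (cmod (U i x)))" if "i \<le> n + p" for i
      by (rule continuous_on_log_norm[OF Uhol]) (use Unz_r[OF that] in auto)
    have contv: "continuous_on (sphere 0 r) (\<lambda>x. ln (vnorm n ft x))"
      by (rule continuous_on_log_vnorm[OF ft ftred])
    define t where "t = char_T n ft r"
    have T: "char_T n fs r = t + b"
      unfolding t_def b_def by (rule char_T_exp_factor[OF ft ftred h fteq r0])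
    have nn: "0 \<le> \<phi> i r + cs" if "i \<le> n + p" for i
    proof -
      have "0 \<le> \<phi> i r + c0 i" using P[OF that] r1' by (simp add: P_def)
      then show ?thesis using csc[OF that] by linarith
    qed
    have reg: "\<phi> i (C * r) - \<phi> i (r / C) \<le> 2 * \<epsilon> * (\<phi> i r + cs)" if i: "i \<le> n + p" for i
    proof -
      have "r \<notin> F0 i" using rF i by (auto simp: F_def)
      then have "\<phi> i (C * r) - \<phi> i (r / C) \<le> 2 * (\<phi> i r + c0 i) / ln (ln r)"
        using P[OF i] Rf(4)[OF i] rR by (simp add: P_def)
      also have "\<dots> = 2 * \<epsilon> * (\<phi> i r + c0 i)" by (simp add: \<epsilon>_def)
      also have "\<dots> \<le> 2 * \<epsilon> * (\<phi> i r + cs)" using csc[OF i] eps by (intro mult_left_mono) auto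
      finally show ?thesis .
    qed
    have m1: "\<phi> i (r / C) \<le> \<phi> i (r / 2)" "\<phi> i (r / 2) \<le> \<phi> i r" "\<phi> i r \<le> \<phi> i (C * r)" if i: "i \<le> n + p" for i
      using C r0 mult_right_mono[of 1 C r] by (auto intro!: mono[OF i] divide_left_mono)
    \<comment> \<open>The Harnack defect is three times the increment from \<open>r / 2\<close> to
      \<open>r\<close>, which lies within the regular range from \<open>r / C\<close> to
      \<open>C * r\<close>.\<close>
    have mean: "\<phi> i r - 6 * \<epsilon> * (\<phi> i r + cs) \<le> circle_mean (\<lambda>x. ln (cmod (U i x))) r" if i: "i \<le> n + p" for i
    proof -
      have "\<phi> i r - 3 * (\<phi> i r - \<phi> i (r / 2)) \<le> circle_mean (\<lambda>x. ln (cmod (U i x))) r"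
        unfolding \<phi>_def by (rule mean_log_ge_log_maximum[OF Uhol Unz_r[OF i] r0])
      moreover have "\<phi> i r - \<phi> i (r / 2) \<le> 2 * \<epsilon> * (\<phi> i r + cs)" using reg[OF i] m1[OF i] by linarith
      moreover have "6 * \<epsilon> * (\<phi> i r + cs) = 3 * (2 * \<epsilon> * (\<phi> i r + cs))" by simp
      moreover have "x - z \<le> c" if "x - 3 * (x - y) \<le> c" "x - y \<le> s" "z = 3 * s" for x y z c s :: real
        using that by argo
      ultimately show ?thesis by blast
    qed
    \<comment> \<open>The unit of error, in terms of the characteristic; the shift by
      \<open>2 * cs\<close> keeps it nonnegative.\<close>
    define e where "e = \<epsilon> * (t + 2 * cs)"
    \<comment> \<open>The bound is used twice: first \<open>6 * \<epsilon> \<le> 1 / 2\<close>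
      absorbs the error into the left side and gives a crude bound by twice the characteristic,
      which is then inserted into the error term.\<close>
    have compk: "\<phi> k r + cs \<le> 2 * (t + cs)" "\<phi> k r \<le> t + 12 * e" if k: "k \<le> n" for k
    proof -
      have i: "k \<le> n + p" using k by simp
      have "circle_mean (\<lambda>x. ln (cmod (ft k x))) r \<le> t"
        unfolding t_def by (rule char_T_ge_mean_log[OF ft ftred k]) (use Unz_r[OF i] k r0 in \<open>auto simp: U_def\<close>)
      then have le: "\<phi> k r - 6 * \<epsilon> * (\<phi> k r + cs) \<le> t" using mean[OF i] k by (simp add: U_def)
      have "6 * \<epsilon> * (\<phi> k r + cs) \<le> 1 / 2 * (\<phi> k r + cs)" using eps nn[OF i] by (intro mult_right_mono) auto
      then show 1: "\<phi> k r + cs \<le> 2 * (t + cs)" using le by argo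
      have "6 * \<epsilon> * (\<phi> k r + cs) \<le> 6 * \<epsilon> * (2 * (t + cs))" using 1 eps by (intro mult_left_mono) auto
      moreover have "6 * \<epsilon> * (2 * (t + cs)) \<le> 6 * \<epsilon> * (2 * (t + 2 * cs))"
        using eps cs0 by (intro mult_left_mono) auto
      moreover have "6 * \<epsilon> * (2 * (t + 2 * cs)) = 12 * e" by (simp add: e_def)
      ultimately show "\<phi> k r \<le> t + 12 * e" using le by argo
    qed
    have tc: "0 \<le> t + 2 * cs" using compk(1)[of 0] nn[of 0] cs0 by simp
    have e0: "0 \<le> e" using tc eps by (simp add: e_def)
    have \<Phi>t: "\<Phi> r \<le> t + 12 * e" using \<Phi>at[of r] compk(2) by auto
    have "12 * e \<le> t + 2 * cs" using mult_right_mono[OF eps(2) tc] by (simp add: e_def)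
    then have s3: "\<phi> i r + cs \<le> 3 * (t + 2 * cs)" if "i \<le> n + p" for i
      using \<phi>d[OF that r0] \<Phi>t csd tc by argo
    have e6: "2 * \<epsilon> * (\<phi> i r + cs) \<le> 6 * e" if i: "i \<le> n + p" for i
      using mult_left_mono[OF s3[OF i], of "2 * \<epsilon>"] eps by (simp add: e_def)
    have Ce: "\<phi> i (C * r) \<le> \<phi> i r + 6 * e" if i: "i \<le> n + p" for i
      using reg[OF i] m1[OF i] e6[OF i] by linarith
    have mean': "\<phi> i r - circle_mean (\<lambda>x. ln (cmod (U i x))) r \<le> 18 * e" if i: "i \<le> n + p" for i
    proof -
      have "6 * \<epsilon> * (\<phi> i r + cs) = 3 * (2 * \<epsilon> * (\<phi> i r + cs))" by simp
      moreover have "x - c \<le> 18 * w" if "x - z \<le> c" "z = 3 * s" "s \<le> 6 * w" for x z c s w :: real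
        using that by argo
      ultimately show ?thesis using mean[OF i] e6[OF i] by blast
    qed
    define M where "M = Max ((\<lambda>K. \<Sum>j\<in>K. \<Phi> r - \<phi> (n + j) r) ` \<K>)"
    have "M \<in> (\<lambda>K. \<Sum>j\<in>K. \<Phi> r - \<phi> (n + j) r) ` \<K>" unfolding M_def by (rule Max_in) (use fin\<K> ne\<K> in auto)
    \<comment> \<open>In contrast to the maximum in the integrand, this one is attained by a single
      set for the whole circle.\<close>
    then obtain K0 where K0: "K0 \<in> \<K>" "M = (\<Sum>j\<in>K0. \<Phi> r - \<phi> (n + j) r)" by blast
    define u where "u K x = (\<Sum>j\<in>K. ln (vnorm n ft x) - ln (cmod (U (n + j) x)))" for K x
    have meq: "m x = Max ((\<lambda>K. u K x) ` \<K>)" if x: "cmod x = r" for x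
    proof -
      have "ln (vnorm n fs x / cmod (lin_form n (a j) fs x)) = ln (vnorm n ft x) - ln (cmod (U (n + j) x))"
        if "j \<in> {1..p}" for j
      proof -
        \<comment> \<open>The common factor \<open>exp h\<close> cancels.\<close>
        have "vnorm n fs x / cmod (lin_form n (a j) fs x) = vnorm n ft x / cmod (U (n + j) x)"
        proof -
          have "vnorm n fs x = exp (Re (h x)) * vnorm n ft x" by (rule vnorm_exp_factor) (rule fteq)
          then show ?thesis unfolding lin Uj[OF that] by (simp add: norm_mult)
        qed
        moreover have "0 < vnorm n ft x" "0 < cmod (U (n + j) x)"
          using vnorm_pos[of n ft x] ftred Unz_r[OF _ x, of "n + j"] that by auto
        ultimately show ?thesis by (simp add: ln_div)
      qed
      then have "(\<Sum>j\<in>K. ln (vnorm n fs x / cmod (lin_form n (a j) fs x))) = u K x" if "K \<in> \<K>" for K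
        unfolding u_def using that by (intro sum.cong) (auto simp: \<K>_def)
      then show ?thesis unfolding m_def by (intro arg_cong[of _ _ Max] image_cong) auto
    qed
    have contj: "continuous_on (sphere 0 r) (\<lambda>x. ln (cmod (U (n + j) x)))" if "j \<in> {1..p}" for j
      by (rule cont) (use that in auto)
    have vle: "ln (vnorm n ft x) \<le> \<Phi> r" if x: "cmod x = r" for x
    proof -
      obtain k where k: "k \<le> n" "vnorm n ft x = cmod (ft k x)" using vnorm_attained .
      have "ln (cmod (U k x)) \<le> \<phi> k r" unfolding \<phi>_def
        by (rule log_norm_le_log_maximum[OF Uhol Unz_r]) (use k x r0 in auto)
      then show ?thesis using k \<Phi>ge[OF k(1), of r] by (simp add: U_def)
    qed
    have "circle_mean m r = circle_mean (\<lambda>x. Max ((\<lambda>K. u K x) ` \<K>)) r"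
      by (rule circle_mean_cong) (use meq r0 in auto)
    also have "\<dots> \<le> circle_mean (\<lambda>x. M + (\<Sum>j\<in>{1..p}. \<phi> (n + j) r - ln (cmod (U (n + j) x)))) r"
    proof (rule circle_mean_mono)
      show "continuous_on (sphere 0 r) (\<lambda>x. Max ((\<lambda>K. u K x) ` \<K>))"
        unfolding u_def
        by (intro continuous_on_Max_image fin\<K> ne\<K> continuous_on_sum continuous_on_diff contv contj)
           (auto simp: \<K>_def)
      show "continuous_on (sphere 0 r) (\<lambda>x. M + (\<Sum>j\<in>{1..p}. \<phi> (n + j) r - ln (cmod (U (n + j) x))))"
        by (intro continuous_on_add continuous_on_sum continuous_on_diff continuous_on_const contj)
      fix x assume x: "cmod x = r"
      \<comment> \<open>The differences \<open>\<phi> (n + j) r - ln (cmod (U (n + j) x))\<close>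
        are nonnegative on the circle, so their sum may be extended from \<open>K\<close> to all
        forms. The bound no longer depends on \<open>K\<close>, and each difference has small
        mean.\<close>
      have "u K x \<le> M + (\<Sum>j\<in>{1..p}. \<phi> (n + j) r - ln (cmod (U (n + j) x)))" if K: "K \<in> \<K>" for K
      proof -
        have "u K x \<le> (\<Sum>j\<in>K. (\<Phi> r - \<phi> (n + j) r) + (\<phi> (n + j) r - ln (cmod (U (n + j) x))))"
          unfolding u_def by (rule sum_mono) (use vle[OF x] in simp)
        also have "\<dots> = (\<Sum>j\<in>K. \<Phi> r - \<phi> (n + j) r) + (\<Sum>j\<in>K. \<phi> (n + j) r - ln (cmod (U (n + j) x)))"
          by (rule sum.distrib)
        also have "(\<Sum>j\<in>K. \<Phi> r - \<phi> (n + j) r) \<le> M" unfolding M_def using K fin\<K> by simp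
        also have "(\<Sum>j\<in>K. \<phi> (n + j) r - ln (cmod (U (n + j) x))) \<le> (\<Sum>j\<in>{1..p}. \<phi> (n + j) r - ln (cmod (U (n + j) x)))"
        proof (rule sum_mono2)
          show "0 \<le> \<phi> (n + j) r - ln (cmod (U (n + j) x))" if "j \<in> {1..p} - K" for j
          proof -
            have "ln (cmod (U (n + j) x)) \<le> \<phi> (n + j) r" unfolding \<phi>_def
              by (rule log_norm_le_log_maximum[OF Uhol Unz_r]) (use that x r0 in auto)
            then show ?thesis by simp
          qed
        qed (use K in \<open>auto simp: \<K>_def\<close>)
        finally show ?thesis by simp
      qed
      then show "Max ((\<lambda>K. u K x) ` \<K>) \<le> M + (\<Sum>j\<in>{1..p}. \<phi> (n + j) r - ln (cmod (U (n + j) x)))"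
        using fin\<K> ne\<K> by (intro Max.boundedI) auto
    qed (use r0 in simp)
    also have "\<dots> = M + (\<Sum>j\<in>{1..p}. \<phi> (n + j) r - circle_mean (\<lambda>x. ln (cmod (U (n + j) x))) r)"
    proof -
      have "circle_mean (\<lambda>x. \<Sum>j\<in>{1..p}. \<phi> (n + j) r - ln (cmod (U (n + j) x))) r =
        (\<Sum>j\<in>{1..p}. circle_mean (\<lambda>x. \<phi> (n + j) r - ln (cmod (U (n + j) x))) r)"
        by (intro circle_mean_sum continuous_on_diff continuous_on_const contj) (use r0 in auto)
      also have "\<dots> = (\<Sum>j\<in>{1..p}. \<phi> (n + j) r - circle_mean (\<lambda>x. ln (cmod (U (n + j) x))) r)"
      proof (rule sum.cong[OF refl])
        fix j assume "j \<in> {1..p}"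
        from circle_mean_diff[OF continuous_on_const contj[OF this]] r0
        show "circle_mean (\<lambda>x. \<phi> (n + j) r - ln (cmod (U (n + j) x))) r =
          \<phi> (n + j) r - circle_mean (\<lambda>x. ln (cmod (U (n + j) x))) r" by simp
      qed
      finally show ?thesis
        using r0 by (subst circle_mean_add)
          (auto intro!: continuous_on_sum continuous_on_diff continuous_on_const contj)
    qed
    also have "\<dots> \<le> M + (\<Sum>j\<in>{1..p}. 18 * e)"
      by (intro add_left_mono sum_mono mean') auto
    finally have mbound: "circle_mean m r \<le> M + 18 * real p * e" by simp
    \<comment> \<open>The counting bound for the same optimal set: its sum is \<open>- M\<close> and
      cancels the bound of the integrated maximum.\<close>
    have "count_N ?W r \<le> (\<Sum>j\<in>K0. \<phi> (n + j) r - \<Phi> r) + real (n + 1) * \<Phi> r + real (n + 1) * (6 * e) + cN K0 * (1 + ln r)"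
      by (rule cN(2)[OF K0(1)]) (use r1 r0 e0 W_r Ce in auto)
    also have "(\<Sum>j\<in>K0. \<phi> (n + j) r - \<Phi> r) = - M" unfolding K0(2) by (simp add: sum_negf[symmetric])
    also have "cN K0 * (1 + ln r) \<le> cs * (1 + ln r)" using csN[OF K0(1)] lr0 by (intro mult_right_mono) auto
    also have "real (n + 1) * \<Phi> r \<le> real (n + 1) * (t + 12 * e)" using \<Phi>t by (intro mult_left_mono) auto
    finally have total: "circle_mean m r + count_N ?W r \<le> real (n + 1) * t + A * e + cs * (1 + ln r)"
      using mbound by (simp add: A_def algebra_simps)
    define Tr where "Tr = char_T n fs r"
    have tT: "t = Tr - b" using T by (simp add: Tr_def)
    have A0: "0 \<le> A" by (simp add: A_def)
    have Tc: "t + 2 * cs \<le> Tr + c2" "0 \<le> Tr + c2" using tc by (auto simp: tT c2_def)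
    have c20: "0 \<le> c2" using cs0 by (simp add: c2_def)
    have "A * e = A * \<epsilon> * (t + 2 * cs)" by (simp add: e_def)
    also have "\<dots> \<le> A * \<epsilon> * (Tr + c2)" using Tc A0 eps by (intro mult_left_mono mult_nonneg_nonneg) auto
    also have "\<dots> \<le> Cf * \<epsilon> * (Tr + c2)" using Tc eps cs0 by (intro mult_right_mono) (auto simp: Cf_def)
    also have "\<dots> = Cf * (\<epsilon> * Tr) + Cf * c2 * \<epsilon>" by (simp add: algebra_simps)
    also have "Cf * c2 * \<epsilon> \<le> Cf * c2 * 1" using eps cs0 A0 c20 by (intro mult_left_mono) (auto simp: Cf_def)
    finally have Ae: "A * e \<le> Cf * (\<epsilon> * Tr) + Cf * c2" by simp
    have nb: "real (n + 1) * t \<le> real (n + 1) * Tr + real (n + 1) * \<bar>b\<bar>"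
      unfolding distrib_left[symmetric] by (intro mult_left_mono) (auto simp: tT)
    have "Dl + cs * ln r \<le> Cf * ln r"
    proof -
      have "0 \<le> A * ln r" using A0 lr0 by simp
      then show ?thesis using lr(2) by (simp add: Cf_def distrib_right)
    qed
    then have "circle_mean m r + count_N ?W r \<le> real (n + 1) * Tr + Cf * (\<epsilon> * Tr) + Cf * ln r"
      using total Ae nb by (simp add: Dl_def distrib_left)
    then show ?thesis by (simp add: Tr_def \<epsilon>_def)
  qed
  then show ?thesis
    using Fexc unfolding log_exceptional_def circle_mean_def m_def \<K>_def
    by (intro exI[of _ F] exI[of _ Cf] exI[of _ Rf]) auto
qed

end
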